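(* Let $k$ be a field and let $m,n\ge4$. If $\operatorname{char}k\ne2,3$, then all minimal primes over $I_3(m,n)$ are of type $(1)$, $(2)$, $(3)$, $(3A)$, or $(2,2)$. If $\operatorname{char}k=3$, then another minimal prime over $I_3(m,n)$ is the ideal generated by the $2\times2$ minors of the generic $m\times n$ matrix $M_{m,n}$.
   Context: The permanent of a $t\times t$ matrix $(a_{i,j})$ over a commutative ring is $\sum_{\sigma\in S_t}a_{1,\sigma(1)}\cdots a_{t,\sigma(t)}$. $M=M_{m,n}=(x_{i,j})$ is the generic $m\times n$ matrix of independent indeterminates over $k$, and $I_3(m,n)\subset k[x_{i,j}]$ is the ideal generated by the permanents of all $3\times3$ submatrices of $M$. The types of primes, for $3\times3$ permanents of the $m\times n$ matrix $M$, are: Type $(1)$: the ideal generated by all the entries of some $m'\times n'$ submatrix $M'$ of $M$ with $m'+n'=m+n-2$. Type $(2)$: the ideal generated by the permanent of some $2\times2$ submatrix of $M'$ and all the entries of $M'$ outside this $2\times2$ submatrix, where $M'$ is some $m'\times n'$ submatrix of $M$ with $m'+n'=m+n-1$. Type $(3)$: the ideal generated by the permanent of some $3\times3$ submatrix of $M$ and all the entries of $M$ outside this submatrix. Type $(2,2)$: the ideal generated by the permanents of two $2\times2$ submatrices of $M$, having disjoint row sets and disjoint column sets, and all the entries of $M$ outside these two submatrices. Type $(3A)$: a prime is of type $(3A)$ if it contains the ideal $J_3$ for some $3\times4$ or $4\times3$ submatrix of $M$ and all the entries of $M$ outside this submatrix. Here, for a $3\times4$ matrix $N=(y_{r,p})$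 of indeterminates, $J_3$ is defined as follows (for a $4\times3$ matrix, use its transpose). Let $P_q$ be the permanent of the $3\times3$ matrix obtained from $N$ by omitting column $q$, and for $1\le r\le3$, $1\le p,q\le4$ let $B_{r,p,q}=\partial P_q/\partial y_{r,p}$ (so $B_{r,p,p}=0$, and for $p\neq q$ it is the $2\times2$ permanent of $N$ omitting row $r$ and columns $p,q$). For each $p\in\{1,\dots,4\}$ let $f_p$ be the determinant of the $3\times3$ matrix obtained from the $3\times4$ matrix with $(r,q)$ entry $B_{r,q,p}$ by omitting its $p$-th column (which is zero). For each $r\in\{1,2,3\}$ let $g_r$ be the determinant of the symmetric $4\times4$ matrix with $(p,q)$ entry $B_{r,p,q}$. Then $J_3=\langle P_1,\dots,P_4,f_1,\dots,f_4,g_1,g_2,g_3\rangle$. *)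

theory Defs
  imports
    "HOL-Library.Cardinality"
    "HOL-Library.Poly_Mapping"
    "HOL-Algebra.Algebraic_Closure_Type"
    "Jordan_Normal_Form.Determinant"
    "Jordan_Normal_Form.DL_Submatrix"
begin

text \<open>
  Polynomials over \<open>'k\<close> in indeterminates indexed by \<open>'v\<close> are finitely supported maps from
  monomials (exponent vectors \<open>'v \<Rightarrow>\<^sub>0 nat\<close>) to coefficients, with the ring structure of
  \<^theory>\<open>HOL-Library.Poly_Mapping\<close>.
\<close>

type_synonym ('v, 'k) mpoly = "('v \<Rightarrow>\<^sub>0 nat) \<Rightarrow>\<^sub>0 'k"

definition indet :: "'v \<Rightarrow> ('v, 'k::zero_neq_one) mpoly" where
  "indet v = Poly_Mapping.single (Poly_Mapping.single v 1) 1"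

text \<open>The formal partial derivative; the truncated subtraction of exponents is harmless, since
  the coefficient of the term vanishes when the exponent of \<open>v\<close> is zero.\<close>

definition pderivative :: "'v \<Rightarrow> ('v, 'k::comm_ring_1) mpoly \<Rightarrow> ('v, 'k) mpoly" where
  "pderivative v p =
     (\<Sum>t\<in>Poly_Mapping.keys p.
        Poly_Mapping.single (t - Poly_Mapping.single v 1)
          (of_nat (Poly_Mapping.lookup t v) * Poly_Mapping.lookup p t))"

definition permanent :: "'a::comm_ring_1 mat \<Rightarrow> 'a" where
  "permanent A =
     (\<Sum>\<sigma>\<in>{\<sigma>. \<sigma> permutes {0..<dim_row A}}. \<Prod>i = 0..<dim_row A. A $$ (i, \<sigma> i))"


subsection \<open>Ideals\<close>

abbreviation ideal_gen :: "'a::comm_ring_1 set \<Rightarrow> 'a set" where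
  "ideal_gen S \<equiv> Idl\<^bsub>ring_of_type_algebra\<^esub> S"

abbreviation prime_ideal :: "'a::comm_ring_1 set \<Rightarrow> bool" where
  "prime_ideal P \<equiv> primeideal P ring_of_type_algebra"

definition minimal_prime_over :: "'a::comm_ring_1 set \<Rightarrow> 'a set \<Rightarrow> bool" where
  "minimal_prime_over I P \<longleftrightarrow>
     prime_ideal P \<and> I \<subseteq> P \<and> (\<forall>Q. prime_ideal Q \<and> I \<subseteq> Q \<and> Q \<subseteq> P \<longrightarrow> Q = P)"


subsection \<open>Submatrices of the generic matrix\<close>

text \<open>
  The generic matrix \<open>M\<close> has rows indexed by a finite type \<open>'m\<close> and columns indexed by a finite
  type \<open>'n\<close>, its \<open>(i, j)\<close> entry being \<open>indet (i, j)\<close>; so \<open>m = CARD('m)\<close> and \<open>n = CARD('n)\<close>.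
  A submatrix is given by the distinct lists of its row and column indices, each in any order:
  reordering leaves permanents unchanged and alters determinants at most in sign, so none of the
  ideals below depends on the order.
\<close>

definition sub_indices :: "'m list \<Rightarrow> 'n list \<Rightarrow> ('m \<times> 'n) mat" where
  "sub_indices rs cs = mat (length rs) (length cs) (\<lambda>(i, j). (rs ! i, cs ! j))"

definition generic_sub :: "'m list \<Rightarrow> 'n list \<Rightarrow> ('m \<times> 'n, 'k::zero_neq_one) mpoly mat" where
  "generic_sub rs cs = map_mat indet (sub_indices rs cs)"

definition index_list :: "nat \<Rightarrow> 'a list \<Rightarrow> bool" where
  "index_list t xs \<longleftrightarrow> distinct xs \<and> length xs = t"

definition permanental_ideal :: "nat \<Rightarrow> ('m \<times> 'n, 'k::field) mpoly set" where
  "permanental_ideal t =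
     ideal_gen {permanent (generic_sub rs cs) | rs cs. index_list t rs \<and> index_list t cs}"

definition determinantal_ideal :: "nat \<Rightarrow> ('m \<times> 'n, 'k::field) mpoly set" where
  "determinantal_ideal t =
     ideal_gen {det (generic_sub rs cs) | rs cs. index_list t rs \<and> index_list t cs}"


subsection \<open>The ideal \<open>J\<^sub>3\<close> of a \<open>3 \<times> 4\<close> matrix of indeterminates\<close>

text \<open>The argument \<open>Y\<close> is the matrix of the indices of the indeterminates; rows and columns
  are counted from \<open>0\<close>.\<close>

definition J3_P :: "'v mat \<Rightarrow> nat \<Rightarrow> ('v, 'k::field) mpoly" where
  "J3_P Y q = permanent (submatrix (map_mat indet Y) UNIV (- {q}))"

definition J3_B :: "'v mat \<Rightarrow> nat \<Rightarrow> nat \<Rightarrow> nat \<Rightarrow> ('v, 'k::field) mpoly" where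
  "J3_B Y r p q = pderivative (Y $$ (r, p)) (J3_P Y q)"

definition J3_f :: "'v mat \<Rightarrow> nat \<Rightarrow> ('v, 'k::field) mpoly" where
  "J3_f Y p = det (submatrix (mat 3 4 (\<lambda>(r, q). J3_B Y r q p)) UNIV (- {p}))"

definition J3_g :: "'v mat \<Rightarrow> nat \<Rightarrow> ('v, 'k::field) mpoly" where
  "J3_g Y r = det (mat 4 4 (\<lambda>(p, q). J3_B Y r p q))"

definition J3 :: "'v mat \<Rightarrow> ('v, 'k::field) mpoly set" where
  "J3 Y = ideal_gen (J3_P Y ` {..<4} \<union> J3_f Y ` {..<4} \<union> J3_g Y ` {..<3})"


subsection \<open>The types of primes\<close>

definition type_1 :: "('m::finite \<times> 'n::finite, 'k::field) mpoly set \<Rightarrow> bool" where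
  "type_1 P \<longleftrightarrow>
     (\<exists>(R :: 'm set) (C :: 'n set). card R + card C + 2 = CARD('m) + CARD('n) \<and>
        P = ideal_gen (indet ` (R \<times> C)))"

definition type_2 :: "('m::finite \<times> 'n::finite, 'k::field) mpoly set \<Rightarrow> bool" where
  "type_2 P \<longleftrightarrow>
     (\<exists>(R :: 'm set) (C :: 'n set) rs cs. card R + card C + 1 = CARD('m) + CARD('n) \<and>
        index_list 2 rs \<and> index_list 2 cs \<and> set rs \<subseteq> R \<and> set cs \<subseteq> C \<and>
        P = ideal_gen ({permanent (generic_sub rs cs)} \<union>
                       indet ` (R \<times> C - set rs \<times> set cs)))"

definition type_3 :: "('m::finite \<times> 'n::finite, 'k::field) mpoly set \<Rightarrow> bool" where
  "type_3 P \<longleftrightarrow>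
     (\<exists>(rs :: 'm list) (cs :: 'n list). index_list 3 rs \<and> index_list 3 cs \<and>
        P = ideal_gen ({permanent (generic_sub rs cs)} \<union> indet ` (- (set rs \<times> set cs))))"

definition type_2_2 :: "('m::finite \<times> 'n::finite, 'k::field) mpoly set \<Rightarrow> bool" where
  "type_2_2 P \<longleftrightarrow>
     (\<exists>(rs :: 'm list) (cs :: 'n list) rs' cs'.
        index_list 2 rs \<and> index_list 2 cs \<and> index_list 2 rs' \<and> index_list 2 cs' \<and>
        set rs \<inter> set rs' = {} \<and> set cs \<inter> set cs' = {} \<and>
        P = ideal_gen ({permanent (generic_sub rs cs), permanent (generic_sub rs' cs')} \<union>
                       indet ` (- (set rs \<times> set cs \<union> set rs' \<times> set cs'))))"

definition type_3A :: "('m::finite \<times> 'n::finite, 'k::field) mpoly set \<Rightarrow> bool" where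
  "type_3A P \<longleftrightarrow> prime_ideal P \<and>
     (\<exists>(rs :: 'm list) (cs :: 'n list).
        (index_list 3 rs \<and> index_list 4 cs \<and> J3 (sub_indices rs cs) \<subseteq> P \<or>
         index_list 4 rs \<and> index_list 3 cs \<and> J3 (transpose_mat (sub_indices rs cs)) \<subseteq> P) \<and>
        indet ` (- (set rs \<times> set cs)) \<subseteq> P)"

end

theory Submission
  imports Defs "HOL-Computational_Algebra.Fraction_Field"
begin

text \<open>
  Let \<open>P\<close> be a minimal prime and let \<open>y\<close> be the generic matrix over the residue field of \<open>P\<close>.  All its
  \<open>3 \<times> 3\<close> permanents vanish: the product of three distinct rows is zero when the rows are read as
  linear forms in \<open>k[e\<^sub>a]/(e\<^sub>a\<^sup>2)\<close>.  Multiplication by a row \<open>u\<close> with at least five nonzero entries is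
  injective in degree two when \<open>2\<close> and \<open>3\<close> are invertible, so any two other rows have product zero,
  and a matrix whose \<open>2 \<times> 2\<close> permanents vanish is supported on a line or on a \<open>2 \<times> 2\<close> block.  If \<open>u\<close>
  has four or three nonzero entries, the small kernel of the multiplication forces either the same
  conclusion or that the matrix lives in the columns where \<open>u\<close> is nonzero.  If no row or column has
  more than two nonzero entries, the support is a union of paths and cycles, and is inspected
  directly.  So \<open>P\<close> contains one of the ideals of types (1), (2), (3), (2,2), which are prime and
  contain all the permanents, or else \<open>y\<close> vanishes outside a \<open>3 \<times> 4\<close> or \<open>4 \<times> 3\<close> submatrix.  In the
  latter case, if no row or column of that submatrix is zero, these rows and columns are kernel
  vectors of the matrices defining the \<open>g\<^sub>r\<close> and the \<open>f\<^sub>p\<close>, so \<open>J\<^sub>3\<close> is contained in \<open>P\<close>.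

  In characteristic three, the permanent of a rank one \<open>3 \<times> 3\<close> matrix is \<open>6\<close> times a product, hence
  zero.  Minimality holds because the permanents generate the ideal of \<open>2 \<times> 2\<close> minors locally.
\<close>

subsection \<open>Triple products of vectors\<close>

text \<open>The invertibility of 2 and 3 enters through one linear system. Scale the nonzero entries
  of \<open>u\<close> to 1 and write c for the product of \<open>v\<close> and \<open>w\<close>. On
  the support of \<open>u\<close>, the vanishing of the triple product says c_ab + c_ac + c_bc = 0
  for all triples. Four indices give, after division by 2, equal values of c on complementary pairs;
  a fifth index gives c_ab = c_cd = c_ce = c_de and so 3 c_ab = 0. With exactly four nonzero entries
  a two-dimensional kernel remains, described by p, q, r with p + q + r = 0; it is the source of the
  3 x 4 pattern. Support arguments do not bound the number of rows in that case, and a simultaneous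
  diagonalisation does it instead. The primes of types (1), (2), (3) and (2,2) arise from ideals of
  indeterminates by adjoining, one at a time, a polynomial that is linear in an indeterminate absent
  from the other generators. This reduces their primality to one statement about Q X + R.\<close>

text \<open>
  Read vectors as linear forms in the ring \<open>k[e\<^sub>a]/(e\<^sub>a\<^sup>2)\<close>.  Then \<open>pairing v w\<close> and \<open>tripling u v w\<close> are the
  coefficients of \<open>v w\<close> and \<open>u v w\<close>, and a matrix has vanishing \<open>3 \<times> 3\<close> permanents iff the product
  of any three distinct rows is zero.
\<close>

definition pairing :: "('c \<Rightarrow> 'a::comm_ring_1) \<Rightarrow> ('c \<Rightarrow> 'a) \<Rightarrow> 'c \<Rightarrow> 'c \<Rightarrow> 'a" where
  "pairing v w a b = v a * w b + v b * w a"

definition tripling :: "('c \<Rightarrow> 'a::comm_ring_1) \<Rightarrow> ('c \<Rightarrow> 'a) \<Rightarrow> ('c \<Rightarrow> 'a) \<Rightarrow> 'c \<Rightarrow> 'c \<Rightarrow> 'c \<Rightarrow> 'a" where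
  "tripling u v w a b c =
     u a * pairing v w b c + u b * pairing v w a c + u c * pairing v w a b"

definition tri_null :: "('c \<Rightarrow> 'a::comm_ring_1) \<Rightarrow> ('c \<Rightarrow> 'a) \<Rightarrow> ('c \<Rightarrow> 'a) \<Rightarrow> bool" where
  "tri_null u v w \<longleftrightarrow> (\<forall>a b c. a \<noteq> b \<longrightarrow> a \<noteq> c \<longrightarrow> b \<noteq> c \<longrightarrow> tripling u v w a b c = 0)"

definition pair_null :: "('c \<Rightarrow> 'a::comm_ring_1) \<Rightarrow> ('c \<Rightarrow> 'a) \<Rightarrow> bool" where
  "pair_null v w \<longleftrightarrow> (\<forall>a b. a \<noteq> b \<longrightarrow> pairing v w a b = 0)"

lemma pairing_commute: "pairing v w a b = pairing w v a b"
  by (simp add: pairing_def algebra_simps)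

lemma pairing_swap: "pairing v w a b = pairing v w b a"
  by (simp add: pairing_def algebra_simps)

lemma tri_nullD:
  "tri_null u v w \<Longrightarrow> a \<noteq> b \<Longrightarrow> a \<noteq> c \<Longrightarrow> b \<noteq> c \<Longrightarrow>
     u a * pairing v w b c + u b * pairing v w a c + u c * pairing v w a b = 0"
  unfolding tri_null_def tripling_def by blast

section \<open>Multiplication by a row with several nonzero entries\<close>

context
  fixes u v w :: "'c \<Rightarrow> 'f::field"
  assumes two: "(2::'f) \<noteq> 0" and three: "(3::'f) \<noteq> 0"
    and uvw: "tri_null u v w"
begin

text \<open>For \<open>p\<close>, \<open>q\<close>, \<open>r\<close> in the support of
  \<open>u\<close>, the triples made of \<open>j\<close> and two of them give three linear equations
  for the products at (p,j), (q,j), (r,j), with determinant 2 u_p u_q u_r up to sign. For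
  \<open>i\<close> outside the support the triple \<open>a\<close>, \<open>i\<close>,
  \<open>j\<close> is enough.\<close>

lemma pairing_outside_support:
  assumes "distinct [a, b, c]" "u a \<noteq> 0" "u b \<noteq> 0" "u c \<noteq> 0" and "u j = 0" "i \<noteq> j"
  shows "pairing v w i j = 0"
proof -
  have on: "pairing v w p j = 0"
    if "distinct [p, q, r]" "u p \<noteq> 0" "u q \<noteq> 0" "u r \<noteq> 0" for p q r
  proof -
    have j: "p \<noteq> j" "q \<noteq> j" "r \<noteq> j" using that assms by auto
    have 1: "u p * pairing v w q j + u q * pairing v w p j = 0"
      using tri_nullD[OF uvw, of p q j] that j assms(5) by simp
    have 2: "u p * pairing v w r j + u r * pairing v w p j = 0"
      using tri_nullD[OF uvw, of p r j] that j assms(5) by simp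
    have 3: "u q * pairing v w r j + u r * pairing v w q j = 0"
      using tri_nullD[OF uvw, of q r j] that j assms(5) by simp
    have "2 * u q * u r * pairing v w p j = 0"
      using 1 2 3 by Groebner_Basis.algebra
    then show ?thesis using two that by simp
  qed
  show ?thesis
  proof (cases "u i = 0")
    case True
    then have "u a * pairing v w i j = 0"
      using tri_nullD[OF uvw, of a i j] assms by (metis add.right_neutral mult_zero_left)
    then show ?thesis using assms by simp
  next
    case False
    then consider "distinct [i, a, b]" | "distinct [i, a, c]" | "distinct [i, b, c]"
      using assms(1) by auto
    then show ?thesis by cases (use on False assms in blast)+
  qed
qed

text \<open>With \<open>u\<close> scaled to 1 this reads c_ab = c_cd: adding the equations of the
  two triples that contain \<open>a\<close> and \<open>b\<close> and subtracting the other two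
  leaves 2 (c_ab - c_cd).\<close>

lemma pairing_opposite:
  assumes "distinct [a, b, c, d]" "u a \<noteq> 0" "u b \<noteq> 0" "u c \<noteq> 0" "u d \<noteq> 0"
  shows "pairing v w a b * (u c * u d) = pairing v w c d * (u a * u b)"
proof -
  have 1: "u a * pairing v w b c + u b * pairing v w a c + u c * pairing v w a b = 0"
    using tri_nullD[OF uvw, of a b c] assms by simp
  have 2: "u a * pairing v w b d + u b * pairing v w a d + u d * pairing v w a b = 0"
    using tri_nullD[OF uvw, of a b d] assms by simp
  have 3: "u a * pairing v w c d + u c * pairing v w a d + u d * pairing v w a c = 0"
    using tri_nullD[OF uvw, of a c d] assms by simp
  have 4: "u b * pairing v w c d + u c * pairing v w b d + u d * pairing v w b c = 0"
    using tri_nullD[OF uvw, of b c d] assms by simp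
  have "2 * (pairing v w a b * (u c * u d) - pairing v w c d * (u a * u b)) = 0"
    using 1 2 3 4 by Groebner_Basis.algebra
  then show ?thesis using two by simp
qed

text \<open>The pair {a, b} is opposite to all three pairs inside {c, d, e}; the triple equation for
  \<open>c\<close>, \<open>d\<close>, \<open>e\<close> therefore adds up the same scaled value three
  times.\<close>

lemma pairing_five:
  assumes "distinct [a, b, c, d, e]" "u a \<noteq> 0" "u b \<noteq> 0" "u c \<noteq> 0" "u d \<noteq> 0" "u e \<noteq> 0"
  shows "pairing v w a b = 0"
proof -
  have 1: "pairing v w a b * (u c * u d) = pairing v w c d * (u a * u b)"
    using pairing_opposite[of a b c d] assms by simp
  have 2: "pairing v w a b * (u c * u e) = pairing v w c e * (u a * u b)"
    using pairing_opposite[of a b c e] assms by simp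
  have 3: "pairing v w a b * (u d * u e) = pairing v w d e * (u a * u b)"
    using pairing_opposite[of a b d e] assms by simp
  have 4: "u c * pairing v w d e + u d * pairing v w c e + u e * pairing v w c d = 0"
    using tri_nullD[OF uvw, of c d e] assms by simp
  have "3 * (u c * u d * u e) * pairing v w a b = 0"
    using 1 2 3 4 by Groebner_Basis.algebra
  then show ?thesis using three assms by simp
qed


text \<open>Vanishing against \<open>j\<close> makes \<open>w\<close> equal to - w_j / v_j times
  \<open>v\<close> away from \<open>j\<close>, so the product of the two is a multiple of the square
  of \<open>v\<close> there. The multiple is nonzero because the product is nonzero somewhere,
  necessarily away from \<open>j\<close>.\<close>

lemma proportional_off:
  assumes "v j \<noteq> 0" and j: "\<And>i. i \<noteq> j \<Longrightarrow> pairing v w i j = 0"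
    and "a \<noteq> b" "pairing v w a b \<noteq> 0"
  obtains l where "l \<noteq> 0" "\<And>i k. i \<noteq> j \<Longrightarrow> k \<noteq> j \<Longrightarrow> pairing v w i k = l * v i * v k"
proof -
  have eq: "w i * v j = - (v i * w j)" if "i \<noteq> j" for i
    using j[OF that] by (simp add: pairing_def eq_neg_iff_add_eq_0 algebra_simps)
  define l where "l = - 2 * w j / v j"
  have w: "w i = - (w j / v j) * v i" if "i \<noteq> j" for i
    using eq[OF that] assms(1) by (simp add: field_simps)
  have *: "pairing v w i k = l * v i * v k" if "i \<noteq> j" "k \<noteq> j" for i k
    using w[OF that(1)] w[OF that(2)] by (simp add: pairing_def l_def algebra_simps)
  have ab: "a \<noteq> j" "b \<noteq> j" using assms j pairing_swap by metis+
  then have "l \<noteq> 0" using *[OF ab] assms(4) by auto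
  with * show ?thesis by (rule that[rotated])
qed

text \<open>If v_j were nonzero, the product would be a multiple of the square of \<open>v\<close>
  on the support of \<open>u\<close>. The scaled entries \<open>s\<close> then satisfy so many
  equations that all products of two of them vanish, against the nonzero value at \<open>p\<close>,
  \<open>q\<close>.\<close>

lemma null_four_inside:
  assumes U: "distinct [a, b, c, d]" "u a \<noteq> 0" "u b \<noteq> 0" "u c \<noteq> 0" "u d \<noteq> 0"
    and out: "\<And>i. i \<notin> {a, b, c, d} \<Longrightarrow> u i = 0"
    and nz: "p \<noteq> q" "pairing v w p q \<noteq> 0"
    and j: "j \<notin> {a, b, c, d}"
  shows "v j = 0"
proof (rule ccontr)
  assume vj: "v j \<noteq> 0"
  have o: "pairing v w i k = 0" if "k \<notin> {a, b, c, d}" "i \<noteq> k" for i k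
    using pairing_outside_support[of a b c k i] U out that by auto
  obtain l where l: "l \<noteq> 0" "\<And>i k. i \<noteq> j \<Longrightarrow> k \<noteq> j \<Longrightarrow> pairing v w i k = l * v i * v k"
    using proportional_off[OF vj o[OF j] nz] by metis
  have jn: "a \<noteq> j" "b \<noteq> j" "c \<noteq> j" "d \<noteq> j" using j by auto
  define s where "s i = v i / u i" for i
  have s: "v i = s i * u i" if "u i \<noteq> 0" for i using that by (simp add: s_def)
  have opp: "s x * s y = s z * s t"
    if "distinct [x, y, z, t]" "u x \<noteq> 0" "u y \<noteq> 0" "u z \<noteq> 0" "u t \<noteq> 0"
      "x \<noteq> j" "y \<noteq> j" "z \<noteq> j" "t \<noteq> j" for x y z t
  proof -
    have "l * v x * v y * (u z * u t) = l * v z * v t * (u x * u y)"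
      using pairing_opposite[of x y z t] l(2) that by simp
    then have "(l * u x * u y * u z * u t) * (s x * s y) = (l * u x * u y * u z * u t) * (s z * s t)"
      using that by (simp add: s algebra_simps)
    then show ?thesis using that l(1) by simp
  qed
  have "u a * (l * v b * v c) + u b * (l * v a * v c) + u c * (l * v a * v b) = 0"
    using tri_nullD[OF uvw, of a b c] l(2) jn U by simp
  then have "(l * u a * u b * u c) * (s b * s c + s a * s c + s a * s b) = 0"
    using U by (simp add: s algebra_simps)
  then have sum: "s b * s c + s a * s c + s a * s b = 0" using U l(1) by simp
  have 1: "s a * s b = s c * s d" and 2: "s a * s c = s b * s d" and 3: "s a * s d = s b * s c"
    using opp[of a b c d] opp[of a c b d] opp[of a d b c] U jn by auto
  \<comment> \<open>Each of these squares equals the product of all four values of \<open>s\<close>.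
    So the three pair products agree up to sign, and their sum is 1 or 3 times
    \<open>s a * s b\<close> up to sign.\<close>
  have "(s a * s b) * (s a * s b) = (s a * s c) * (s a * s c)"
    using 1 2 by Groebner_Basis.algebra
  moreover have "(s a * s b) * (s a * s b) = (s b * s c) * (s b * s c)"
    using 1 2 3 by Groebner_Basis.algebra
  ultimately have sg: "s a * s c = s a * s b \<or> s a * s c = - (s a * s b)"
      "s b * s c = s a * s b \<or> s b * s c = - (s a * s b)"
    by (metis square_eq_iff)+
  have ab0: "s a * s b = 0"
  proof (rule ccontr)
    assume x: "s a * s b \<noteq> 0"
    have "s a * s b + s a * s b + s a * s b = 3 * (s a * s b)" by (simp add: algebra_simps)
    then have "s a * s b + s a * s b + s a * s b \<noteq> 0" using x three by simp
    then show False using sum sg x by (auto simp: add.commute)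
  qed
  then have "s a * s c = 0" "s b * s c = 0" using sg by auto
  then have z: "s x * s y = 0" if "x \<in> {a, b, c, d}" "y \<in> {a, b, c, d}" "x \<noteq> y" for x y
    using that ab0 1 2 3 by (auto simp: mult.commute)
  have "p \<in> {a, b, c, d}" "q \<in> {a, b, c, d}" using o nz pairing_swap by metis+
  then have "v p * v q = 0" using z[of p q] nz(1) s U by auto
  moreover have "p \<noteq> j" "q \<noteq> j" using o j nz pairing_swap by metis+
  ultimately show False using l(2)[of p q] nz by (simp add: mult.assoc)
qed

text \<open>If v_j is nonzero, then so are v_p and v_q, and \<open>v3\<close> makes the third
  support entry of \<open>v\<close> vanish; the triple equation for \<open>a\<close>,
  \<open>b\<close>, \<open>c\<close> is then a single nonzero term. In use, \<open>v3\<close> comes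
  from the bound of three nonzero entries in the row \<open>v\<close>.\<close>

lemma null_three_inside:
  assumes U: "distinct [a, b, c]" "u a \<noteq> 0" "u b \<noteq> 0" "u c \<noteq> 0"
    and out: "\<And>i. i \<notin> {a, b, c} \<Longrightarrow> u i = 0"
    and nz: "p \<noteq> q" "pairing v w p q \<noteq> 0"
    and j: "j \<notin> {a, b, c}" and v3: "v a = 0 \<or> v b = 0 \<or> v c = 0 \<or> v j = 0"
  shows "v j = 0"
proof (rule ccontr)
  assume vj: "v j \<noteq> 0"
  have o: "pairing v w i k = 0" if "k \<notin> {a, b, c}" "i \<noteq> k" for i k
    using pairing_outside_support[of a b c k i] U out that by auto
  obtain l where l: "l \<noteq> 0" "\<And>i k. i \<noteq> j \<Longrightarrow> k \<noteq> j \<Longrightarrow> pairing v w i k = l * v i * v k"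
    using proportional_off[OF vj o[OF j] nz] by metis
  have jn: "a \<noteq> j" "b \<noteq> j" "c \<noteq> j" using j by auto
  have "p \<in> {a, b, c}" "q \<in> {a, b, c}" using o nz pairing_swap by metis+
  moreover have "v p \<noteq> 0" "v q \<noteq> 0" using l(2)[of p q] nz o j pairing_swap
    by (metis mult_zero_left mult_zero_right)+
  moreover have "u a * (l * v b * v c) + u b * (l * v a * v c) + u c * (l * v a * v b) = 0"
    using tri_nullD[OF uvw, of a b c] l(2) jn U by simp
  ultimately show False using v3 vj nz(1) l(1) U by auto
qed

end

text \<open>Away from \<open>a\<close>, both \<open>v\<close> and \<open>w\<close> are multiples of
  \<open>z\<close>, with the opposite sign at \<open>a\<close>. So the product of \<open>v\<close>
  and \<open>z\<close> at two indices other than \<open>a\<close> is 2 l z_b z_i, and only one index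
  \<open>b\<close> besides \<open>a\<close> survives.\<close>

lemma pair_null_common:
  fixes v w z :: "'c \<Rightarrow> 'f::field"
  assumes two: "(2::'f) \<noteq> 0" and vz: "pair_null v z" and wz: "pair_null w z" and "z a \<noteq> 0"
    and pq: "p \<noteq> q" "pairing v w p q \<noteq> 0"
  shows "\<exists>b. a \<noteq> b \<and> z b \<noteq> 0 \<and> pairing v w a b \<noteq> 0 \<and>
     (\<forall>i. i \<noteq> a \<longrightarrow> i \<noteq> b \<longrightarrow> v i = 0 \<and> w i = 0 \<and> z i = 0)"
proof -
  define l m where "l = - v a / z a" and "m = - w a / z a"
  have v: "v i = l * z i" if "i \<noteq> a" for i
  proof -
    have "v i * z a = - (v a * z i)"
      using vz that by (simp add: pair_null_def pairing_def eq_neg_iff_add_eq_0)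
    then show ?thesis using assms(4) by (simp add: l_def field_simps)
  qed
  have w: "w i = m * z i" if "i \<noteq> a" for i
  proof -
    have "w i * z a = - (w a * z i)"
      using wz that by (simp add: pair_null_def pairing_def eq_neg_iff_add_eq_0)
    then show ?thesis using assms(4) by (simp add: m_def field_simps)
  qed
  have va: "v a = - l * z a" and wa: "w a = - m * z a"
    using assms(4) by (simp_all add: l_def m_def)
  have "l \<noteq> 0 \<and> m \<noteq> 0 \<and> (\<exists>b. b \<noteq> a \<and> z b \<noteq> 0)"
  proof (cases "p = a \<or> q = a")
    case True
    then show ?thesis using pq v w va wa unfolding pairing_def by fastforce
  next
    case False
    then show ?thesis using pq v w unfolding pairing_def by fastforce
  qed
  then obtain b where b: "l \<noteq> 0" "m \<noteq> 0" "b \<noteq> a" "z b \<noteq> 0" by blast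
  have z0: "z i = 0" if "i \<noteq> a" "i \<noteq> b" for i
  proof -
    have "v b * z i + v i * z b = 0"
      using vz that by (auto simp: pair_null_def pairing_def)
    then have "2 * l * z b * z i = 0" using v[OF b(3)] v[OF that(1)] by (simp add: algebra_simps)
    then show ?thesis using b two by simp
  qed
  have "pairing v w a b = - 2 * l * m * z a * z b"
    using v[OF b(3)] w[OF b(3)] va wa by (simp add: pairing_def algebra_simps)
  then have "pairing v w a b \<noteq> 0" using b two assms(4) by simp
  then show ?thesis using b z0 v w by (intro exI[of _ b]) auto
qed

text \<open>Otherwise \<open>v\<close> and \<open>w\<close> live on two indices \<open>i\<close>,
  \<open>k\<close>, both in the support of \<open>u\<close>. For a third index \<open>j\<close> of
  that support, the triple equation retains only u_j times the product at \<open>i\<close>,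
  \<open>k\<close>.\<close>

lemma null_third_zero:
  fixes u v w z :: "'c \<Rightarrow> 'f::field"
  assumes two: "(2::'f) \<noteq> 0" and three: "(3::'f) \<noteq> 0" and uvw: "tri_null u v w"
    and U: "distinct [a, b, c]" "u a \<noteq> 0" "u b \<noteq> 0" "u c \<noteq> 0"
    and vz: "pair_null v z" and wz: "pair_null w z"
    and pq: "p \<noteq> q" "pairing v w p q \<noteq> 0"
  shows "z i = 0"
proof (rule ccontr)
  assume "z i \<noteq> 0"
  from pair_null_common[OF two vz wz this pq] obtain k where k: "i \<noteq> k" "pairing v w i k \<noteq> 0"
    and off: "\<And>j. j \<noteq> i \<Longrightarrow> j \<noteq> k \<Longrightarrow> v j = 0 \<and> w j = 0" by metis
  have "u i \<noteq> 0" "u k \<noteq> 0"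
    using pairing_outside_support[OF two three uvw U] k pairing_swap by metis+
  moreover obtain j where j: "j \<noteq> i" "j \<noteq> k" "u j \<noteq> 0" using U by auto metis
  ultimately show False using tri_nullD[OF uvw k(1), of j] off[OF j(1,2)] k(2)
    by (auto simp: pairing_def)
qed

text \<open>
  The coordinates of three vectors of \<open>k\<^sup>4\<close> in the basis of characters of the Klein four-group.
  If \<open>e = (1, 1, 1, 1)\<close> and \<open>e v w = 0\<close>, then \<open>c = v w\<close> satisfies \<open>c\<^sub>1\<^sub>2 = c\<^sub>3\<^sub>4\<close>, \<open>c\<^sub>1\<^sub>3 = c\<^sub>2\<^sub>4\<close> and
  \<open>c\<^sub>1\<^sub>4 = c\<^sub>2\<^sub>3\<close>, so multiplication by \<open>c\<close> commutes with this group and is diagonal in that basis.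
\<close>

lemma no_three_fourier:
  fixes a1 x1 y1 t1 a2 x2 y2 t2 a3 x3 :: "'f::field"
  assumes two: "(2::'f) \<noteq> 0" and three: "(3::'f) \<noteq> 0"
    and E12: "3 * a1 * a2 = x1 * x2 + y1 * y2 + t1 * t2" "a1 * x2 + a2 * x1 = y1 * t2 + t1 * y2"
    and E13: "3 * a1 * a3 = x1 * x3" "a1 * x3 + a3 * x1 = 0" "a3 * y1 = t1 * x3" "a3 * t1 = y1 * x3"
    and E23: "3 * a2 * a3 = x2 * x3" "a2 * x3 + a3 * x2 = 0" "a3 * y2 = t2 * x3" "a3 * t2 = y2 * x3"
    and v: "a1 \<noteq> 0 \<or> x1 \<noteq> 0 \<or> y1 \<noteq> 0 \<or> t1 \<noteq> 0" and w: "a2 \<noteq> 0 \<or> x2 \<noteq> 0 \<or> y2 \<noteq> 0 \<or> t2 \<noteq> 0"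
    and z: "a3 \<noteq> 0 \<or> x3 \<noteq> 0"
  shows False
proof -
  \<comment> \<open>Determinants of the linear systems contained in \<open>E13\<close> and in
    \<open>E23\<close>: \<open>P\<close> for the unknowns (a1, x1) and (a2, x2), \<open>Q\<close>
    for (y1, t1) and (y2, t2). They cannot both vanish, since their sum is 4 a3^2.\<close>
  define P Q where "P = 3 * a3 * a3 + x3 * x3" and "Q = a3 * a3 - x3 * x3"
  have "(2::'f) * 2 \<noteq> 0" using two by (metis mult_eq_0_iff)
  then have four: "(4::'f) \<noteq> 0" by simp
  have PQ0: "a1 * P = 0" "x1 * P = 0" "a2 * P = 0" "x2 * P = 0"
    "y1 * Q = 0" "t1 * Q = 0" "y2 * Q = 0" "t2 * Q = 0"
    using E13 E23 unfolding P_def Q_def by Groebner_Basis.algebra+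
  have "P \<noteq> 0 \<or> Q \<noteq> 0"
  proof (rule ccontr)
    assume PQ: "\<not> ?thesis"
    moreover have "4 * (a3 * a3) = P + Q" by (simp add: P_def Q_def)
    ultimately have "a3 = 0" using four by auto
    then show False using PQ z by (simp add: P_def)
  qed
  then consider "a1 = 0" "x1 = 0" "a2 = 0" "x2 = 0" "P \<noteq> 0"
    | "y1 = 0" "t1 = 0" "y2 = 0" "t2 = 0" "Q \<noteq> 0" using PQ0 by fastforce
  then show False
  proof cases
    case 1
    have "y1 \<noteq> 0 \<or> t1 \<noteq> 0" "y2 \<noteq> 0 \<or> t2 \<noteq> 0" using v w 1 by auto
    then have "Q = 0" using \<open>y1 * Q = 0\<close> \<open>t1 * Q = 0\<close> by auto
    then have "(x3 - a3) * (x3 + a3) = 0" by (simp add: Q_def algebra_simps)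
    then have "x3 = a3 \<or> x3 = - a3" by (auto simp: eq_neg_iff_add_eq_0)
    moreover have "a3 \<noteq> 0" using z calculation by auto
    ultimately have "(t1 = y1 \<and> t2 = y2) \<or> (t1 = - y1 \<and> t2 = - y2)"
      using E13(4) E23(4) by (auto simp: mult.commute)
        (metis mult.commute mult_cancel_left mult_minus_right)+
    then have "2 * y1 * y2 = 0" using E12(1) 1 by auto
    then show False using two \<open>t1 = y1 \<and> _ \<or> _\<close> \<open>y1 \<noteq> 0 \<or> t1 \<noteq> 0\<close> \<open>y2 \<noteq> 0 \<or> t2 \<noteq> 0\<close> by auto
  next
    case 2
    have "a1 \<noteq> 0 \<or> x1 \<noteq> 0" "a2 \<noteq> 0 \<or> x2 \<noteq> 0" using v w 2 by auto
    have e12: "3 * a1 * a2 = x1 * x2" "a1 * x2 + a2 * x1 = 0" using E12 2 by auto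
    have nz: "a = 0 \<Longrightarrow> x \<noteq> 0 \<Longrightarrow> 3 * a * a' = x * x' \<Longrightarrow> a * x' + a' * x = 0 \<Longrightarrow> a' = 0 \<and> x' = 0"
      for a x a' x' :: 'f by auto
    have a: "a1 \<noteq> 0" "a2 \<noteq> 0" "a3 \<noteq> 0"
      using nz[of a1 x1 a2 x2] nz[of a2 x2 a1 x1] nz[of a3 x3 a1 x1] e12 E13 z
        \<open>a1 \<noteq> 0 \<or> x1 \<noteq> 0\<close> \<open>a2 \<noteq> 0 \<or> x2 \<noteq> 0\<close>
      by (auto simp: ac_simps)
    \<comment> \<open>The three ratios x_i / a_i are pairwise negatives of each other, so all of
      them vanish.\<close>
    have "2 * a1 * a2 * a2 * x3 * a1 = 0"
      using e12(2) E13(2) E23(2) by Groebner_Basis.algebra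
    then have "x3 = 0" using two a by simp
    then show False using E13(1) three a by simp
  qed
qed

text \<open>The first of four rows has been scaled to the constant 1. The product of
  \<open>v\<close> and \<open>w\<close> acts on the four characters with eigenvalues p + q + r = 0,
  2p, 2q and 2r, so \<open>z\<close> has a component along a nontrivial character only where the
  eigenvalue is zero.\<close>

lemma null_four_rows:
  fixes v w z :: "nat \<Rightarrow> 'f::field"
  assumes two: "(2::'f) \<noteq> 0" and three: "(3::'f) \<noteq> 0"
    and vw: "\<And>a b c. a < b \<Longrightarrow> b < c \<Longrightarrow> c < 4 \<Longrightarrow> tripling (\<lambda>_. 1) v w a b c = 0"
    and vz: "\<And>a b c. a < b \<Longrightarrow> b < c \<Longrightarrow> c < 4 \<Longrightarrow> tripling (\<lambda>_. 1) v z a b c = 0"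
    and wz: "\<And>a b c. a < b \<Longrightarrow> b < c \<Longrightarrow> c < 4 \<Longrightarrow> tripling (\<lambda>_. 1) w z a b c = 0"
    and vwz: "\<And>a b c. a < b \<Longrightarrow> b < c \<Longrightarrow> c < 4 \<Longrightarrow> tripling z v w a b c = 0"
    and v: "\<exists>i<4. v i \<noteq> 0" and w: "\<exists>i<4. w i \<noteq> 0" and z: "\<exists>i<4. z i \<noteq> 0"
    and ab: "a < b" "b < 4"
  shows "pairing v w a b = 0"
proof -
  have "(2::'f) * 2 \<noteq> 0" using two by (metis mult_eq_0_iff)
  then have four: "(4::'f) \<noteq> 0" by simp
  define fa where "fa v = v 0 + v 1 + v 2 + v 3" for v :: "nat \<Rightarrow> 'f"
  define fx where "fx v = v 0 + v 1 - v 2 - v 3" for v :: "nat \<Rightarrow> 'f"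
  define fy where "fy v = v 0 - v 1 + v 2 - v 3" for v :: "nat \<Rightarrow> 'f"
  define ft where "ft v = v 0 - v 1 - v 2 + v 3" for v :: "nat \<Rightarrow> 'f"
  note f_defs = fa_def fx_def fy_def ft_def
  have nz: "fa v \<noteq> 0 \<or> fx v \<noteq> 0 \<or> fy v \<noteq> 0 \<or> ft v \<noteq> 0" if ex: "\<exists>i<4. v i \<noteq> 0" for v
  proof (rule ccontr)
    assume "\<not> ?thesis"
    then have "4 * v 0 = 0" "4 * v 1 = 0" "4 * v 2 = 0" "4 * v 3 = 0"
      unfolding f_defs by Groebner_Basis.algebra+
    then have "v 0 = 0" "v 1 = 0" "v 2 = 0" "v 3 = 0" using four by auto
    moreover obtain i where "i < 4" "v i \<noteq> 0" using ex by blast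
    ultimately show False by (auto simp: less_Suc_eq numeral_eq_Suc)
  qed
  have tri: "tripling u v w 0 1 2 = 0" "tripling u v w 0 1 3 = 0" "tripling u v w 0 2 3 = 0"
    "tripling u v w 1 2 3 = 0"
    if "\<And>a b c. a < b \<Longrightarrow> b < c \<Longrightarrow> c < 4 \<Longrightarrow> tripling u v w a b c = 0" for u v w :: "nat \<Rightarrow> 'f"
    using that by auto
  have E: "3 * fa v * fa w = fx v * fx w + fy v * fy w + ft v * ft w"
      "fa v * fx w + fa w * fx v = fy v * ft w + ft v * fy w"
      "fa v * fy w + fa w * fy v = fx v * ft w + ft v * fx w"
      "fa v * ft w + fa w * ft v = fx v * fy w + fy v * fx w"
    if "\<And>a b c. a < b \<Longrightarrow> b < c \<Longrightarrow> c < 4 \<Longrightarrow> tripling (\<lambda>_. 1) v w a b c = 0" for v w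
    using tri[OF that] unfolding tripling_def pairing_def f_defs by Groebner_Basis.algebra+
  define p q r where "p = pairing v w 0 1" and "q = pairing v w 0 2" and "r = pairing v w 0 3"
  have "2 * (pairing v w 2 3 - p) = 0" "2 * (pairing v w 1 3 - q) = 0" "2 * (pairing v w 1 2 - r) = 0"
    using tri[OF vw] unfolding tripling_def p_def q_def r_def by Groebner_Basis.algebra+
  then have opp: "pairing v w 2 3 = p" "pairing v w 1 3 = q" "pairing v w 1 2 = r"
    using two by simp_all
  have sum: "p + q + r = 0"
    using tri(1)[OF vw] opp by (simp add: tripling_def p_def q_def algebra_simps)
  have "2 * (p * fx z) = 0" "2 * (q * fy z) = 0" "2 * (r * ft z) = 0"
    using tri[OF vwz] sum unfolding tripling_def f_defs opp
      p_def[symmetric] q_def[symmetric] r_def[symmetric]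
    by Groebner_Basis.algebra+
  then have pf: "p * fx z = 0" "q * fy z = 0" "r * ft z = 0" using two by simp_all
  note E12 = E[OF vw] and E13 = E[OF vz] and E23 = E[OF wz]
  note nzs = nz[OF v] nz[OF w] nz[OF z]
  \<comment> \<open>If at most one nontrivial component of \<open>z\<close> survived,
    \<open>no_three_fourier\<close> would apply; the three cases permute the roles of x, y and t. So
    two of the eigenvalues vanish, and the third does by \<open>sum\<close>.\<close>
  have "\<not> (fy z = 0 \<and> ft z = 0)"
    using no_three_fourier[OF two three, of "fa v" "fa w" "fx v" "fx w" "fy v" "fy w" "ft v" "ft w"
        "fa z" "fx z"] E12 E13 E23 nzs by (auto simp: ac_simps)
  moreover have "\<not> (fx z = 0 \<and> ft z = 0)"
    using no_three_fourier[OF two three, of "fa v" "fa w" "fy v" "fy w" "fx v" "fx w" "ft v" "ft w"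
        "fa z" "fy z"] E12 E13 E23 nzs by (auto simp: ac_simps)
  moreover have "\<not> (fx z = 0 \<and> fy z = 0)"
    using no_three_fourier[OF two three, of "fa v" "fa w" "ft v" "ft w" "fx v" "fx w" "fy v" "fy w"
        "fa z" "ft z"] E12 E13 E23 nzs by (auto simp: ac_simps)
  ultimately have "p = 0 \<and> q = 0 \<or> p = 0 \<and> r = 0 \<or> q = 0 \<and> r = 0" using pf by auto
  then have "p = 0" "q = 0" "r = 0" using sum by auto
  moreover have "a = 0 \<and> (b = 1 \<or> b = 2 \<or> b = 3) \<or> a = 1 \<and> (b = 2 \<or> b = 3) \<or> a = 2 \<and> b = 3"
    using ab by auto
  ultimately show ?thesis using opp by (auto simp: p_def q_def r_def)
qed

subsection \<open>Zero patterns forced by vanishing permanents\<close>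

definition perm_null :: "('m \<Rightarrow> 'n \<Rightarrow> 'a::comm_ring_1) \<Rightarrow> bool" where
  "perm_null y \<longleftrightarrow> (\<forall>r s t. r \<noteq> s \<longrightarrow> r \<noteq> t \<longrightarrow> s \<noteq> t \<longrightarrow> tri_null (y r) (y s) (y t))"

definition null_without_row :: "('m \<Rightarrow> 'n \<Rightarrow> 'a::comm_ring_1) \<Rightarrow> 'm \<Rightarrow> bool" where
  "null_without_row y r \<longleftrightarrow> (\<forall>s t. s \<noteq> r \<longrightarrow> t \<noteq> r \<longrightarrow> s \<noteq> t \<longrightarrow> pair_null (y s) (y t))"

definition zero_off :: "'m set \<Rightarrow> 'n set \<Rightarrow> ('m \<Rightarrow> 'n \<Rightarrow> 'a::zero) \<Rightarrow> bool" where
  "zero_off R C y \<longleftrightarrow> (\<forall>i j. y i j \<noteq> 0 \<longrightarrow> i \<in> R \<and> j \<in> C)"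

lemma perm_nullD:
  "perm_null y \<Longrightarrow> r \<noteq> s \<Longrightarrow> r \<noteq> t \<Longrightarrow> s \<noteq> t \<Longrightarrow> tri_null (y r) (y s) (y t)"
  unfolding perm_null_def by blast

lemma tripling_transpose:
  "tripling (y r) (y s) (y t) a b c =
     tripling (\<lambda>i. y i a) (\<lambda>i. y i b) (\<lambda>i. y i c) r s t"
  by (simp add: tripling_def pairing_def algebra_simps)

lemma pairing_transpose:
  "pairing (y r) (y s) a b = pairing (\<lambda>i. y i a) (\<lambda>i. y i b) r s"
  by (simp add: pairing_def algebra_simps)

lemma perm_null_transpose:
  assumes "perm_null y"
  shows "perm_null (\<lambda>j i. y i j)"
  using assms tripling_transpose[of y] unfolding perm_null_def tri_null_def by metis

lemma null_without_col_iff: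
  "null_without_row (\<lambda>j i. y i j) c \<longleftrightarrow>
     (\<forall>r s a b. r \<noteq> s \<longrightarrow> a \<noteq> c \<longrightarrow> b \<noteq> c \<longrightarrow> a \<noteq> b \<longrightarrow> pairing (y r) (y s) a b = 0)"
  using pairing_transpose[of y] unfolding null_without_row_def pair_null_def by metis

lemma not_null_without_row:
  assumes "\<not> null_without_row y r"
  obtains v w p q where "v \<noteq> r" "w \<noteq> r" "v \<noteq> w" "p \<noteq> q" "pairing (y v) (y w) p q \<noteq> 0"
  using assms unfolding null_without_row_def pair_null_def by metis

context
  fixes y :: "'m::finite \<Rightarrow> 'n::finite \<Rightarrow> 'f::field"
  assumes two: "(2::'f) \<noteq> 0" and three: "(3::'f) \<noteq> 0" and null: "perm_null y"
begin

text \<open>Two rows with nonzero product are covered by \<open>inside\<close>. A further row either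
  has nonzero product with one of them and is covered as well, or annihilates both and is zero by
  \<open>null_third_zero\<close>.\<close>

lemma null_all_inside:
  assumes nn: "\<not> null_without_row y r"
    and U: "distinct [a, b, c]" "y r a \<noteq> 0" "y r b \<noteq> 0" "y r c \<noteq> 0"
    and inside: "\<And>v w p q j. v \<noteq> r \<Longrightarrow> w \<noteq> r \<Longrightarrow> v \<noteq> w \<Longrightarrow> p \<noteq> q \<Longrightarrow>
      pairing (y v) (y w) p q \<noteq> 0 \<Longrightarrow> y r j = 0 \<Longrightarrow> y v j = 0"
  shows "zero_off UNIV {j. y r j \<noteq> 0} y"
proof -
  obtain v w p q where vw: "v \<noteq> r" "w \<noteq> r" "v \<noteq> w" "p \<noteq> q" "pairing (y v) (y w) p q \<noteq> 0"
    using nn by (rule not_null_without_row)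
  have "y z j = 0" if j: "y r j = 0" for z j
  proof (cases "z = r \<or> z = v \<or> z = w")
    case True
    then show ?thesis
      using j inside[OF vw j] inside[OF vw(2,1) vw(3)[symmetric] vw(4) _ j] vw(5) pairing_commute
      by metis
  next
    case False
    show ?thesis
    proof (cases "pair_null (y v) (y z) \<and> pair_null (y w) (y z)")
      case True
      then show ?thesis
        using null_third_zero[OF two three perm_nullD[OF null] U _ _ vw(4,5)] vw by metis
    next
      case False
      then obtain x p q where "x \<in> {v, w}" "p \<noteq> q" "pairing (y z) (y x) p q \<noteq> 0"
        by (metis insertCI pair_null_def pairing_commute)
      then show ?thesis using inside[of z x p q j] \<open>\<not> (z = r \<or> _)\<close> vw j by auto
    qed
  qed
  then show ?thesis unfolding zero_off_def by auto
qed

text \<open>A fifth nonzero entry in row \<open>r\<close> would make the product of any two other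
  rows vanish, so the support has exactly four columns, and all rows live in them. After scaling,
  \<open>null_four_rows\<close> leaves room for only two more nonzero rows.\<close>

lemma null_four_row:
  assumes "card {j. y r j \<noteq> 0} \<ge> 4" and nn: "\<not> null_without_row y r"
  shows "\<exists>R C. card R \<le> 3 \<and> card C \<le> 4 \<and> zero_off R C y"
proof -
  obtain S where S: "S \<subseteq> {j. y r j \<noteq> 0}" "card S = 4"
    using obtain_subset_with_card_n[OF assms(1)] by metis
  then obtain a b c d where abcd: "S = {a, b, c, d}" "distinct [a, b, c, d]"
    by (auto simp: card_Suc_eq numeral_eq_Suc)
  have U: "y r a \<noteq> 0" "y r b \<noteq> 0" "y r c \<noteq> 0" "y r d \<noteq> 0" using S abcd by auto
  obtain v w p q where vw: "v \<noteq> r" "w \<noteq> r" "v \<noteq> w" "p \<noteq> q" "pairing (y v) (y w) p q \<noteq> 0"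
    using nn by (rule not_null_without_row)
  have supp: "{j. y r j \<noteq> 0} = {a, b, c, d}"
  proof (rule ccontr)
    assume "\<not> ?thesis"
    then obtain e where e: "y r e \<noteq> 0" "e \<notin> {a, b, c, d}" using S abcd by auto
    note rvw = perm_nullD[OF null vw(1)[symmetric] vw(2)[symmetric] vw(3)]
    have "y r p \<noteq> 0" "y r q \<noteq> 0"
      using pairing_outside_support[OF two three rvw _ U(1-3)] abcd vw(4,5) pairing_swap[of "y v" "y w" p q]
      by auto
    \<comment> \<open>Wherever \<open>p\<close> and \<open>q\<close> lie, at least three of the five
      known support indices differ from both, as \<open>pairing_five\<close> requires.\<close>
    moreover have "\<exists>T. card T = 3 \<and> T \<subseteq> {a, b, c, d, e} - {p, q}"
    proof -
      have "card {a, b, c, d, e} = 5" using abcd e by auto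
      moreover have "card {p, q} \<le> 2" by (simp add: card_insert_if)
      ultimately have "card ({a, b, c, d, e} - {p, q}) \<ge> 3"
        using diff_card_le_card_Diff[of "{p, q}" "{a, b, c, d, e}"] by simp
      then show ?thesis using obtain_subset_with_card_n by metis
    qed
    then obtain T where T: "card T = 3" "T \<subseteq> {a, b, c, d, e} - {p, q}" by blast
    from T(1) obtain i j k where "T = {i, j, k}" "i \<noteq> j" "j \<noteq> k" "i \<noteq> k"
      unfolding card_3_iff by blast
    with T(2) have "{i, j, k} \<subseteq> {a, b, c, d, e} - {p, q}" "distinct [i, j, k]" by auto
    ultimately have "pairing (y v) (y w) p q = 0"
      using pairing_five[OF two three rvw, of p q i j k] vw(4) U e by auto
    then show False using vw(5) by simp
  qed
  have inside: "y v j = 0" if "v \<noteq> r" "w \<noteq> r" "v \<noteq> w" "p \<noteq> q" "pairing (y v) (y w) p q \<noteq> 0" "y r j = 0"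
    for v w p q j
    by (rule null_four_inside[OF two three perm_nullD[OF null] abcd(2) U _ that(4,5)])
      (use that supp in blast)+
  have abc: "distinct [a, b, c]" using abcd(2) by simp
  have off: "zero_off UNIV {a, b, c, d} y"
    unfolding supp[symmetric]
    by (rule null_all_inside[OF nn abc U(1-3)]) (erule (5) inside)
  define f where "f i = [a, b, c, d] ! i" for i
  have fS: "f i \<in> {a, b, c, d}" if "i < 4" for i using that by (auto simp: f_def numeral_eq_Suc less_Suc_eq)
  have fr: "y r (f i) \<noteq> 0" if "i < 4" for i using fS[OF that] U by auto
  have fi: "f i \<noteq> f j" if "i < j" "j < 4" for i j
    using that abcd(2) nth_eq_iff_index_eq[of "[a,b,c,d]" i j] by (auto simp: f_def)
  \<comment> \<open>Dividing each column by its entry in row \<open>r\<close> preserves the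
    vanishing of triple products and makes row \<open>r\<close> constant.\<close>
  define g where "g z i = y z (f i) / y r (f i)" for z i
  define h where "h i = y r (f i)" for i
  have h: "h i \<noteq> 0" if "i < 4" for i using fr[OF that] by (simp add: h_def)
  have g: "y z (f i) = g z i * h i" if "i < 4" for z i
    using fr[OF that] by (simp add: g_def h_def)
  have g0: "tripling (g x) (g v) (g w) i j k = 0"
    if "x \<noteq> v" "x \<noteq> w" "v \<noteq> w" and ijk: "i < j" "j < k" "k < 4" for x v w i j k
  proof -
    have "tripling (y x) (y v) (y w) (f i) (f j) (f k) = 0"
      using perm_nullD[OF null that(1-3)] fi[of i j] fi[of j k] fi[of i k] ijk
      unfolding tri_null_def by simp
    then have "tripling (g x) (g v) (g w) i j k * (h i * h j * h k) = 0"
      using ijk by (simp add: tripling_def pairing_def g algebra_simps)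
    then show ?thesis using h ijk by simp
  qed
  have g1: "tripling (\<lambda>_. 1) (g v) (g w) i j k = 0"
    if "v \<noteq> r" "w \<noteq> r" "v \<noteq> w" and ijk: "i < j" "j < k" "k < 4" for v w i j k
  proof -
    have "tripling (g r) (g v) (g w) i j k = tripling (\<lambda>_. 1) (g v) (g w) i j k"
      using fr ijk by (simp add: tripling_def g_def)
    then show ?thesis using g0[of r v w i j k] that by simp
  qed
  have zero: "y z j = 0" if z: "z \<notin> {r, v, w}" for z j
  proof (rule ccontr)
    assume nz: "y z j \<noteq> 0"
    have ex: "\<exists>i<4. g z i \<noteq> 0" if "y z j \<noteq> 0" for z j
    proof -
      have "j \<in> {a, b, c, d}" using off that unfolding zero_off_def by blast
      then have "j = f 0 \<or> j = f 1 \<or> j = f 2 \<or> j = f 3" by (auto simp: f_def)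
      then obtain i where i: "i < 4" "j = f i"
        using that[of 0] that[of 1] that[of 2] that[of 3] by auto
      then show ?thesis using that fr[of i] by (auto simp: g_def)
    qed
    have "\<exists>j. y v j \<noteq> 0" "\<exists>j. y w j \<noteq> 0"
      using vw(5) unfolding pairing_def by (metis add.right_neutral mult_zero_left mult_zero_right)+
    then have v: "\<exists>i<4. g v i \<noteq> 0" and w: "\<exists>i<4. g w i \<noteq> 0" using ex by blast+
    have "pairing (g v) (g w) i k = 0" if "i < k" "k < 4" for i k
      by (rule null_four_rows[OF two three g1 g1 g1 g0 v w ex[OF nz] that]) (use vw z in auto)
    then have pg: "pairing (y v) (y w) (f i) (f k) = 0" if "i < k" "k < 4" for i k
    proof -
      have "pairing (y v) (y w) (f i) (f k) = pairing (g v) (g w) i k * (h i * h k)"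
        using that by (simp add: pairing_def g algebra_simps)
      then show ?thesis using \<open>\<And>i k. i < k \<Longrightarrow> k < 4 \<Longrightarrow> pairing (g v) (g w) i k = 0\<close> that by simp
    qed
    have "p \<in> {a, b, c, d}" "q \<in> {a, b, c, d}"
      using vw(5) off unfolding pairing_def zero_off_def
      by (metis add.right_neutral mult_zero_left mult_zero_right)+
    moreover have "pairing (y v) (y w) a b = 0" "pairing (y v) (y w) a c = 0"
      "pairing (y v) (y w) a d = 0" "pairing (y v) (y w) b c = 0" "pairing (y v) (y w) b d = 0"
      "pairing (y v) (y w) c d = 0"
      using pg[of 0 1] pg[of 0 2] pg[of 0 3] pg[of 1 2] pg[of 1 3] pg[of 2 3] by (auto simp: f_def)
    ultimately show False using vw(4,5) pairing_swap[of "y v" "y w"] by auto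
  qed
  have "zero_off {r, v, w} {a, b, c, d} y" using zero off unfolding zero_off_def by blast
  moreover have "card {r, v, w} \<le> 3" "card {a, b, c, d} \<le> 4" using S abcd by (auto simp: card_insert_if)
  ultimately show ?thesis by blast
qed

lemma null_three_row:
  assumes "card {j. y r j \<noteq> 0} = 3" and nn: "\<not> null_without_row y r"
    and le: "\<And>s. card {j. y s j \<noteq> 0} \<le> 3"
  shows "zero_off UNIV {j. y r j \<noteq> 0} y"
proof -
  obtain a b c where abc: "{j. y r j \<noteq> 0} = {a, b, c}" "distinct [a, b, c]"
    using assms(1) by (auto simp: card_Suc_eq numeral_eq_Suc)
  then have U: "y r a \<noteq> 0" "y r b \<noteq> 0" "y r c \<noteq> 0" by blast+
  have inside: "y v j = 0" if vw: "v \<noteq> r" "w \<noteq> r" "v \<noteq> w" "p \<noteq> q" "pairing (y v) (y w) p q \<noteq> 0" "y r j = 0"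
    for v w p q j
  proof (rule null_three_inside[OF two three perm_nullD[OF null] abc(2) U _ vw(4,5)])
    show j: "j \<notin> {a, b, c}" using abc that by blast
    show "y v a = 0 \<or> y v b = 0 \<or> y v c = 0 \<or> y v j = 0"
    proof (rule ccontr)
      assume "\<not> ?thesis"
      then have "{a, b, c, j} \<subseteq> {j. y v j \<noteq> 0}" by auto
      then have "card {a, b, c, j} \<le> 3" using le[of v] card_mono le_trans by (metis finite)
      then show False using j abc(2) by auto
    qed
  qed (use abc vw in auto)
  show ?thesis by (rule null_all_inside[OF nn abc(2) U]) (erule (5) inside)
qed

end

text \<open>Nonzero entries that pairwise share a line all lie on one line. If two of them share
  none, all four entries of their block are nonzero, and a further row satisfies two equations with
  determinant twice a product of two nonzero entries, because the permanent of the block is zero.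
  Columns are symmetric.\<close>

lemma pair_null_shape:
  fixes z :: "'m \<Rightarrow> 'n \<Rightarrow> 'f::field"
  assumes two: "(2::'f) \<noteq> 0" and null: "\<And>s t. s \<noteq> t \<Longrightarrow> pair_null (z s) (z t)"
  obtains (row) a where "zero_off {a} UNIV z"
    | (col) b where "zero_off UNIV {b} z"
    | (block) a a' b b' where "a \<noteq> a'" "b \<noteq> b'" "z a b \<noteq> 0" "z a' b' \<noteq> 0"
        "pairing (z a) (z a') b b' = 0" "zero_off {a, a'} {b, b'} z"
proof -
  have P: "z s b * z t c + z s c * z t b = 0" if "s \<noteq> t" "b \<noteq> c" for s t b c
    using null[OF that(1)] that(2) unfolding pair_null_def pairing_def by blast
  show thesis
  proof (cases "\<exists>a a' b b'. a \<noteq> a' \<and> b \<noteq> b' \<and> z a b \<noteq> 0 \<and> z a' b' \<noteq> 0")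
    case False
    then have F: "i = k \<or> j = l" if "z i j \<noteq> 0" "z k l \<noteq> 0" for i j k l using that by metis
    show thesis
    proof (cases "\<exists>a. zero_off {a} UNIV z")
      case True
      then show thesis using row by blast
    next
      case nr: False
      then obtain i j where ij: "z i j \<noteq> 0" unfolding zero_off_def by auto
      from nr obtain k l where kl: "z k l \<noteq> 0" "k \<noteq> i" unfolding zero_off_def by blast
      have "l = j" using F[OF ij kl(1)] kl(2) by auto
      then have "zero_off UNIV {j} z" using F ij kl unfolding zero_off_def by (metis UNIV_I singletonI)
      then show thesis by (rule col)
    qed
  next
    case True
    then obtain a a' b b' where ab: "a \<noteq> a'" "b \<noteq> b'" "z a b \<noteq> 0" "z a' b' \<noteq> 0" by blast
    have pr: "pairing (z a) (z a') b b' = 0" using P[OF ab(1,2)] by (simp add: pairing_def)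
    then have nz: "z a b' \<noteq> 0" "z a' b \<noteq> 0" using ab by (auto simp: pairing_def)
    have c0: "z k b = 0 \<and> z k b' = 0" if k: "k \<noteq> a" "k \<noteq> a'" for k
    proof -
      have "z a b * z k b' + z a b' * z k b = 0" "z a' b * z k b' + z a' b' * z k b = 0"
        "z a b * z a' b' + z a b' * z a' b = 0"
        using P ab k by metis+
      then have "2 * (z a b * z a' b') * z k b = 0" "2 * (z a b * z a' b') * z k b' = 0"
        by Groebner_Basis.algebra+
      then show ?thesis using two ab by simp
    qed
    have r0: "z a l = 0 \<and> z a' l = 0" if l: "l \<noteq> b" "l \<noteq> b'" for l
    proof -
      have "z a b * z a' l + z a l * z a' b = 0" "z a b' * z a' l + z a l * z a' b' = 0"
        "z a b * z a' b' + z a b' * z a' b = 0"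
        using P ab l by metis+
      then have "2 * (z a b * z a' b') * z a l = 0" "2 * (z a b * z a' b') * z a' l = 0"
        by Groebner_Basis.algebra+
      then show ?thesis using two ab by simp
    qed
    have "z k l = 0" if "k \<notin> {a, a'} \<or> l \<notin> {b, b'}" for k l
    proof -
      have "z a b * z k l + z a l * z k b = 0" if "k \<noteq> a" "l \<noteq> b"
        using P that by metis
      then show ?thesis using c0[of k] r0[of l] that ab(3) by (cases "k \<in> {a,a'}"; cases "l \<in> {b,b'}") auto
    qed
    then have "zero_off {a, a'} {b, b'} z" unfolding zero_off_def by blast
    then show thesis using block ab pr by blast
  qed
qed

section \<open>Zero patterns of a matrix that correspond to the types of primes\<close>

definition shape_1 :: "('m::finite \<Rightarrow> 'n::finite \<Rightarrow> 'a::comm_ring_1) \<Rightarrow> bool" where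
  "shape_1 y \<longleftrightarrow> (\<exists>R C. card R + card C + 2 = CARD('m) + CARD('n) \<and> (\<forall>i\<in>R. \<forall>j\<in>C. y i j = 0))"

definition shape_2 :: "('m::finite \<Rightarrow> 'n::finite \<Rightarrow> 'a::comm_ring_1) \<Rightarrow> bool" where
  "shape_2 y \<longleftrightarrow> (\<exists>R C a a' b b'. card R + card C + 1 = CARD('m) + CARD('n) \<and> a \<noteq> a' \<and> b \<noteq> b' \<and>
     {a, a'} \<subseteq> R \<and> {b, b'} \<subseteq> C \<and> pairing (y a) (y a') b b' = 0 \<and>
     (\<forall>(i, j) \<in> R \<times> C - {a, a'} \<times> {b, b'}. y i j = 0))"

definition shape_2_2 :: "('m::finite \<Rightarrow> 'n::finite \<Rightarrow> 'a::comm_ring_1) \<Rightarrow> bool" where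
  "shape_2_2 y \<longleftrightarrow> (\<exists>a a' b b' c c' d d'. distinct [a, a', c, c'] \<and> distinct [b, b', d, d'] \<and>
     pairing (y a) (y a') b b' = 0 \<and> pairing (y c) (y c') d d' = 0 \<and>
     (\<forall>i j. (i, j) \<notin> {a, a'} \<times> {b, b'} \<union> {c, c'} \<times> {d, d'} \<longrightarrow> y i j = 0))"

text \<open>Types (3) and (3A) share this pattern. They are separated later by the presence of a
  zero line in the block, which may even lead to type (1).\<close>

definition shape_3 :: "('m::finite \<Rightarrow> 'n::finite \<Rightarrow> 'a::comm_ring_1) \<Rightarrow> bool" where
  "shape_3 y \<longleftrightarrow> (\<exists>R C. (card R \<le> 3 \<and> card C \<le> 4 \<or> card R \<le> 4 \<and> card C \<le> 3) \<and> zero_off R C y)"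

lemma shape_1_transpose: "shape_1 (\<lambda>j i. y i j) \<Longrightarrow> shape_1 y"
  unfolding shape_1_def by (metis add.commute)

lemma shape_2_transpose:
  assumes "shape_2 (\<lambda>j i. y i j)" shows "shape_2 y"
proof -
  obtain R C a a' b b' where *: "card R + card C + 1 = CARD('a) + CARD('b)" "a \<noteq> a'" "b \<noteq> b'"
     "{a, a'} \<subseteq> R" "{b, b'} \<subseteq> C" and p: "pairing (\<lambda>i. y i a) (\<lambda>i. y i a') b b' = 0"
     and z: "\<forall>(i, j) \<in> R \<times> C - {a, a'} \<times> {b, b'}. y j i = 0"
    using assms unfolding shape_2_def by (elim exE conjE) (rule that)
  have "pairing (y b) (y b') a a' = 0"
    using p unfolding pairing_def by (simp add: mult.commute)
  moreover have "\<forall>(i, j) \<in> C \<times> R - {b, b'} \<times> {a, a'}. y i j = 0"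
    using z by blast
  moreover have "card C + card R + 1 = CARD('b) + CARD('a)" using *(1) by simp
  ultimately show ?thesis unfolding shape_2_def
    by (intro exI[of _ C] exI[of _ R] exI[of _ b] exI[of _ b'] exI[of _ a] exI[of _ a'] conjI *(2-5))
qed

lemma shape_3_transpose: "shape_3 (\<lambda>j i. y i j) \<Longrightarrow> shape_3 y"
  unfolding shape_3_def zero_off_def by blast

lemma card_Compl_eq:
  fixes R :: "'m::finite set"
  shows "card (- R) = CARD('m) - card R" "card R \<le> CARD('m)"
  by (simp_all add: Compl_eq_Diff_UNIV card_Diff_subset card_mono)

lemma card_Compl_finite: "card (- A) + card A = CARD('a)" for A :: "'a::finite set"
  using card_Un_disjoint[of "- A" A] by (simp add: Compl_partition2)

text \<open>The deleted line must avoid the block. If \<open>c\<close> is a row of the block,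
  \<open>off\<close> already clears the rest of it, and any row outside the block can be deleted
  instead.\<close>

lemma shape_2_line_block:
  fixes y :: "'m::finite \<Rightarrow> 'n::finite \<Rightarrow> 'f::field"
  assumes m: "CARD('m) \<ge> 4" and rs: "r \<noteq> s" and ab: "a \<noteq> b" and p: "pairing (y r) (y s) a b = 0"
    and off: "\<And>i j. i \<in> {r, s} \<Longrightarrow> j \<notin> {a, b} \<Longrightarrow> y i j = 0"
    and z: "\<And>i j. i \<noteq> c \<Longrightarrow> (i, j) \<notin> {r, s} \<times> {a, b} \<Longrightarrow> y i j = 0"
  shows "shape_2 y"
proof -
  obtain c' where c': "c' \<notin> {r, s}" "c \<notin> {r, s} \<Longrightarrow> c' = c"
  proof (cases "c \<in> {r, s}")
    case True
    have "card (- {r, s}) > 0" using card_Compl_finite[of "{r, s}"] rs m by simp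
    then have "- {r, s} \<noteq> {}" by (metis card.empty less_irrefl)
    then show ?thesis using that True by blast
  qed (use that in blast)
  have card: "card (- {c'}) + card (UNIV :: 'n set) + 1 = CARD('m) + CARD('n)"
    using card_Compl_finite[of "{c'}"] by simp
  have "y i j = 0" if "i \<noteq> c'" "(i, j) \<notin> {r, s} \<times> {a, b}" for i j
    using off z c'(2) that by blast
  then have "\<forall>(i, j) \<in> (- {c'}) \<times> UNIV - {r, s} \<times> {a, b}. y i j = 0" by blast
  then show ?thesis unfolding shape_2_def using c' rs ab p card
    by (intro exI[of _ "- {c'}"] exI[of _ UNIV] exI[of _ r] exI[of _ s] exI[of _ a] exI[of _ b]) auto
qed

context
  fixes y :: "'m::finite \<Rightarrow> 'n::finite \<Rightarrow> 'f::field"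
  assumes two: "(2::'f) \<noteq> 0" and m: "CARD('m) \<ge> 4" and n: "CARD('n) \<ge> 4"
begin

lemma shape_1_rows:
  assumes "\<And>i j. i \<noteq> r \<Longrightarrow> i \<noteq> a \<Longrightarrow> y i j = 0"
  shows "shape_1 y"
proof -
  obtain a' where a': "a' \<noteq> r" "a \<noteq> r \<Longrightarrow> a' = a"
  proof (cases "a = r")
    case True
    have "\<exists>a'. a' \<noteq> r" using m by (metis (full_types) One_nat_def card_1_singleton_iff UNIV_eq_I
          insertI1 numeral_le_one_iff semiring_norm(69))
    then show ?thesis using that True by blast
  qed (use that in blast)
  have "card {r, a'} = 2" using a' by simp
  then have "card (- {r, a'}) + card (UNIV :: 'n set) + 2 = CARD('m) + CARD('n)"
    using card_Compl_finite[of "{r, a'}"] by simp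
  moreover have "\<forall>i \<in> - {r, a'}. \<forall>j \<in> UNIV. y i j = 0" using assms a' by auto
  ultimately show ?thesis unfolding shape_1_def by blast
qed

text \<open>Once row \<open>r\<close> is cleared, a remaining row or column gives two deleted lines,
  and a remaining block gives one deleted line and a block.\<close>

lemma shape_null_without_row:
  assumes "null_without_row y r"
  shows "shape_1 y \<or> shape_2 y"
proof -
  define z where "z i = (if i = r then (\<lambda>_. 0) else y i)" for i
  have N: "pair_null (z s) (z t)" if "s \<noteq> t" for s t
    using assms that unfolding null_without_row_def z_def
    by (auto simp: pair_null_def pairing_def)
  show ?thesis
  proof (rule pair_null_shape[where z = z, OF two])
    fix s t :: 'm assume "s \<noteq> t" then show "pair_null (z s) (z t)" by (rule N)
  next
    fix a assume row: "zero_off {a} UNIV z"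
    then have "y i j = 0" if "i \<noteq> r" "i \<noteq> a" for i j
      using that row unfolding zero_off_def z_def by (metis singletonD)
    then show ?thesis using shape_1_rows by blast
  next
    fix b assume col: "zero_off UNIV {b} z"
    then have "\<forall>i \<in> - {r}. \<forall>j \<in> - {b}. y i j = 0" by (auto simp: zero_off_def z_def split: if_splits)
    moreover have "card (- {r}) + card (- {b}) + 2 = CARD('m) + CARD('n)"
      using card_Compl_finite[of "{r}"] card_Compl_finite[of "{b}"] by simp
    ultimately show ?thesis unfolding shape_1_def by blast
  next
    fix a a' b b' assume block: "a \<noteq> a'" "b \<noteq> b'" "z a b \<noteq> 0" "z a' b' \<noteq> 0"
      "pairing (z a) (z a') b b' = 0" "zero_off {a, a'} {b, b'} z"
    have ne: "a \<noteq> r" "a' \<noteq> r" using block by (auto simp: z_def)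
    have "card (- {r}) + card (UNIV :: 'n set) + 1 = CARD('m) + CARD('n)"
      using card_Compl_finite[of "{r}"] by simp
    moreover have "\<forall>(i, j) \<in> (- {r}) \<times> UNIV - {a, a'} \<times> {b, b'}. y i j = 0"
    proof (intro ballI)
      fix p assume p: "p \<in> (- {r}) \<times> UNIV - {a, a'} \<times> {b, b'}"
      then have "z (fst p) (snd p) = 0" using block(6) unfolding zero_off_def by force
      then show "case p of (i, j) \<Rightarrow> y i j = 0" using p by (auto simp: z_def)
    qed
    moreover have "pairing (y a) (y a') b b' = 0" using block ne by (simp add: z_def)
    ultimately have "shape_2 y" unfolding shape_2_def using ne block
      by (intro exI[of _ "- {r}"] exI[of _ UNIV] exI[of _ a] exI[of _ a'] exI[of _ b] exI[of _ b']) auto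
    then show ?thesis ..
  qed
qed

text \<open>The matrix splits into this block and a complement with vanishing 2 x 2 permanents. A
  complement on a line leads to \<open>shape_2\<close>, a complementary block to
  \<open>shape_2_2\<close>.\<close>

lemma shape_block:
  assumes rs: "r \<noteq> s" and ab: "a \<noteq> b" and p: "pairing (y r) (y s) a b = 0"
    and off: "\<And>i j. y i j \<noteq> 0 \<Longrightarrow> i \<in> {r, s} \<longleftrightarrow> j \<in> {a, b}"
    and null: "\<And>i k. i \<notin> {r, s} \<Longrightarrow> k \<notin> {r, s} \<Longrightarrow> i \<noteq> k \<Longrightarrow> pair_null (y i) (y k)"
  shows "shape_1 y \<or> shape_2 y \<or> shape_2_2 y"
proof -
  have off0: "y i j = 0" if "i \<in> {r, s}" "j \<notin> {a, b}" for i j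
    using off that by blast
  define z where "z i = (if i \<in> {r, s} then (\<lambda>_. 0) else y i)" for i
  have N: "pair_null (z i) (z k)" if "i \<noteq> k" for i k
    using null[OF _ _ that] that unfolding z_def by (auto simp: pair_null_def pairing_def)
  show ?thesis
  proof (rule pair_null_shape[where z = z, OF two])
    fix s t :: 'm assume "s \<noteq> t" then show "pair_null (z s) (z t)" by (rule N)
  next
    fix c assume row: "zero_off {c} UNIV z"
    have "y i j = 0" if "i \<noteq> c" "(i, j) \<notin> {r, s} \<times> {a, b}" for i j
    proof (cases "i \<in> {r, s}")
      case False
      then have "z i j = y i j" by (simp add: z_def)
      then show ?thesis using row that(1) unfolding zero_off_def by (metis singletonD)
    qed (use off[of i j] that in blast)
    then have "shape_2 y" by (intro shape_2_line_block[OF m rs ab p off0])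
    then show ?thesis by blast
  next
    fix c assume col: "zero_off UNIV {c} z"
    have "y i j = 0" if "j \<noteq> c" "(j, i) \<notin> {a, b} \<times> {r, s}" for i j
    proof (cases "i \<in> {r, s}")
      case False
      then have "z i j = y i j" by (simp add: z_def)
      then show ?thesis using col that(1) unfolding zero_off_def by (metis singletonD)
    qed (use off[of i j] that in blast)
    moreover have "pairing (\<lambda>i. y i a) (\<lambda>i. y i b) r s = 0" using p by (metis pairing_transpose)
    ultimately have "shape_2 (\<lambda>j i. y i j)"
      by (intro shape_2_line_block[OF n ab rs]) (use off in blast)+
    then show ?thesis using shape_2_transpose by blast
  next
    fix c c' d d' assume block: "c \<noteq> c'" "d \<noteq> d'" "z c d \<noteq> 0" "z c' d' \<noteq> 0"
      "pairing (z c) (z c') d d' = 0" "zero_off {c, c'} {d, d'} z"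
    have ne: "c \<notin> {r, s}" "c' \<notin> {r, s}" using block by (auto simp: z_def)
    then have zc: "z c = y c" "z c' = y c'" by (auto simp: z_def)
    then have "d \<notin> {a, b}" "d' \<notin> {a, b}" using off[of c d] off[of c' d'] block ne by auto
    moreover have "y i j = 0" if "(i, j) \<notin> {r, s} \<times> {a, b} \<union> {c, c'} \<times> {d, d'}" for i j
    proof (cases "i \<in> {r, s}")
      case True
      then show ?thesis using off that by blast
    next
      case False
      then have "z i j = y i j" by (simp add: z_def)
      moreover have "z i j = 0" using block(6) that unfolding zero_off_def by blast
      ultimately show ?thesis by simp
    qed
    moreover have "distinct [r, s, c, c']" using ne rs block(1) by auto
    ultimately have "distinct [r, s, c, c'] \<and> distinct [a, b, d, d'] \<and>
        pairing (y r) (y s) a b = 0 \<and> pairing (y c) (y c') d d' = 0 \<and>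
        (\<forall>i j. (i, j) \<notin> {r, s} \<times> {a, b} \<union> {c, c'} \<times> {d, d'} \<longrightarrow> y i j = 0)"
      using ab p block(2,5) unfolding zc by simp blast
    then have "shape_2_2 y" unfolding shape_2_2_def by (intro exI)
    then show ?thesis by blast
  qed
qed

end

text \<open>In a triple equation containing row \<open>u\<close> and column \<open>c\<close>, only
  the term at \<open>c\<close> survives. If \<open>u\<close> is itself one of the two rows, it
  vanishes at both \<open>a\<close> and \<open>b\<close>.\<close>

lemma null_without_col:
  fixes y :: "'m::finite \<Rightarrow> 'n::finite \<Rightarrow> 'f::field"
  assumes null: "perm_null y" and u: "{j. y u j \<noteq> 0} = {c}"
  shows "null_without_row (\<lambda>j i. y i j) c"
  unfolding null_without_col_iff
proof (intro allI impI)
  fix r s :: 'm and a b :: 'n assume *: "r \<noteq> s" "a \<noteq> c" "b \<noteq> c" "a \<noteq> b"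
  have u0: "y u j = 0 \<longleftrightarrow> j \<noteq> c" for j using u by auto
  show "pairing (y r) (y s) a b = 0"
  proof (cases "u = r \<or> u = s")
    case True
    moreover have "y u a = 0" "y u b = 0" using u0 * by blast+
    ultimately show ?thesis by (auto simp: pairing_def)
  next
    case False
    then have "y u c * pairing (y r) (y s) a b + y u a * pairing (y r) (y s) c b +
        y u b * pairing (y r) (y s) c a = 0"
      using tri_nullD[OF perm_nullD[OF null], of u r s c a b] * by auto
    then show ?thesis using u0[of a] u0[of b] u0[of c] * by simp
  qed
qed

text \<open>Lines with a single entry being excluded, the support is a disjoint union of cycles. A
  cycle of length four is split off as a block, or is the whole support if its permanent is nonzero;
  a longer cycle closes after six entries, and nothing else can then be nonzero.\<close>

lemma null_shape_degree_two:
  fixes y :: "'m::finite \<Rightarrow> 'n::finite \<Rightarrow> 'f::field"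
  assumes two: "(2::'f) \<noteq> 0" and m: "CARD('m) \<ge> 4" and n: "CARD('n) \<ge> 4"
    and null: "perm_null y"
    and row: "\<And>i. card {j. y i j \<noteq> 0} = 0 \<or> card {j. y i j \<noteq> 0} = 2"
    and col: "\<And>j. card {i. y i j \<noteq> 0} = 0 \<or> card {i. y i j \<noteq> 0} = 2"
  shows "shape_1 y \<or> shape_2 y \<or> shape_2_2 y \<or> shape_3 y"
proof (cases "\<exists>i j. y i j \<noteq> 0")
  case False
  then have "zero_off {} {} y" by (auto simp: zero_off_def)
  then show ?thesis unfolding shape_3_def by (metis card.empty zero_le)
next
  case True
  then obtain r a where ra: "y r a \<noteq> 0" by blast
  have row2: "\<exists>b. b \<noteq> a \<and> (\<forall>j. y r j \<noteq> 0 \<longleftrightarrow> j = a \<or> j = b)" if "y r a \<noteq> 0" for r a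
  proof -
    have "card {j. y r j \<noteq> 0} = 2" using row[of r] that by auto
    then obtain p q where pq: "{j. y r j \<noteq> 0} = {p, q}" "p \<noteq> q" by (auto simp: card_2_iff)
    have "y r j \<noteq> 0 \<longleftrightarrow> j = p \<or> j = q" for j using pq(1) by blast
    then show ?thesis using that pq(2) by metis
  qed
  have col2: "\<exists>s. s \<noteq> r \<and> (\<forall>i. y i a \<noteq> 0 \<longleftrightarrow> i = r \<or> i = s)" if "y r a \<noteq> 0" for r a
  proof -
    have "card {i. y i a \<noteq> 0} = 2" using col[of a] that by auto
    then obtain p q where pq: "{i. y i a \<noteq> 0} = {p, q}" "p \<noteq> q" by (auto simp: card_2_iff)
    have "y i a \<noteq> 0 \<longleftrightarrow> i = p \<or> i = q" for i using pq(1) by blast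
    then show ?thesis using that pq(2) by metis
  qed
  have T: "y r a * pairing (y s) (y t) b c + y r b * pairing (y s) (y t) a c +
      y r c * pairing (y s) (y t) a b = 0"
    if "distinct [r, s, t]" "distinct [a, b, c]" for r s t a b c
    using tri_nullD[OF perm_nullD[OF null], of r s t a b c] that by auto
  obtain b where b: "b \<noteq> a" "\<And>j. y r j \<noteq> 0 \<longleftrightarrow> j = a \<or> j = b" using row2[OF ra] by blast
  obtain s where s: "s \<noteq> r" "\<And>i. y i a \<noteq> 0 \<longleftrightarrow> i = r \<or> i = s" using col2[OF ra] by blast
  obtain c where c: "c \<noteq> a" "\<And>j. y s j \<noteq> 0 \<longleftrightarrow> j = a \<or> j = c" using row2[of s a] s by blast
  show ?thesis
  proof (cases "c = b")
    case True
    have cb: "y i b \<noteq> 0 \<longleftrightarrow> i = r \<or> i = s" for i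
      using col2[of r b] b(2)[of b] c(2)[of b] s(1) True by metis
    have off: "i \<in> {r, s} \<longleftrightarrow> j \<in> {a, b}" if "y i j \<noteq> 0" for i j
      using that b(2) c(2) s(2) cb True by blast
    show ?thesis
    proof (cases "pairing (y r) (y s) a b = 0")
      case P: True
      have "pair_null (y i) (y k)" if ik: "i \<notin> {r, s}" "k \<notin> {r, s}" "i \<noteq> k" for i k
        unfolding pair_null_def
      proof (intro allI impI)
        fix p q :: 'n assume pq: "p \<noteq> q"
        show "pairing (y i) (y k) p q = 0"
        proof (cases "p \<in> {a, b} \<or> q \<in> {a, b}")
          case True
          then show ?thesis using off ik unfolding pairing_def by (metis add.right_neutral mult_zero_left mult_zero_right)
        next
          case False
          then have "y r p = 0" "y r q = 0" using b(2) by blast+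
          then show ?thesis using T[of r i k a p q] ik pq False ra by auto
        qed
      qed
      then show ?thesis using shape_block[OF two m n s(1)[symmetric] b(1)[symmetric] P off] by blast
    next
      \<comment> \<open>An entry away from the block would create a 3 x 3 permanent equal to that
        entry times the nonzero permanent of the block.\<close>
      case P: False
      have "y i j = 0" if i: "i \<notin> {r, s}" and j: "j \<notin> {a, b}" for i j
      proof -
        have "pairing (y r) (y s) j b = 0" "pairing (y r) (y s) a j = 0" "y i a = 0" "y i b = 0"
          using off i j unfolding pairing_def by (metis add.right_neutral mult_zero_left mult_zero_right insertCI)+
        then show ?thesis using T[of i r s j a b] i j b(1) s(1) P by auto
      qed
      then have "zero_off {r, s} {a, b} y" using off unfolding zero_off_def by blast
      moreover have "card {r, s} \<le> 3" "card {a, b} \<le> 4" by (auto simp: card_insert_if)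
      ultimately show ?thesis unfolding shape_3_def by blast
    qed
  next
    \<comment> \<open>The path runs through \<open>c\<close>, \<open>s\<close>, \<open>a\<close>,
      \<open>r\<close>, \<open>b\<close>, \<open>t\<close>, \<open>d\<close>. If it did not close up
      with \<open>d = c\<close>, the permanent of rows \<open>r\<close>, \<open>s\<close>,
      \<open>t\<close> in columns \<open>a\<close>, \<open>c\<close>, \<open>d\<close> would be the
      single nonzero product of y_ra, y_sc and y_td.\<close>
    case cb: False
    obtain t where t: "t \<noteq> r" "\<And>i. y i b \<noteq> 0 \<longleftrightarrow> i = r \<or> i = t" using col2[of r b] b by blast
    have ts: "t \<noteq> s" using t(2)[of s] c(2)[of b] b(1) cb s(1) by auto
    obtain d where d: "d \<noteq> b" "\<And>j. y t j \<noteq> 0 \<longleftrightarrow> j = b \<or> j = d" using row2[of t b] t by blast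
    have da: "d \<noteq> a" using d(2)[of a] s(2)[of t] ts t(1) by auto
    have dc: "d = c"
    proof (rule ccontr)
      assume "d \<noteq> c"
      then have "y s d = 0" "y t c = 0" "y t a = 0" "y r c = 0" "y r d = 0"
        using b(1) b(2)[of c] b(2)[of d] c(1) c(2)[of d] d(1) d(2)[of a] d(2)[of c] cb da \<open>d \<noteq> c\<close>
        by auto
      then show False using T[of r s t a c d] ts s(1) t(1) \<open>d \<noteq> c\<close> c da ra d(2)[of d] c(2)[of c]
        by (auto simp: pairing_def)
    qed
    have cc: "y i c \<noteq> 0 \<longleftrightarrow> i = s \<or> i = t" for i
      using col2[of s c] c(2)[of c] d(2)[of c] dc ts by metis
    have "y i j = 0" if "i \<notin> {r, s, t} \<or> j \<notin> {a, b, c}" for i j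
    proof (rule ccontr)
      assume nz: "y i j \<noteq> 0"
      have "i \<in> {r, s, t} \<longleftrightarrow> j \<in> {a, b, c}"
        using nz b(2) c(2) d(2) dc s(2) t(2) cc by blast
      then have i: "i \<notin> {r, s, t}" and j: "j \<notin> {a, b, c}" using that by auto
      have "y i a = 0" "y i b = 0" "y s b = 0" "y r j = 0" "y s j = 0"
        using i j b(2) c(2) s(2) t(2) cb b(1) by auto
      moreover have "y s a \<noteq> 0" "y r b \<noteq> 0" using s(2) b(2) by auto
      ultimately show False using T[of i r s j a b] i j nz s(1) b(1) by (auto simp: pairing_def)
    qed
    then have "zero_off {r, s, t} {a, b, c} y" unfolding zero_off_def by blast
    moreover have "card {r, s, t} \<le> 3" "card {a, b, c} \<le> 4" by (auto simp: card_insert_if)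
    ultimately show ?thesis unfolding shape_3_def by blast
  qed
qed

text \<open>Three columns carry everything. If some column also has three nonzero entries, its rows
  carry everything too and the block is 3 x 3. Otherwise each of the three columns has at most one
  nonzero entry outside row \<open>r\<close>, which leaves at most four rows.\<close>

lemma null_shape_three:
  fixes y :: "'m::finite \<Rightarrow> 'n::finite \<Rightarrow> 'f::field"
  assumes two: "(2::'f) \<noteq> 0" and three: "(3::'f) \<noteq> 0" and null: "perm_null y"
    and nr: "\<And>r. \<not> null_without_row y r" and nc: "\<And>c. \<not> null_without_row (\<lambda>j i. y i j) c"
    and row: "\<And>i. card {j. y i j \<noteq> 0} \<le> 3" and col: "\<And>j. card {i. y i j \<noteq> 0} \<le> 3"
    and r: "card {j. y r j \<noteq> 0} = 3"
  shows "shape_3 y"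
proof -
  define S where "S = {j. y r j \<noteq> 0}"
  have off: "zero_off UNIV S y"
    unfolding S_def using null_three_row[OF two three null r nr row] .
  have S: "card S = 3" using r by (simp add: S_def)
  show ?thesis
  proof (cases "\<exists>c. card {i. y i c \<noteq> 0} = 3")
    case True
    then obtain c where c: "card {i. y i c \<noteq> 0} = 3" by blast
    have "zero_off UNIV {i. y i c \<noteq> 0} (\<lambda>j i. y i j)"
      using null_three_row[OF two three perm_null_transpose[OF null] c nc col] .
    then have "zero_off {i. y i c \<noteq> 0} S y" using off unfolding zero_off_def by blast
    then show ?thesis unfolding shape_3_def using c S
      by (intro exI[of _ "{i. y i c \<noteq> 0}"] exI[of _ S]) simp
  next
    case False
    then have col2: "card {i. y i j \<noteq> 0} \<le> 2" for j using col[of j] by (metis le_SucE numeral_2_eq_2 numeral_3_eq_3)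
    define T where "T = (\<Union>j\<in>S. {i. y i j \<noteq> 0} - {r})"
    define R where "R = insert r T"
    have "card ({i. y i j \<noteq> 0} - {r}) \<le> 1" if "j \<in> S" for j
      using col2[of j] that by (simp add: S_def card_Diff_singleton)
    then have "card T \<le> card S * 1" unfolding T_def
      using card_UN_le[of S "\<lambda>j. {i. y i j \<noteq> 0} - {r}"] sum_bounded_above[of S "\<lambda>j. card ({i. y i j \<noteq> 0} - {r})" 1]
      by fastforce
    then have "card R \<le> 4" using S unfolding R_def by (simp add: card_insert_if)
    moreover have "zero_off R S y" using off unfolding zero_off_def R_def T_def by blast
    ultimately show ?thesis unfolding shape_3_def using S by (metis order_refl)
  qed
qed

text \<open>A line whose deletion kills all 2 x 2 permanents is treated first, because the later
  cases rely on there being none. The rest goes by the largest number of nonzero entries in a line: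
  at least four, three, or at most two, where exactly one is impossible by
  \<open>null_without_col\<close>.\<close>

theorem perm_null_shape:
  fixes y :: "'m::finite \<Rightarrow> 'n::finite \<Rightarrow> 'f::field"
  assumes two: "(2::'f) \<noteq> 0" and three: "(3::'f) \<noteq> 0" and m: "CARD('m) \<ge> 4" and n: "CARD('n) \<ge> 4"
    and null: "perm_null y"
  shows "shape_1 y \<or> shape_2 y \<or> shape_2_2 y \<or> shape_3 y"
proof (cases "(\<exists>r. null_without_row y r) \<or> (\<exists>c. null_without_row (\<lambda>j i. y i j) c)")
  case True
  then show ?thesis
    using shape_null_without_row[OF two m n] shape_null_without_row[OF two n m]
      shape_1_transpose shape_2_transpose by metis
next
  case False
  then have nr: "\<not> null_without_row y r" and nc: "\<not> null_without_row (\<lambda>j i. y i j) c" for r c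
    by blast+
  note nullt = perm_null_transpose[OF null]
  show ?thesis
  proof (cases "(\<exists>r. card {j. y r j \<noteq> 0} \<ge> 4) \<or> (\<exists>c. card {i. y i c \<noteq> 0} \<ge> 4)")
    case True
    have "shape_3 y" if "card {j. y r j \<noteq> 0} \<ge> 4" for r
      using null_four_row[OF two three null that nr] unfolding shape_3_def by blast
    moreover have "shape_3 (\<lambda>j i. y i j)" if "card {i. y i c \<noteq> 0} \<ge> 4" for c
      using null_four_row[OF two three nullt that nc] unfolding shape_3_def by blast
    ultimately show ?thesis using True shape_3_transpose by blast
  next
    case False
    then have row: "card {j. y r j \<noteq> 0} \<le> 3" and col: "card {i. y i c \<noteq> 0} \<le> 3" for r c
      by (metis not_less_eq_eq numeral_3_eq_3 numeral_eq_Suc pred_numeral_simps(2) pred_numeral_simps(3) semiring_norm(26,27,28))+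
    show ?thesis
    proof (cases "(\<exists>r. card {j. y r j \<noteq> 0} = 3) \<or> (\<exists>c. card {i. y i c \<noteq> 0} = 3)")
      case True
      then show ?thesis
        using null_shape_three[OF two three null nr nc row col]
          null_shape_three[OF two three nullt nc nr col row] shape_3_transpose by blast
    next
      case False
      have "card {j. y r j \<noteq> 0} \<noteq> 1" for r
      proof
        assume "card {j. y r j \<noteq> 0} = 1"
        then obtain c where "{j. y r j \<noteq> 0} = {c}" by (auto simp: card_1_singleton_iff)
        then show False using null_without_col[OF null] nc by blast
      qed
      moreover have "card {i. y i c \<noteq> 0} \<noteq> 1" for c
      proof
        assume "card {i. y i c \<noteq> 0} = 1"
        then obtain r where "{i. y i c \<noteq> 0} = {r}" by (auto simp: card_1_singleton_iff)
        then show False using null_without_col[OF nullt] nr by blast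
      qed
      ultimately have "card {j. y r j \<noteq> 0} = 0 \<or> card {j. y r j \<noteq> 0} = 2"
          "card {i. y i c \<noteq> 0} = 0 \<or> card {i. y i c \<noteq> 0} = 2" for r c
        using row[of r] col[of c] False by (metis le_SucE numeral_2_eq_2 numeral_3_eq_3 One_nat_def le_zero_eq)+
      then show ?thesis using null_shape_degree_two[OF two m n null] by blast
    qed
  qed
qed

subsection \<open>Ideals and evaluation of polynomials\<close>

text \<open>Plain closure conditions, free of the records of HOL-Algebra; the link is
  \<open>ideal_iff_is_ideal\<close>.\<close>

definition is_ideal :: "'a::comm_ring_1 set \<Rightarrow> bool" where
  "is_ideal I \<longleftrightarrow> 0 \<in> I \<and> (\<forall>a\<in>I. \<forall>b\<in>I. a + b \<in> I) \<and> (\<forall>a\<in>I. \<forall>r. r * a \<in> I)"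

context
  fixes I :: "'a::comm_ring_1 set"
  assumes I: "is_ideal I"
begin

lemma ideal_0: "0 \<in> I"
  and ideal_add: "a \<in> I \<Longrightarrow> b \<in> I \<Longrightarrow> a + b \<in> I"
  and ideal_mult_left: "a \<in> I \<Longrightarrow> r * a \<in> I"
  using I unfolding is_ideal_def by auto

lemma ideal_mult_right: "a \<in> I \<Longrightarrow> a * r \<in> I"
  using ideal_mult_left[of a r] by (simp add: mult.commute)

lemma ideal_uminus: "a \<in> I \<Longrightarrow> - a \<in> I"
  using ideal_mult_left[of a "- 1"] by simp

lemma ideal_diff: "a \<in> I \<Longrightarrow> b \<in> I \<Longrightarrow> a - b \<in> I"
  using ideal_add[of a "- b"] ideal_uminus[of b] by simp

lemma ideal_sum: "(\<And>x. x \<in> A \<Longrightarrow> f x \<in> I) \<Longrightarrow> sum f A \<in> I"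
  by (induction A rule: infinite_finite_induct) (auto intro: ideal_0 ideal_add)

lemma ideal_cancel_right: "b \<in> I \<Longrightarrow> a + b \<in> I \<longleftrightarrow> a \<in> I"
  using ideal_diff[of "a + b" b] ideal_add by auto

end

lemma ideal_iff_is_ideal: "ideal I ring_of_type_algebra \<longleftrightarrow> is_ideal I" for I :: "'a::comm_ring_1 set"
proof
  assume "ideal I ring_of_type_algebra"
  then interpret ideal I "ring_of_type_algebra :: 'a ring" .
  have eqs: "monoid.mult (ring_of_type_algebra :: 'a ring) = (*)"
    "add (ring_of_type_algebra :: 'a ring) = (+)" "zero (ring_of_type_algebra :: 'a ring) = 0"
    "carrier (ring_of_type_algebra :: 'a ring) = UNIV"
    by (auto simp: ring_of_type_algebra_def)
  show "is_ideal I"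
    unfolding is_ideal_def
    using additive_subgroup.zero_closed[OF additive_subgroup_axioms, unfolded eqs]
      additive_subgroup.a_closed[OF additive_subgroup_axioms, unfolded eqs] I_l_closed[unfolded eqs, OF _ UNIV_I]
    by (intro conjI ballI allI)
next
  assume I: "is_ideal I"
  show "ideal I ring_of_type_algebra"
  proof (rule idealI[OF ring_from_type_algebra])
    show "subgroup I (add_monoid (ring_of_type_algebra :: 'a ring))"
    proof -
      have 1: "a + b \<in> I" if "a \<in> I" "b \<in> I" for a b using ideal_add[OF I that] .
      have inv: "m_inv (add_monoid (ring_of_type_algebra :: 'a ring)) x = - x" for x
      proof -
        interpret ring "ring_of_type_algebra :: 'a ring" by (rule ring_from_type_algebra)
        show ?thesis
          unfolding a_inv_def[symmetric] by (rule minus_equality)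
            (auto simp: ring_of_type_algebra_def)
      qed
      show ?thesis
        by (rule subgroup.intro)
          (auto simp: ring_of_type_algebra_def 1 ideal_0[OF I]
            inv[unfolded ring_of_type_algebra_def, simplified] ideal_uminus[OF I])
    qed
  qed (use ideal_mult_left[OF I] ideal_mult_right[OF I] in \<open>auto simp: ring_of_type_algebra_def\<close>)
qed

lemma is_ideal_ideal_gen: "is_ideal (ideal_gen S)"
  and ideal_gen_superset: "S \<subseteq> ideal_gen S"
  and ideal_gen_minimal: "is_ideal I \<Longrightarrow> S \<subseteq> I \<Longrightarrow> ideal_gen S \<subseteq> I"
  for S I :: "'a::comm_ring_1 set"
proof -
  interpret ring "ring_of_type_algebra :: 'a ring" by (rule ring_from_type_algebra)
  have c: "carrier (ring_of_type_algebra :: 'a ring) = UNIV" by (simp add: ring_of_type_algebra_def)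
  show "is_ideal (ideal_gen S)" using genideal_ideal[of S] c ideal_iff_is_ideal by auto
  show "S \<subseteq> ideal_gen S" using genideal_self[of S] c by auto
  show "ideal_gen S \<subseteq> I" if "is_ideal I" "S \<subseteq> I"
    using genideal_minimal that ideal_iff_is_ideal by blast
qed

lemma prime_ideal_iff:
  "prime_ideal P \<longleftrightarrow> is_ideal P \<and> 1 \<notin> P \<and> (\<forall>a b. a * b \<in> P \<longrightarrow> a \<in> P \<or> b \<in> P)"
  for P :: "'a::comm_ring_1 set"
proof
  assume "prime_ideal P"
  then interpret primeideal P "ring_of_type_algebra :: 'a ring" .
  have [simp]: "monoid.mult (ring_of_type_algebra :: 'a ring) = (*)"
    "carrier (ring_of_type_algebra :: 'a ring) = UNIV"
    by (auto simp: ring_of_type_algebra_def)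
  have P: "is_ideal P" using is_ideal ideal_iff_is_ideal by blast
  moreover have "1 \<notin> P"
  proof
    assume "1 \<in> P"
    then have "x \<in> P" for x using ideal_mult_left[OF P, of 1 x] by simp
    then show False using I_notcarr by auto
  qed
  ultimately show "is_ideal P \<and> 1 \<notin> P \<and> (\<forall>a b. a * b \<in> P \<longrightarrow> a \<in> P \<or> b \<in> P)"
    using I_prime by simp
next
  assume P: "is_ideal P \<and> 1 \<notin> P \<and> (\<forall>a b. a * b \<in> P \<longrightarrow> a \<in> P \<or> b \<in> P)"
  then have "ideal P ring_of_type_algebra" by (simp add: ideal_iff_is_ideal)
  then show "prime_ideal P"
    by (rule primeidealI[OF _ cring_from_type_algebra]) (use P in \<open>auto simp: ring_of_type_algebra_def\<close>)
qed

lemma prime_idealD: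
  assumes "prime_ideal P"
  shows "is_ideal P" "1 \<notin> P" "a * b \<in> P \<longleftrightarrow> a \<in> P \<or> b \<in> P"
  using assms ideal_mult_left ideal_mult_right unfolding prime_ideal_iff by blast+

lemma prime_ideal_vimage:
  assumes "comm_ring_hom f" and "prime_ideal P"
  shows "prime_ideal {a. f a \<in> P}"
proof -
  interpret comm_ring_hom f by fact
  note P = prime_idealD[OF assms(2)]
  show ?thesis
    unfolding prime_ideal_iff is_ideal_def
    by (auto simp: hom_add hom_mult P ideal_0[OF P(1)] intro: ideal_add[OF P(1)])
qed

lemma prime_ideal_zero: "prime_ideal {0 :: 'a::idom}"
  unfolding prime_ideal_iff is_ideal_def by auto

lemma prime_ideal_kernel:
  fixes f :: "'a::comm_ring_1 \<Rightarrow> 'b::idom"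
  assumes "comm_ring_hom f"
  shows "prime_ideal {a. f a = 0}"
  using prime_ideal_vimage[OF assms prime_ideal_zero] by simp


section \<open>Homomorphisms out of polynomial rings\<close>

definition const :: "'k \<Rightarrow> ('v, 'k::zero) mpoly" where
  "const c = Poly_Mapping.single 0 c"

lemma comm_ring_hom_const: "comm_ring_hom (const :: 'k::comm_ring_1 \<Rightarrow> ('v, 'k) mpoly)"
  by unfold_locales (simp_all add: const_def single_add mult_single)

lemma update_eq_add:
  "a \<notin> Poly_Mapping.keys f \<Longrightarrow> Poly_Mapping.update a b f = Poly_Mapping.single a b + f"
  for f :: "'a \<Rightarrow>\<^sub>0 'b::comm_monoid_add"
  by (rule poly_mapping_eqI) (auto simp: lookup_update lookup_add lookup_single when_def in_keys_iff)

lemma mpoly_induct [case_names const indet add mult]: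
  fixes f :: "('v, 'k::comm_ring_1) mpoly"
  assumes const: "\<And>c. P (const c)" and indet: "\<And>v. P (indet v)"
    and add: "\<And>f g. P f \<Longrightarrow> P g \<Longrightarrow> P (f + g)" and mult: "\<And>f g. P f \<Longrightarrow> P g \<Longrightarrow> P (f * g)"
  shows "P f"
proof -
  have 1: "P 1" using const[of 1] by (simp add: const_def)
  have pow: "P (f ^ n)" if "P f" for f n by (induction n) (use that 1 mult in auto)
  have ind: "Poly_Mapping.single (Poly_Mapping.single v n) 1 = (indet v ^ n :: ('v, 'k) mpoly)" for v and n
  proof (induction n)
    case (Suc n)
    have "Poly_Mapping.single (Poly_Mapping.single v (Suc n)) (1::'k) =
        indet v * Poly_Mapping.single (Poly_Mapping.single v n) 1"
      by (simp add: indet_def mult_single single_add[symmetric])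
    then show ?case using Suc by simp
  qed simp
  have mon: "P (Poly_Mapping.single t 1)" for t
  proof (induction t rule: update_induct)
    case (update t v n)
    have "Poly_Mapping.single (Poly_Mapping.update v n t) (1::'k) =
       indet v ^ n * Poly_Mapping.single t 1"
      using update(1) by (simp add: update_eq_add ind[symmetric] mult_single)
    then show ?case using mult pow indet update(3) by simp
  qed (use 1 in simp)
  show ?thesis
  proof (induction f rule: update_induct)
    case const
    then show ?case using assms(1)[of 0] by (simp add: const_def)
  next
    case (update f t c)
    have "Poly_Mapping.update t c f = const c * Poly_Mapping.single t 1 + f"
      using update(1) by (simp add: update_eq_add const_def mult_single)
    then show ?case using add mult assms(1) mon update(3) by simp
  qed
qed

definition peval :: "('k::comm_ring_1 \<Rightarrow> 'a::comm_ring_1) \<Rightarrow> ('v \<Rightarrow> 'a) \<Rightarrow> ('v, 'k) mpoly \<Rightarrow> 'a" where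
  "peval h g f = (\<Sum>t\<in>Poly_Mapping.keys f. h (Poly_Mapping.lookup f t) *
     (\<Prod>v\<in>Poly_Mapping.keys t. g v ^ Poly_Mapping.lookup t v))"

context
  fixes h :: "'k::comm_ring_1 \<Rightarrow> 'a::comm_ring_1" and g :: "'v \<Rightarrow> 'a"
  assumes h: "comm_ring_hom h"
begin

interpretation h: comm_ring_hom h by (rule h)

lemma peval_single:
  "peval h g (Poly_Mapping.single t c) = h c * (\<Prod>v\<in>Poly_Mapping.keys t. g v ^ Poly_Mapping.lookup t v)"
  by (simp add: peval_def)

lemma peval_add: "peval h g (p + q) = peval h g p + peval h g q"
  unfolding peval_def by (rule setsum_keys_plus_distrib) (simp_all add: h.hom_add distrib_right)

lemma monomial_value_add:
  "(\<Prod>v\<in>Poly_Mapping.keys (s + t). g v ^ Poly_Mapping.lookup (s + t) v) =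
   (\<Prod>v\<in>Poly_Mapping.keys s. g v ^ Poly_Mapping.lookup s v) *
   (\<Prod>v\<in>Poly_Mapping.keys t. g v ^ Poly_Mapping.lookup t v)"
  for s t :: "'v \<Rightarrow>\<^sub>0 nat"
proof -
  let ?A = "Poly_Mapping.keys s \<union> Poly_Mapping.keys t"
  have *: "(\<Prod>v\<in>Poly_Mapping.keys r. g v ^ Poly_Mapping.lookup r v) = (\<Prod>v\<in>?A. g v ^ Poly_Mapping.lookup r v)"
    if "Poly_Mapping.keys r \<subseteq> ?A" for r :: "'v \<Rightarrow>\<^sub>0 nat"
    by (rule prod.mono_neutral_left) (use that in \<open>auto simp: in_keys_iff\<close>)
  show ?thesis
    unfolding *[OF keys_add] *[OF Un_upper1] *[OF Un_upper2]
    by (simp add: lookup_add power_add prod.distrib)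
qed

lemma comm_ring_hom_peval: "comm_ring_hom (peval h g)"
proof
  show "peval h g 0 = 0" "peval h g 1 = 1" by (simp_all add: peval_def)
  show "peval h g (p + q) = peval h g p + peval h g q" for p q by (rule peval_add)
  show "peval h g (p * q) = peval h g p * peval h g q" for p q
  proof (induction p rule: update_induct)
    case const
    then show ?case by (simp add: peval_def)
  next
    case (update p s c)
    have "peval h g (Poly_Mapping.single s c * q) = peval h g (Poly_Mapping.single s c) * peval h g q"
    proof (induction q rule: update_induct)
      case const
      then show ?case by (simp add: peval_def)
    next
      case (update q t d)
      have "peval h g (Poly_Mapping.single s c * Poly_Mapping.single t d) =
          peval h g (Poly_Mapping.single s c) * peval h g (Poly_Mapping.single t d)"
        by (simp add: mult_single peval_single monomial_value_add h.hom_mult algebra_simps)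
      then show ?case using update by (simp add: update_eq_add distrib_left peval_add)
    qed
    then show ?case using update by (simp add: update_eq_add distrib_right peval_add)
  qed
qed

lemma peval_const [simp]: "peval h g (const c) = h c"
  by (simp add: const_def peval_single)

lemma peval_indet [simp]: "peval h g (indet v) = g v"
  by (simp add: indet_def peval_single)

end

text \<open>With \<open>F\<close> the identity and \<open>G\<close> a substitution followed by a map
  back, this bounds the kernel of the substitution by \<open>I\<close>. With \<open>I\<close> zero
  it is the uniqueness of evaluation.\<close>

lemma mpoly_hom_cong:
  fixes F G :: "('v, 'k::comm_ring_1) mpoly \<Rightarrow> 'a::comm_ring_1"
  assumes F: "comm_ring_hom F" and G: "comm_ring_hom G" and I: "is_ideal I"
    and c: "\<And>c. F (const c) - G (const c) \<in> I" and v: "\<And>v. F (indet v) - G (indet v) \<in> I"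
  shows "F f - G f \<in> I"
proof -
  interpret F: comm_ring_hom F by fact
  interpret G: comm_ring_hom G by fact
  show ?thesis
  proof (induction f rule: mpoly_induct)
    case (add f g)
    have "F (f + g) - G (f + g) = (F f - G f) + (F g - G g)" by (simp add: F.hom_add G.hom_add)
    then show ?case using ideal_add[OF I add] by simp
  next
    case (mult f g)
    have "F (f * g) - G (f * g) = F g * (F f - G f) + G f * (F g - G g)"
      by (simp add: F.hom_mult G.hom_mult algebra_simps)
    then show ?case using ideal_add[OF I] ideal_mult_left[OF I] mult by simp
  qed (use c v in auto)
qed

lemma comm_ring_hom_id: "comm_ring_hom (\<lambda>x. x)"
  by unfold_locales auto

lemma comm_ring_hom_comp: "comm_ring_hom f \<Longrightarrow> comm_ring_hom g \<Longrightarrow> comm_ring_hom (\<lambda>x. f (g x))"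
  for f :: "'b::comm_ring_1 \<Rightarrow> 'c::comm_ring_1" and g :: "'a::comm_ring_1 \<Rightarrow> 'b"
proof -
  assume "comm_ring_hom f" "comm_ring_hom g"
  then interpret f: comm_ring_hom f + g: comm_ring_hom g .
  show ?thesis by unfold_locales (simp_all add: f.hom_add f.hom_mult g.hom_add g.hom_mult)
qed

lemma mpoly_hom_eq:
  fixes F G :: "('v, 'k::comm_ring_1) mpoly \<Rightarrow> 'a::comm_ring_1"
  assumes F: "comm_ring_hom F" and G: "comm_ring_hom G"
    and c: "\<And>c. F (const c) = G (const c)" and v: "\<And>v. F (indet v) = G (indet v)"
  shows "F f = G f"
proof -
  have "is_ideal {0 :: 'a}" by (simp add: is_ideal_def)
  then show ?thesis using mpoly_hom_cong[OF F G, of "{0}"] c v by simp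
qed

text \<open>Only linearly ordered exponents give an \<^class>\<open>idom\<close> instance, so the target has its
  indeterminates indexed by \<^typ>\<open>nat\<close>.\<close>

lemma prime_ideal_indets:
  fixes W :: "'v::finite set"
  shows "prime_ideal (ideal_gen (indet ` W) :: ('v, 'k::field) mpoly set)"
proof -
  obtain e :: "'v \<Rightarrow> nat" where e: "inj e"
    using finite_imp_inj_to_nat_seg[of "UNIV :: 'v set"] by auto
  define J where "J = (ideal_gen (indet ` W) :: ('v, 'k) mpoly set)"
  note J = is_ideal_ideal_gen[of "indet ` W :: ('v, 'k) mpoly set", folded J_def]
  define \<phi> :: "('v, 'k) mpoly \<Rightarrow> (nat, 'k) mpoly"
    where "\<phi> = peval const (\<lambda>v. if v \<in> W then 0 else indet (e v))"
  define \<psi> :: "(nat, 'k) mpoly \<Rightarrow> ('v, 'k) mpoly" where "\<psi> = peval const (\<lambda>i. indet (inv_into UNIV e i))"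
  have \<phi>: "comm_ring_hom \<phi>" and \<psi>: "comm_ring_hom \<psi>"
    unfolding \<phi>_def \<psi>_def by (rule comm_ring_hom_peval[OF comm_ring_hom_const])+
  interpret \<phi>: comm_ring_hom \<phi> by (rule \<phi>)
  interpret \<psi>: comm_ring_hom \<psi> by (rule \<psi>)
  have phi_const: "\<phi> (const c) = const c" for c by (simp add: \<phi>_def peval_const[OF comm_ring_hom_const])
  have phi_indet: "\<phi> (indet v) = (if v \<in> W then 0 else indet (e v))" for v
    by (simp add: \<phi>_def peval_indet[OF comm_ring_hom_const])
  have psi_const: "\<psi> (const c) = const c" for c by (simp add: \<psi>_def peval_const[OF comm_ring_hom_const])
  have psi_indet: "\<psi> (indet i) = indet (inv_into UNIV e i)" for i by (simp add: \<psi>_def peval_indet[OF comm_ring_hom_const])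
  have sub: "indet v \<in> J" if "v \<in> W" for v
    using ideal_gen_superset[of "indet ` W"] that unfolding J_def by blast
  have cong: "f - \<psi> (\<phi> f) \<in> J" for f
    by (rule mpoly_hom_cong[OF comm_ring_hom_id comm_ring_hom_comp[OF \<psi> \<phi>] J])
      (auto simp: phi_const phi_indet psi_const psi_indet inv_f_f[OF e] ideal_0[OF J] sub)
  have "f \<in> J" if "\<phi> f = 0" for f using cong[of f] that by simp
  then have "{f. \<phi> f = 0} \<subseteq> J" by blast
  moreover have "J \<subseteq> {f. \<phi> f = 0}"
    unfolding J_def by (rule ideal_gen_minimal)
      (use prime_idealD(1)[OF prime_ideal_kernel[OF \<phi>]] in \<open>auto simp: phi_indet\<close>)
  ultimately show ?thesis using prime_ideal_kernel[OF \<phi>] unfolding J_def by simp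
qed

subsection \<open>Primality by elimination of a variable\<close>

definition linear_residue_ideal :: "'a::comm_ring_1 set \<Rightarrow> 'a \<Rightarrow> 'a \<Rightarrow> 'a poly set" where
  "linear_residue_ideal I Q R = {f. \<exists>h. \<forall>i. coeff (f - h * [:R, Q:]) i \<in> I}"

lemma coeff_mult_linear:
  "coeff (h * [:R, Q:]) i = R * coeff h i + (case i of 0 \<Rightarrow> 0 | Suc k \<Rightarrow> Q * coeff h k)"
  by (simp add: coeff_pCons split: nat.split)

lemma is_ideal_coeffs:
  assumes I: "is_ideal I"
  shows "is_ideal {f. \<forall>i. coeff f i \<in> I}"
  unfolding is_ideal_def
  by (auto simp: ideal_0[OF I] coeff_mult intro!: ideal_add[OF I] ideal_sum[OF I] ideal_mult_left[OF I])

lemma is_ideal_linear_residue: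
  assumes I: "is_ideal I"
  shows "is_ideal (linear_residue_ideal I Q R)"
proof -
  let ?P = "[:R, Q:]"
  define S where "S = {f. \<forall>i. coeff f i \<in> I}"
  have S: "is_ideal S" unfolding S_def by (rule is_ideal_coeffs[OF I])
  have *: "linear_residue_ideal I Q R = {f. \<exists>h. f - h * ?P \<in> S}"
    by (auto simp: linear_residue_ideal_def S_def)
  show ?thesis unfolding is_ideal_def *
  proof (intro conjI ballI allI)
    show "0 \<in> {f. \<exists>h. f - h * ?P \<in> S}"
      using ideal_0[OF S] by (auto intro: exI[of _ 0])
  next
    fix f g assume "f \<in> {f. \<exists>h. f - h * ?P \<in> S}" "g \<in> {f. \<exists>h. f - h * ?P \<in> S}"
    then obtain h k where "f - h * ?P \<in> S" "g - k * ?P \<in> S" by auto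
    then have "(f - h * ?P) + (g - k * ?P) \<in> S" by (rule ideal_add[OF S])
    moreover have "(f - h * p) + (g - k * p) = f + g - (h + k) * p" for p :: "'a poly"
      by (simp add: algebra_simps)
    ultimately have "f + g - (h + k) * ?P \<in> S" by metis
    then show "f + g \<in> {f. \<exists>h. f - h * ?P \<in> S}" by blast
  next
    fix f r assume "f \<in> {f. \<exists>h. f - h * ?P \<in> S}"
    then obtain h where "f - h * ?P \<in> S" by auto
    then have "r * (f - h * ?P) \<in> S" by (rule ideal_mult_left[OF S])
    then have "r * f - (r * h) * ?P \<in> S" by (simp only: right_diff_distrib mult.assoc)
    then show "r * f \<in> {f. \<exists>h. f - h * ?P \<in> S}" by blast
  qed
qed

lemma pseudo_division_linear:
  fixes Q R :: "'a::comm_ring_1"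
  shows "\<exists>d h r. smult (Q ^ d) f = h * [:R, Q:] + [:r:]"
proof (induction f)
  case 0
  then show ?case by (intro exI[of _ 0]) simp
next
  case (pCons a f)
  then obtain d h r where f: "smult (Q ^ d) f = h * [:R, Q:] + [:r:]" by blast
  have "smult (Q ^ Suc d) (pCons a f) = [:Q ^ Suc d * a:] + [:0, Q:] * smult (Q ^ d) f"
    by (simp add: ac_simps)
  also have "\<dots> = ([:0, Q:] * h + [:r:]) * [:R, Q:] + [:Q ^ Suc d * a - r * R:]"
    unfolding f by (simp add: algebra_simps)
  finally show ?case by blast
qed

text \<open>
  The ideal is \<open>I[X] + (Q X + R)\<close>.  Once \<open>Q\<close> is inverted, the quotient by it is a localisation of
  the quotient by \<open>I\<close>; the primality of \<open>(I, Q)\<close> and \<open>R \<notin> (I, Q)\<close> make \<open>Q\<close> a nonzerodivisor.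
\<close>

lemma prime_ideal_linear_residue:
  fixes I :: "'a::comm_ring_1 set"
  assumes I: "prime_ideal I" and L: "prime_ideal {a + Q * b |a b. a \<in> I}"
    and R: "R \<notin> {a + Q * b |a b. a \<in> I}" and Q: "Q \<notin> I"
  shows "prime_ideal (linear_residue_ideal I Q R)"
proof -
  let ?P = "[:R, Q:]" and ?L = "{a + Q * b |a b. a \<in> I}"
  define J where "J = linear_residue_ideal I Q R"
  note I' = prime_idealD[OF I] and L' = prime_idealD[OF L]
  have J: "is_ideal J" unfolding J_def by (rule is_ideal_linear_residue[OF I'(1)])
  have J_iff: "f \<in> J \<longleftrightarrow> (\<exists>h. \<forall>i. coeff (f - h * ?P) i \<in> I)" for f
    by (simp add: J_def linear_residue_ideal_def)
  have P: "h * ?P \<in> J" for h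
    unfolding J_iff by (rule exI[of _ h]) (simp add: ideal_0[OF I'(1)])
  \<comment> \<open>Comparing coefficients from the top down, \<open>Q\<close> times each
    coefficient of \<open>h\<close> lies in \<open>I\<close>; so \<open>h\<close> has its
    coefficients in \<open>I\<close> and contributes nothing modulo \<open>I\<close>.\<close>
  have const: "r \<in> I" if rJ: "[:r:] \<in> J" for r
  proof -
    obtain h where h: "\<And>i. coeff ([:r:] - h * ?P) i \<in> I" using rJ unfolding J_iff by blast
    have "coeff h i \<in> I" for i
    proof (cases "i \<le> degree h")
      case True
      then show ?thesis
      proof (induction i rule: inc_induct)
        case base
        have "coeff ([:r:] - h * ?P) (Suc (degree h)) = - (Q * coeff h (degree h))"
          unfolding coeff_diff coeff_mult_linear by (simp add: coeff_eq_0)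
        then show ?case using h[of "Suc (degree h)"] ideal_uminus[OF I'(1)] I'(3) Q by fastforce
      next
        case (step i)
        have "coeff ([:r:] - h * ?P) (Suc i) = - (R * coeff h (Suc i)) - Q * coeff h i"
          unfolding coeff_diff coeff_mult_linear by simp
        then have "- (coeff ([:r:] - h * ?P) (Suc i) + R * coeff h (Suc i)) = Q * coeff h i" by simp
        moreover have "- (coeff ([:r:] - h * ?P) (Suc i) + R * coeff h (Suc i)) \<in> I"
          using h[of "Suc i"] step.IH ideal_uminus[OF I'(1)] ideal_add[OF I'(1)] ideal_mult_left[OF I'(1)] by blast
        ultimately show ?case using I'(3) Q by simp
      qed
    next
      case False
      then show ?thesis by (simp add: coeff_eq_0 ideal_0[OF I'(1)])
    qed
    then have "coeff ([:r:] - h * ?P) 0 + R * coeff h 0 \<in> I"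
      using h ideal_add[OF I'(1)] ideal_mult_left[OF I'(1)] by blast
    then show ?thesis unfolding coeff_diff coeff_mult_linear by simp
  qed
  \<comment> \<open>Comparing coefficients from the bottom up, \<open>R\<close> times each
    coefficient of \<open>h\<close> lies in (I, Q). So \<open>h\<close> is divisible by
    \<open>Q\<close> modulo \<open>I\<close>, and \<open>Q\<close> can be cancelled because
    \<open>I\<close> is prime.\<close>
  have cancel: "f \<in> J" if QJ: "smult Q f \<in> J" for f
  proof -
    obtain h where h: "\<And>i. coeff (smult Q f - h * ?P) i \<in> I" using QJ unfolding J_iff by blast
    have hL: "coeff h i \<in> ?L" for i
    proof (induction i)
      case 0
      have "R * coeff h 0 = - coeff (smult Q f - h * ?P) 0 + Q * coeff f 0"
        unfolding coeff_diff coeff_mult_linear by simp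
      then have "R * coeff h 0 \<in> ?L" using ideal_uminus[OF I'(1) h[of 0]] by blast
      then show ?case using L'(3) R by blast
    next
      case (Suc i)
      have "R * coeff h (Suc i) = - coeff (smult Q f - h * ?P) (Suc i) + Q * (coeff f (Suc i) - coeff h i)"
        unfolding coeff_diff coeff_mult_linear by (simp add: right_diff_distrib)
      then have "R * coeff h (Suc i) \<in> ?L" using ideal_uminus[OF I'(1) h[of "Suc i"]] by blast
      then show ?case using L'(3) R by blast
    qed
    have "\<exists>b. \<forall>i. coeff (h - smult Q b) i \<in> I" if "\<And>i. coeff h i \<in> ?L" for h
      using that
    proof (induction h)
      case 0
      then show ?case by (intro exI[of _ 0]) (simp add: ideal_0[OF I'(1)])
    next
      case (pCons c h)
      have "coeff h i \<in> ?L" for i using pCons.prems[of "Suc i"] by simp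
      then obtain b where b: "\<And>i. coeff (h - smult Q b) i \<in> I" using pCons.IH by blast
      obtain a d where ad: "c = a + Q * d" "a \<in> I" using pCons.prems[of 0] by auto
      have "coeff (pCons c h - smult Q (pCons d b)) i \<in> I" for i
        using b ad(2) by (cases i) (auto simp: ad(1))
      then show ?case by blast
    qed
    then obtain b where b: "\<And>i. coeff (h - smult Q b) i \<in> I" using hL by blast
    have "Q * coeff (f - b * ?P) i \<in> I" for i
    proof -
      have "smult Q (f - b * p) = (smult Q f - h * p) + (h - smult Q b) * p" for p
        by (simp add: algebra_simps smult_diff_right)
      from this[of ?P] have "Q * coeff (f - b * ?P) i = coeff (smult Q f - h * ?P) i + coeff ((h - smult Q b) * ?P) i"
        by (metis coeff_add coeff_smult)
      moreover have "coeff ((h - smult Q b) * ?P) i \<in> I"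
        using b ideal_mult_right[OF is_ideal_coeffs[OF I'(1)], of "h - smult Q b" ?P] by blast
      ultimately show ?thesis using ideal_add[OF I'(1) h] by metis
    qed
    then have "coeff (f - b * ?P) i \<in> I" for i using I'(3) Q by blast
    then show ?thesis unfolding J_iff by blast
  qed
  have cancel_power: "f \<in> J" if "smult (Q ^ d) f \<in> J" for d f
    using that by (induction d) (auto intro: cancel simp flip: smult_smult)
  have "f \<in> J \<or> g \<in> J" if fg: "f * g \<in> J" for f g
  proof -
    \<comment> \<open>Pseudo-division replaces both factors by constants, and a constant lies in
      \<open>J\<close> only if it lies in \<open>I\<close>.\<close>
    obtain d h r where f: "smult (Q ^ d) f = h * ?P + [:r:]"
      using pseudo_division_linear by blast
    obtain e k s where g: "smult (Q ^ e) g = k * ?P + [:s:]"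
      using pseudo_division_linear by blast
    have "smult (Q ^ d) f * smult (Q ^ e) g \<in> J"
      using ideal_mult_left[OF J fg, of "[:Q ^ (d + e):]"] by (simp add: power_add mult.commute)
    moreover have "smult (Q ^ d) f * smult (Q ^ e) g = [:r * s:] + (h * smult (Q ^ e) g + k * [:r:]) * ?P"
    proof -
      have "(h * p + x) * (k * p + y) = x * y + (h * (k * p + y) + k * x) * p" for p x y :: "'a poly"
        by (simp add: algebra_simps)
      moreover have "[:r:] * [:s:] = [:r * s:]" by simp
      ultimately show ?thesis unfolding f g by metis
    qed
    ultimately have "[:r * s:] \<in> J" using P ideal_cancel_right[OF J] by metis
    then have "r \<in> I \<or> s \<in> I" using const I'(3) by blast
    then have "[:r:] \<in> J \<or> [:s:] \<in> J"
      unfolding J_iff by (auto intro!: exI[of _ 0] simp: coeff_pCons ideal_0[OF I'(1)] split: nat.split)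
    then have "smult (Q ^ d) f \<in> J \<or> smult (Q ^ e) g \<in> J"
      unfolding f g using P ideal_add[OF J] by blast
    then show ?thesis using cancel_power by blast
  qed
  moreover have "1 \<notin> J" using const[of 1] I'(2) by (auto simp: one_pCons)
  ultimately show ?thesis unfolding prime_ideal_iff J_def[symmetric] using J by blast
qed

text \<open>The coefficients stay in the same polynomial ring, in which \<open>v\<close> becomes an
  idle indeterminate. That \<open>f\<close> is free of \<open>v\<close> is expressed by
  \<open>as_poly_in v f = [:f:]\<close>.\<close>

definition as_poly_in :: "'v \<Rightarrow> ('v, 'k::comm_ring_1) mpoly \<Rightarrow> ('v, 'k) mpoly poly" where
  "as_poly_in v = peval (\<lambda>c. [:const c:]) (\<lambda>w. if w = v then [:0, 1:] else [:indet w:])"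

lemma comm_ring_hom_const_poly: "comm_ring_hom (\<lambda>c::'k::comm_ring_1. [:const c :: ('v, 'k) mpoly:])"
proof -
  interpret comm_ring_hom "const :: 'k \<Rightarrow> ('v, 'k) mpoly" by (rule comm_ring_hom_const)
  show ?thesis by unfold_locales (simp_all add: hom_add hom_mult one_pCons)
qed

lemma comm_ring_hom_as_poly_in: "comm_ring_hom (as_poly_in v)"
  unfolding as_poly_in_def by (rule comm_ring_hom_peval[OF comm_ring_hom_const_poly])

lemma as_poly_in_const: "as_poly_in v (const c) = [:const c:]"
  by (simp add: as_poly_in_def peval_const[OF comm_ring_hom_const_poly])

lemma as_poly_in_indet: "as_poly_in v (indet w) = (if w = v then [:0, 1:] else [:indet w:])"
  by (simp add: as_poly_in_def peval_indet[OF comm_ring_hom_const_poly])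

lemma comm_ring_hom_poly: "comm_ring_hom (\<lambda>p. poly p a)"
  by unfold_locales auto

lemma poly_as_poly_in: "poly (as_poly_in v f) (indet v) = f"
  by (rule mpoly_hom_eq[OF comm_ring_hom_comp[OF comm_ring_hom_poly comm_ring_hom_as_poly_in] comm_ring_hom_id])
    (simp_all add: as_poly_in_const as_poly_in_indet)

lemma ideal_gen_insert:
  fixes A :: "'a::comm_ring_1 set"
  shows "ideal_gen (insert Q A) = {a + Q * b |a b. a \<in> ideal_gen A}"
proof
  let ?L = "{a + Q * b |a b. a \<in> ideal_gen A}"
  note A = is_ideal_ideal_gen[of A] and B = is_ideal_ideal_gen[of "insert Q A"]
  have "is_ideal ?L"
    unfolding is_ideal_def
  proof (intro conjI ballI allI)
    show "0 \<in> ?L" using ideal_0[OF A] by (auto intro!: exI[of _ 0])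
  next
    fix x y assume "x \<in> ?L" "y \<in> ?L"
    then obtain a b c d where "x = a + Q * b" "y = c + Q * d" "a \<in> ideal_gen A" "c \<in> ideal_gen A" by auto
    then have "x + y = (a + c) + Q * (b + d)" "a + c \<in> ideal_gen A"
      using ideal_add[OF A] by (simp_all add: algebra_simps)
    then show "x + y \<in> ?L" by blast
  next
    fix x r assume "x \<in> ?L"
    then obtain a b where "x = a + Q * b" "a \<in> ideal_gen A" by auto
    then have "r * x = r * a + Q * (r * b)" "r * a \<in> ideal_gen A"
      using ideal_mult_left[OF A] by (simp_all add: algebra_simps)
    then show "r * x \<in> ?L" by blast
  qed
  moreover have "insert Q A \<subseteq> ?L"
  proof -
    have "Q = 0 + Q * 1" "\<And>a. a = a + Q * 0" by simp_all
    then show ?thesis using ideal_0[OF A] ideal_gen_superset[of A] by blast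
  qed
  ultimately show "ideal_gen (insert Q A) \<subseteq> ?L" by (rule ideal_gen_minimal)
  have "ideal_gen A \<subseteq> ideal_gen (insert Q A)"
    by (rule ideal_gen_minimal[OF B]) (use ideal_gen_superset[of "insert Q A"] in blast)
  moreover have "Q \<in> ideal_gen (insert Q A)" using ideal_gen_superset[of "insert Q A"] by blast
  ultimately show "?L \<subseteq> ideal_gen (insert Q A)"
    using ideal_add[OF B] ideal_mult_right[OF B] by blast
qed

text \<open>The ideal is the preimage under \<open>as_poly_in v\<close> of I[X] + (Q X + R), which
  \<open>prime_ideal_linear_residue\<close> shows to be prime. Substituting the indeterminate
  \<open>v\<close> for X turns a congruence there back into membership.\<close>

lemma prime_ideal_insert_linear:
  fixes A :: "('v, 'k::field) mpoly set"
  assumes A: "\<And>a. a \<in> A \<Longrightarrow> as_poly_in v a = [:a:]"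
    and Q: "as_poly_in v Q = [:Q:]" and R: "as_poly_in v R = [:R:]"
    and prime: "prime_ideal (ideal_gen A)" "prime_ideal (ideal_gen (insert Q A))"
    and Qn: "Q \<notin> ideal_gen A" and Rn: "R \<notin> ideal_gen (insert Q A)"
  shows "prime_ideal (ideal_gen (insert (indet v * Q + R) A))"
proof -
  define I where "I = ideal_gen A"
  define T where "T = ideal_gen (insert (indet v * Q + R) A)"
  define L where "L = linear_residue_ideal I Q R"
  note I = is_ideal_ideal_gen[of A, folded I_def]
  note T = is_ideal_ideal_gen[of "insert (indet v * Q + R) A", folded T_def]
  interpret \<phi>: comm_ring_hom "as_poly_in v" by (rule comm_ring_hom_as_poly_in)
  have L: "prime_ideal L"
    unfolding L_def I_def
    by (rule prime_ideal_linear_residue) (use prime Qn Rn in \<open>simp_all add: ideal_gen_insert\<close>)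
  have L': "is_ideal L" using prime_idealD(1)[OF L] .
  have IT: "I \<subseteq> T"
    unfolding I_def by (rule ideal_gen_minimal[OF T]) (use ideal_gen_superset in \<open>force simp: T_def\<close>)
  have P: "indet v * Q + R \<in> T" using ideal_gen_superset unfolding T_def by blast
  have AI: "A \<subseteq> I" unfolding I_def by (rule ideal_gen_superset)
  have "insert (indet v * Q + R) A \<subseteq> {f. as_poly_in v f \<in> L}"
  proof -
    have "as_poly_in v (indet v * Q + R) = 1 * [:R, Q:]"
      by (simp add: \<phi>.hom_add \<phi>.hom_mult as_poly_in_indet Q R)
    moreover have "1 * [:R, Q:] \<in> L"
      unfolding L_def linear_residue_ideal_def by (rule CollectI, rule exI[of _ 1]) (simp add: ideal_0[OF I])
    moreover have "as_poly_in v a \<in> L" if "a \<in> A" for a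
      unfolding L_def linear_residue_ideal_def
      by (rule CollectI, rule exI[of _ 0])
        (use that AI A in \<open>auto simp: coeff_pCons ideal_0[OF I] split: nat.split\<close>)
    ultimately show ?thesis by auto
  qed
  moreover have V: "prime_ideal {f. as_poly_in v f \<in> L}"
    by (rule prime_ideal_vimage[OF comm_ring_hom_as_poly_in L])
  ultimately have "T \<subseteq> {f. as_poly_in v f \<in> L}"
    unfolding T_def using ideal_gen_minimal prime_idealD(1) by blast
  moreover have "f \<in> T" if fL: "as_poly_in v f \<in> L" for f
  proof -
    obtain h where h: "\<And>i. coeff (as_poly_in v f - h * [:R, Q:]) i \<in> I"
      using fL unfolding L_def linear_residue_ideal_def by blast
    have "poly (as_poly_in v f - h * [:R, Q:]) (indet v) \<in> I"
      unfolding poly_altdef by (rule ideal_sum[OF I ideal_mult_right[OF I h]])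
    moreover have "poly (as_poly_in v f - h * [:R, Q:]) (indet v) = f - poly h (indet v) * (indet v * Q + R)"
      by (simp add: poly_as_poly_in algebra_simps)
    ultimately have "f - poly h (indet v) * (indet v * Q + R) \<in> T" using IT by auto
    then show ?thesis
      using ideal_add[OF T _ ideal_mult_left[OF T P]] by (metis diff_add_cancel)
  qed
  ultimately have "T = {f. as_poly_in v f \<in> L}" by blast
  then show ?thesis using V unfolding T_def by simp
qed

lemma not_in_ideal_gen_peval:
  fixes A :: "('v, 'k::field) mpoly set"
  assumes "\<And>a. a \<in> A \<Longrightarrow> peval (\<lambda>c. c) x a = 0" and "peval (\<lambda>c. c) x f \<noteq> 0"
  shows "f \<notin> ideal_gen A"
proof -
  have "is_ideal {a. peval (\<lambda>c. c) x a = 0}"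
    using prime_ideal_kernel[OF comm_ring_hom_peval[OF comm_ring_hom_id]] prime_idealD(1) by blast
  then have "ideal_gen A \<subseteq> {a. peval (\<lambda>c. c) x a = 0}"
    by (rule ideal_gen_minimal) (use assms(1) in blast)
  then show ?thesis using assms(2) by blast
qed

context
  fixes v :: 'v
begin

interpretation \<phi>: comm_ring_hom "as_poly_in v :: ('v, 'k::comm_ring_1) mpoly \<Rightarrow> _"
  by (rule comm_ring_hom_as_poly_in)

lemma as_poly_in_free_add: "as_poly_in v f = [:f:] \<Longrightarrow> as_poly_in v g = [:g:] \<Longrightarrow> as_poly_in v (f + g) = [:f + g:]"
  by (simp add: \<phi>.hom_add)

lemma as_poly_in_free_mult: "as_poly_in v f = [:f:] \<Longrightarrow> as_poly_in v g = [:g:] \<Longrightarrow> as_poly_in v (f * g) = [:f * g:]"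
  by (simp add: \<phi>.hom_mult)

end

context
  fixes x :: "'v \<Rightarrow> 'k::field"
begin

interpretation ev: comm_ring_hom "peval (\<lambda>c. c) x :: ('v, 'k) mpoly \<Rightarrow> 'k"
  by (rule comm_ring_hom_peval[OF comm_ring_hom_id])

lemma eval_indet: "peval (\<lambda>c. c) x (indet v) = x v"
  by (rule peval_indet[OF comm_ring_hom_id])

lemma eval_add: "peval (\<lambda>c. c) x (f + g) = peval (\<lambda>c. c) x f + peval (\<lambda>c. c) x g"
  by (rule ev.hom_add)

lemma eval_mult: "peval (\<lambda>c. c) x (f * g) = peval (\<lambda>c. c) x f * peval (\<lambda>c. c) x g"
  by (rule ev.hom_mult)

end

lemmas eval_simps = eval_indet eval_add eval_mult

text \<open>The 2 x 2 permanent is linear in \<open>a\<close> with coefficient \<open>d\<close>. In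
  the two nonmembership goals the chosen point is a zero of the generators at which the excluded
  polynomial has value 1.\<close>

lemma prime_ideal_block:
  fixes W :: "'v::finite set"
  assumes d: "distinct [a, b, c, d]" and W: "{a, b, c, d} \<inter> W = {}"
  shows "prime_ideal (ideal_gen (insert (indet a * indet d + indet b * indet c) (indet ` W))
    :: ('v, 'k::field) mpoly set)"
proof (rule prime_ideal_insert_linear)
  show "prime_ideal (ideal_gen (indet ` W) :: ('v, 'k) mpoly set)" by (rule prime_ideal_indets)
  show "prime_ideal (ideal_gen (insert (indet d) (indet ` W)) :: ('v, 'k) mpoly set)"
    using prime_ideal_indets[of "insert d W", where 'k = 'k] by simp
  show "(indet d :: ('v, 'k) mpoly) \<notin> ideal_gen (indet ` W)"
    by (rule not_in_ideal_gen_peval[where x = "\<lambda>v. if v = d then 1 else 0"]) (use W in \<open>auto simp: eval_simps\<close>)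
  show "(indet b * indet c :: ('v, 'k) mpoly) \<notin> ideal_gen (insert (indet d) (indet ` W))"
    by (rule not_in_ideal_gen_peval[where x = "\<lambda>v. if v = b \<or> v = c then 1 else 0"])
      (use W d in \<open>auto simp: eval_simps\<close>)
qed (use W d in \<open>auto simp: as_poly_in_indet as_poly_in_free_add as_poly_in_free_mult\<close>)

lemma prime_ideal_two_blocks:
  fixes W :: "'v::finite set"
  assumes d: "distinct [a, b, c, d, a', b', c', d']" and W: "{a, b, c, d, a', b', c', d'} \<inter> W = {}"
  shows "prime_ideal (ideal_gen (insert (indet a' * indet d' + indet b' * indet c')
    (insert (indet a * indet d + indet b * indet c) (indet ` W))) :: ('v, 'k::field) mpoly set)"
proof (rule prime_ideal_insert_linear)
  show "prime_ideal (ideal_gen (insert (indet a * indet d + indet b * indet c) (indet ` W)) :: ('v, 'k) mpoly set)"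
    by (rule prime_ideal_block) (use W d in auto)
  show "prime_ideal (ideal_gen (insert (indet d') (insert (indet a * indet d + indet b * indet c) (indet ` W)))
    :: ('v, 'k) mpoly set)"
  proof -
    have "prime_ideal (ideal_gen (insert (indet a * indet d + indet b * indet c) (indet ` insert d' W))
        :: ('v, 'k) mpoly set)"
      by (rule prime_ideal_block) (use W d in auto)
    then show ?thesis by (simp add: insert_commute)
  qed
  show "(indet d' :: ('v, 'k) mpoly) \<notin>
      ideal_gen (insert (indet a * indet d + indet b * indet c) (indet ` W))"
    by (rule not_in_ideal_gen_peval[where x = "\<lambda>v. if v = d' then 1 else 0"])
      (use W d in \<open>auto simp: eval_simps\<close>)
  show "(indet b' * indet c' :: ('v, 'k) mpoly) \<notin>
      ideal_gen (insert (indet d') (insert (indet a * indet d + indet b * indet c) (indet ` W)))"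
    by (rule not_in_ideal_gen_peval[where x = "\<lambda>v. if v = b' \<or> v = c' then 1 else 0"])
      (use W d in \<open>auto simp: eval_simps\<close>)
qed (use W d in \<open>auto simp: as_poly_in_indet as_poly_in_free_add as_poly_in_free_mult\<close>)

text \<open>The permanent is linear in \<open>a\<close>, and the coefficient is a 2 x 2 permanent,
  covered by \<open>prime_ideal_block\<close>. Where \<open>b\<close>, \<open>d\<close>,
  \<open>i\<close> are 1 and the rest 0, the coefficient vanishes while the remainder does
  not.\<close>

lemma prime_ideal_permanent_three:
  fixes W :: "'v::finite set"
  assumes d: "distinct [a, b, c, d, e, f, g, h, i]" and W: "{a, b, c, d, e, f, g, h, i} \<inter> W = {}"
  shows "prime_ideal (ideal_gen (insert (indet a * (indet e * indet i + indet f * indet h) +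
    (indet b * (indet d * indet i + indet f * indet g) + indet c * (indet d * indet h + indet e * indet g)))
    (indet ` W)) :: ('v, 'k::field) mpoly set)"
proof (rule prime_ideal_insert_linear)
  show "prime_ideal (ideal_gen (indet ` W) :: ('v, 'k) mpoly set)" by (rule prime_ideal_indets)
  show "prime_ideal (ideal_gen (insert (indet e * indet i + indet f * indet h) (indet ` W)) :: ('v, 'k) mpoly set)"
    by (rule prime_ideal_block) (use W d in auto)
  show "(indet e * indet i + indet f * indet h :: ('v, 'k) mpoly) \<notin> ideal_gen (indet ` W)"
    by (rule not_in_ideal_gen_peval[where x = "\<lambda>v. if v = e \<or> v = i then 1 else 0"])
      (use W d in \<open>auto simp: eval_simps\<close>)
  show "(indet b * (indet d * indet i + indet f * indet g) + indet c * (indet d * indet h + indet e * indet g) :: ('v, 'k) mpoly)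
      \<notin> ideal_gen (insert (indet e * indet i + indet f * indet h) (indet ` W))"
    by (rule not_in_ideal_gen_peval[where x = "\<lambda>v. if v = b \<or> v = d \<or> v = i then 1 else 0"])
      (use W d in \<open>auto simp: eval_simps\<close>)
qed (use W d in \<open>auto simp: as_poly_in_indet as_poly_in_free_add as_poly_in_free_mult\<close>)

subsection \<open>The prime ideals of types (1), (2), (3) and (2,2)\<close>

lemma permanent_2:
  assumes "dim_row A = 2"
  shows "permanent A = A $$ (0, 0) * A $$ (1, 1) + A $$ (0, 1) * A $$ (1, 0)"
proof -
  have "{0..<2} = {0, 1::nat}" by auto
  then show ?thesis
    unfolding permanent_def assms
    by (simp add: sum_over_permutations_insert Transposition.transpose_def)
qed

lemma permanent_3:
  assumes "dim_row A = 3"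
  shows "permanent A = tripling (\<lambda>j. A $$ (0, j)) (\<lambda>j. A $$ (1, j)) (\<lambda>j. A $$ (2, j)) 0 1 2"
proof -
  have "{0..<3} = {0, 1, 2::nat}" by auto
  then show ?thesis
    unfolding permanent_def assms tripling_def pairing_def
    by (simp add: sum_over_permutations_insert Transposition.transpose_def algebra_simps)
qed

definition generic_entry :: "'m \<Rightarrow> 'n \<Rightarrow> ('m \<times> 'n, 'k::zero_neq_one) mpoly" where
  "generic_entry i j = indet (i, j)"

lemma permanent_generic_2:
  "permanent (generic_sub [r, s] [a, b]) = pairing (generic_entry r) (generic_entry s) a b"
  by (subst permanent_2) (simp_all add: generic_sub_def sub_indices_def generic_entry_def pairing_def)

lemma permanent_generic_3:
  "permanent (generic_sub [r, s, t] [a, b, c]) =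
     tripling (generic_entry r) (generic_entry s) (generic_entry t) a b c"
  by (subst permanent_3)
    (simp_all add: generic_sub_def sub_indices_def generic_entry_def tripling_def pairing_def numeral_2_eq_2)

lemma index_list_2: "index_list 2 xs \<longleftrightarrow> (\<exists>a b. xs = [a, b] \<and> a \<noteq> b)"
  unfolding index_list_def by (auto simp: numeral_eq_Suc length_Suc_conv)

lemma index_list_3: "index_list 3 xs \<longleftrightarrow> (\<exists>a b c. xs = [a, b, c] \<and> distinct [a, b, c])"
  unfolding index_list_def by (auto simp: numeral_eq_Suc length_Suc_conv)

lemma permanental_ideal_3:
  "permanental_ideal 3 = ideal_gen {tripling (generic_entry r) (generic_entry s) (generic_entry t) a b c |
     r s t a b c. distinct [r, s, t] \<and> distinct [a, b, c]}"
  unfolding permanental_ideal_def index_list_3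
  by (rule arg_cong[where f = ideal_gen]) (auto simp del: distinct.simps simp: permanent_generic_3; metis permanent_generic_3)

lemma permanental_ideal_3_le:
  assumes "is_ideal J"
    and "\<And>r s t a b c. distinct [r, s, t] \<Longrightarrow> distinct [a, b, c] \<Longrightarrow>
      tripling (generic_entry r) (generic_entry s) (generic_entry t) a b c \<in> J"
  shows "permanental_ideal 3 \<subseteq> J"
  unfolding permanental_ideal_3 by (rule ideal_gen_minimal) (use assms in blast)+

section \<open>Ideals that contain all 3 x 3 permanents\<close>

context
  fixes J :: "'a::comm_ring_1 set" and y :: "'m \<Rightarrow> 'n \<Rightarrow> 'a"
  assumes J: "is_ideal J"
begin

lemma pairing_ideal_row:
  assumes "\<And>j. y s j \<in> J"
  shows "pairing (y s) (y t) a b \<in> J" "pairing (y t) (y s) a b \<in> J"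
  unfolding pairing_def
  using assms by (auto intro!: ideal_add[OF J] intro: ideal_mult_left[OF J] ideal_mult_right[OF J])

lemma pairing_ideal_col:
  assumes "y s a \<in> J" "y t a \<in> J"
  shows "pairing (y s) (y t) a b \<in> J" "pairing (y s) (y t) b a \<in> J"
  unfolding pairing_def
  using assms by (auto intro!: ideal_add[OF J] intro: ideal_mult_left[OF J] ideal_mult_right[OF J])

lemma tripling_ideal_pairing:
  assumes "\<And>a b. a \<noteq> b \<Longrightarrow> pairing (y s) (y t) a b \<in> J" and "distinct [a, b, c]"
  shows "tripling (y r) (y s) (y t) a b c \<in> J"
    "tripling (y s) (y r) (y t) a b c \<in> J" "tripling (y s) (y t) (y r) a b c \<in> J"
proof -
  have t: "tripling (y r) (y s) (y t) a b c \<in> J"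
    unfolding tripling_def
    using assms by (auto intro!: ideal_add[OF J] ideal_mult_left[OF J])
  moreover have "tripling (y s) (y r) (y t) a b c = tripling (y r) (y s) (y t) a b c"
    "tripling (y s) (y t) (y r) a b c = tripling (y r) (y s) (y t) a b c"
    by (simp_all add: tripling_def pairing_def algebra_simps)
  ultimately show "tripling (y r) (y s) (y t) a b c \<in> J"
    "tripling (y s) (y r) (y t) a b c \<in> J" "tripling (y s) (y t) (y r) a b c \<in> J" by auto
qed

lemma tripling_ideal_row:
  assumes "r \<in> {s, t, u}" "\<And>j. y r j \<in> J"
  shows "tripling (y s) (y t) (y u) a b c \<in> J"
  using assms pairing_ideal_row[of r] unfolding tripling_def
  by (auto intro!: ideal_add[OF J] intro: ideal_mult_left[OF J] ideal_mult_right[OF J])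

lemma tripling_ideal_without_row:
  assumes "\<And>s t a b. s \<noteq> p \<Longrightarrow> t \<noteq> p \<Longrightarrow> s \<noteq> t \<Longrightarrow> a \<noteq> b \<Longrightarrow> pairing (y s) (y t) a b \<in> J"
    and "distinct [r, s, t]" "distinct [a, b, c]"
  shows "tripling (y r) (y s) (y t) a b c \<in> J"
proof -
  consider "s \<noteq> p" "t \<noteq> p" | "r \<noteq> p" "t \<noteq> p" | "r \<noteq> p" "s \<noteq> p" using assms(2) by auto
  then show ?thesis
  proof cases
    case 1
    then show ?thesis using tripling_ideal_pairing(1)[of s t] assms by auto
  next
    case 2
    then show ?thesis using tripling_ideal_pairing(2)[of r t] assms by auto
  next
    case 3
    then show ?thesis using tripling_ideal_pairing(3)[of r s] assms by auto
  qed
qed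

lemma pairing_ideal_block:
  assumes rows: "\<And>i j. i \<in> {s, t} \<Longrightarrow> (i, j) \<notin> {r, r'} \<times> {c, c'} \<Longrightarrow> y i j \<in> J"
    and p: "pairing (y r) (y r') c c' \<in> J" and "s \<noteq> t" "a \<noteq> b"
  shows "pairing (y s) (y t) a b \<in> J"
proof (cases "{s, t} = {r, r'} \<and> {a, b} = {c, c'}")
  case True
  then have "pairing (y s) (y t) a b = pairing (y r) (y r') c c'"
    by (auto simp: doubleton_eq_iff pairing_def algebra_simps)
  then show ?thesis using p by simp
next
  case False
  then consider "s \<notin> {r, r'}" | "t \<notin> {r, r'}" | "a \<notin> {c, c'}" | "b \<notin> {c, c'}"
    using assms(3,4) by auto
  then show ?thesis
  proof cases
    case 1
    then show ?thesis using pairing_ideal_row(1)[of s] rows[of s] by blast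
  next
    case 2
    then show ?thesis using pairing_ideal_row(2)[of t] rows[of t] by blast
  next
    case 3
    then show ?thesis using pairing_ideal_col(1)[of s a t] rows by blast
  next
    case 4
    then show ?thesis using pairing_ideal_col(2)[of s b t] rows by blast
  qed
qed

end

text \<open>Three distinct rows do not fit into two deleted ones. With one row and one column
  deleted, any two columns include an undeleted one, whose entries outside the deleted row lie in
  \<open>J\<close>. Two deleted columns follow by transposition.\<close>

lemma tripling_ideal_two_lines:
  fixes y :: "'m::finite \<Rightarrow> 'n::finite \<Rightarrow> 'a::comm_ring_1"
  assumes J: "is_ideal J" and "card (- R) + card (- C) = 2" and y: "\<And>i j. i \<in> R \<Longrightarrow> j \<in> C \<Longrightarrow> y i j \<in> J"
    and d: "distinct [r, s, t]" "distinct [a, b, c]"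
  shows "tripling (y r) (y s) (y t) a b c \<in> J"
proof -
  have two_rows: "tripling (y r) (y s) (y t) a b c \<in> J"
    if cards: "card (- R) = 2" "card (- C) = 0" and y: "\<And>i j. i \<in> R \<Longrightarrow> j \<in> C \<Longrightarrow> y i j \<in> J"
      and d: "distinct [r, s, t]"
    for y :: "'x::finite \<Rightarrow> 'y::finite \<Rightarrow> 'a" and R C r s t a b c
  proof -
    have "C = UNIV" using cards(2) by auto
    obtain p q where pq: "- R = {p, q}" using cards(1) by (auto simp: card_2_iff)
    have "r \<notin> {p, q} \<or> s \<notin> {p, q} \<or> t \<notin> {p, q}" using d by auto
    then obtain i where "i \<in> {r, s, t}" "i \<in> R" using pq by blast
    then show ?thesis using tripling_ideal_row[OF J, of i r s t y] y \<open>C = UNIV\<close> by blast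
  qed
  consider "card (- R) = 2" "card (- C) = 0" | "card (- R) = 1" "card (- C) = 1"
    | "card (- R) = 0" "card (- C) = 2" using assms(2) by linarith
  then show ?thesis
  proof cases
    case 1
    show ?thesis by (rule two_rows[OF 1 y d(1)])
  next
    case 2
    then obtain p q where pq: "- R = {p}" "- C = {q}" by (auto simp: card_1_singleton_iff)
    have RC: "i \<in> R \<longleftrightarrow> i \<noteq> p" "j \<in> C \<longleftrightarrow> j \<noteq> q" for i j using pq by blast+
    have "pairing (y s) (y t) a b \<in> J" if "s \<noteq> p" "t \<noteq> p" "a \<noteq> b" for s t a b
    proof -
      have "s \<in> R" "t \<in> R" "a \<in> C \<or> b \<in> C" using RC that by auto
      then show ?thesis using pairing_ideal_col[OF J, of y] y by blast
    qed
    then show ?thesis using tripling_ideal_without_row[OF J, of p y] d by blast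
  next
    case 3
    show ?thesis unfolding tripling_transpose
      by (rule two_rows[OF 3(2,1) _ d(2)]) (use y in blast)
  qed
qed

lemma tripling_ideal_line_block:
  fixes y :: "'m::finite \<Rightarrow> 'n::finite \<Rightarrow> 'a::comm_ring_1"
  assumes J: "is_ideal J" and "card (- R) + card (- C) = 1"
    and y: "\<And>i j. i \<in> R \<Longrightarrow> j \<in> C \<Longrightarrow> (i, j) \<notin> {p, p'} \<times> {q, q'} \<Longrightarrow> y i j \<in> J"
    and pr: "pairing (y p) (y p') q q' \<in> J"
    and d: "distinct [r, s, t]" "distinct [a, b, c]"
  shows "tripling (y r) (y s) (y t) a b c \<in> J"
proof -
  have row: "tripling (y r) (y s) (y t) a b c \<in> J"
    if cards: "card (- R) = 1" "card (- C) = 0"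
      and y: "\<And>i j. i \<in> R \<Longrightarrow> j \<in> C \<Longrightarrow> (i, j) \<notin> {p, p'} \<times> {q, q'} \<Longrightarrow> y i j \<in> J"
      and pr: "pairing (y p) (y p') q q' \<in> J"
      and d: "distinct [r, s, t]" "distinct [a, b, c]"
    for y :: "'x::finite \<Rightarrow> 'y::finite \<Rightarrow> 'a" and R C r s t a b c p p' q q'
  proof -
    have "C = UNIV" using cards(2) by auto
    obtain l where l: "- R = {l}" using cards(1) by (auto simp: card_1_singleton_iff)
    have "pairing (y s) (y t) a b \<in> J" if "s \<noteq> l" "t \<noteq> l" "s \<noteq> t" "a \<noteq> b" for s t a b
      by (rule pairing_ideal_block[OF J _ pr]) (use y l that \<open>C = UNIV\<close> in auto)
    then show ?thesis using tripling_ideal_without_row[OF J, of l y] d by blast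
  qed
  consider "card (- R) = 1" "card (- C) = 0" | "card (- C) = 1" "card (- R) = 0"
    using assms(2) by linarith
  then show ?thesis
  proof cases
    case 1
    show ?thesis by (rule row[OF 1 y pr d])
  next
    case 2
    have "pairing (\<lambda>i. y i q) (\<lambda>i. y i q') p p' \<in> J" using pr by (metis pairing_transpose)
    then show ?thesis unfolding tripling_transpose
      by (intro row[OF 2 _ _ d(2,1), of q q' p p' "\<lambda>j i. y i j"]) (use y in auto)
  qed
qed

text \<open>Unless one of the three rows lies entirely in \<open>J\<close>, two of them meet the
  same block by pigeonhole, and all products of these two rows are in \<open>J\<close>.\<close>

lemma tripling_ideal_two_blocks:
  fixes y :: "'m \<Rightarrow> 'n \<Rightarrow> 'a::comm_ring_1"
  assumes J: "is_ideal J" and rows: "distinct [p, p', u, u']" and cols: "distinct [q, q', v, v']"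
    and y: "\<And>i j. (i, j) \<notin> {p, p'} \<times> {q, q'} \<union> {u, u'} \<times> {v, v'} \<Longrightarrow> y i j \<in> J"
    and pr: "pairing (y p) (y p') q q' \<in> J" "pairing (y u) (y u') v v' \<in> J"
    and d: "distinct [r, s, t]" "distinct [a, b, c]"
  shows "tripling (y r) (y s) (y t) a b c \<in> J"
proof (cases "{r, s, t} \<subseteq> {p, p', u, u'}")
  case False
  then obtain i where "i \<in> {r, s, t}" "i \<notin> {p, p', u, u'}" by blast
  then show ?thesis using tripling_ideal_row[OF J, of i r s t y] y by blast
next
  case True
  have y1: "y i j \<in> J" if "i \<in> {p, p'}" "(i, j) \<notin> {p, p'} \<times> {q, q'}" for i j
    by (rule y) (use rows that in force)
  have y2: "y i j \<in> J" if "i \<in> {u, u'}" "(i, j) \<notin> {u, u'} \<times> {v, v'}" for i j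
    by (rule y) (use rows that in force)
  have pp: "pairing (y i) (y k) a b \<in> J" if "i \<noteq> k" "a \<noteq> b" "i \<in> {p, p'}" "k \<in> {p, p'}" for i k a b
    by (rule pairing_ideal_block[OF J _ pr(1) that(1,2)], rule y1) (use that in blast)+
  have uu: "pairing (y i) (y k) a b \<in> J" if "i \<noteq> k" "a \<noteq> b" "i \<in> {u, u'}" "k \<in> {u, u'}" for i k a b
    by (rule pairing_ideal_block[OF J _ pr(2) that(1,2)], rule y2) (use that in blast)+
  have same: "pairing (y i) (y k) a b \<in> J"
    if "i \<noteq> k" "a \<noteq> b" "i \<in> {p, p'} \<and> k \<in> {p, p'} \<or> i \<in> {u, u'} \<and> k \<in> {u, u'}" for i k a b
    using pp uu that by blast
  have "s \<in> {p, p'} \<and> t \<in> {p, p'} \<or> s \<in> {u, u'} \<and> t \<in> {u, u'} \<or>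
    r \<in> {p, p'} \<and> t \<in> {p, p'} \<or> r \<in> {u, u'} \<and> t \<in> {u, u'} \<or>
    r \<in> {p, p'} \<and> s \<in> {p, p'} \<or> r \<in> {u, u'} \<and> s \<in> {u, u'}"
    using True by blast
  then consider "s \<in> {p, p'} \<and> t \<in> {p, p'} \<or> s \<in> {u, u'} \<and> t \<in> {u, u'}"
    | "r \<in> {p, p'} \<and> t \<in> {p, p'} \<or> r \<in> {u, u'} \<and> t \<in> {u, u'}"
    | "r \<in> {p, p'} \<and> s \<in> {p, p'} \<or> r \<in> {u, u'} \<and> s \<in> {u, u'}" by blast
  moreover have "r \<noteq> s" "r \<noteq> t" "s \<noteq> t" using d by auto
  ultimately show ?thesis
    by cases (rule tripling_ideal_pairing[OF J _ d(2)], rule same, assumption+)+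
qed

lemma tripling_permute_rows:
  assumes "distinct [r, s, t]" "{r, s, t} \<subseteq> {r', s', t'}"
  shows "tripling (y r) (y s) (y t) a b c = tripling (y r') (y s') (y t') a b c"
proof -
  have sw: "tripling (y r) (y s) (y t) a b c = tripling (y s) (y r) (y t) a b c"
    "tripling (y r) (y s) (y t) a b c = tripling (y r) (y t) (y s) a b c" for r s t
    by (simp_all add: tripling_def pairing_def algebra_simps)
  have "r \<in> {r', s', t'}" "s \<in> {r', s', t'}" "t \<in> {r', s', t'}" "r \<noteq> s" "r \<noteq> t" "s \<noteq> t" using assms by auto
  then show ?thesis using sw by (elim insertE emptyE) metis+
qed

lemma tripling_ideal_three:
  fixes y :: "'m \<Rightarrow> 'n \<Rightarrow> 'a::comm_ring_1"
  assumes J: "is_ideal J"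
    and y: "\<And>i j. (i, j) \<notin> {r', s', t'} \<times> {a', b', c'} \<Longrightarrow> y i j \<in> J"
    and tr: "tripling (y r') (y s') (y t') a' b' c' \<in> J"
    and d: "distinct [r, s, t]" "distinct [a, b, c]"
  shows "tripling (y r) (y s) (y t) a b c \<in> J"
proof (cases "{r, s, t} \<subseteq> {r', s', t'}")
  case False
  then obtain i where "i \<in> {r, s, t}" "i \<notin> {r', s', t'}" by blast
  then show ?thesis using tripling_ideal_row[OF J, of i r s t y] y by blast
next
  case rows: True
  show ?thesis
  proof (cases "{a, b, c} \<subseteq> {a', b', c'}")
    case False
    then obtain j where "j \<in> {a, b, c}" "j \<notin> {a', b', c'}" by blast
    then show ?thesis unfolding tripling_transpose
      using tripling_ideal_row[OF J, of j a b c "\<lambda>j i. y i j"] y by blast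
  next
    case True
    have "tripling (y r) (y s) (y t) a b c = tripling (y r') (y s') (y t') a b c"
      by (rule tripling_permute_rows[OF d(1) rows])
    also have "\<dots> = tripling (y r') (y s') (y t') a' b' c'"
      unfolding tripling_transpose[of y] by (rule tripling_permute_rows[OF d(2) True])
    finally show ?thesis using tr by simp
  qed
qed

lemma minimal_prime_overD:
  assumes "minimal_prime_over I P" "prime_ideal Q" "I \<subseteq> Q" "Q \<subseteq> P"
  shows "P = Q"
  using assms unfolding minimal_prime_over_def by blast

lemma generic_entry_in_ideal_gen: "(i, j) \<in> W \<Longrightarrow> indet ` W \<subseteq> A \<Longrightarrow> generic_entry i j \<in> ideal_gen A"
  using ideal_gen_superset[of A] unfolding generic_entry_def by blast

lemma prime_over_two_lines:
  fixes R :: "'m::finite set" and C :: "'n::finite set"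
  assumes "card R + card C + 2 = CARD('m) + CARD('n)"
  defines "T \<equiv> ideal_gen (indet ` (R \<times> C)) :: ('m \<times> 'n, 'k::field) mpoly set"
  shows "prime_ideal T" "permanental_ideal 3 \<subseteq> T"
proof -
  show T: "prime_ideal T" unfolding T_def by (rule prime_ideal_indets)
  have "card (- R) + card (- C) = 2"
    using assms(1) card_Compl_eq[of R] card_Compl_eq[of C] by simp
  then show "permanental_ideal 3 \<subseteq> T"
    by (intro permanental_ideal_3_le prime_idealD(1)[OF T] tripling_ideal_two_lines)
      (auto simp: T_def intro: generic_entry_in_ideal_gen)
qed

lemma prime_over_line_block:
  fixes R :: "'m::finite set" and C :: "'n::finite set"
  assumes "card R + card C + 1 = CARD('m) + CARD('n)" and "p \<noteq> p'" "q \<noteq> q'"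
  defines "T \<equiv> ideal_gen ({permanent (generic_sub [p, p'] [q, q'])} \<union> indet ` (R \<times> C - {p, p'} \<times> {q, q'}))
    :: ('m \<times> 'n, 'k::field) mpoly set"
  shows "prime_ideal T" "permanental_ideal 3 \<subseteq> T"
proof -
  have perm: "permanent (generic_sub [p, p'] [q, q'] :: ('m \<times> 'n, 'k) mpoly mat) =
      indet (p, q) * indet (p', q') + indet (p, q') * indet (p', q)"
    unfolding permanent_generic_2 by (simp add: pairing_def generic_entry_def)
  have "prime_ideal (ideal_gen (insert (indet (p, q) * indet (p', q') + indet (p, q') * indet (p', q))
      (indet ` (R \<times> C - {p, p'} \<times> {q, q'}))) :: ('m \<times> 'n, 'k) mpoly set)"
    by (rule prime_ideal_block) (use assms(2,3) in auto)
  then show T: "prime_ideal T" unfolding T_def perm by simp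
  have "card (- R) + card (- C) = 1"
    using assms(1) card_Compl_eq[of R] card_Compl_eq[of C] by simp
  moreover have "generic_entry i j \<in> T" if "i \<in> R" "j \<in> C" "(i, j) \<notin> {p, p'} \<times> {q, q'}" for i j
    unfolding T_def by (rule generic_entry_in_ideal_gen[OF _ Un_upper2]) (use that in blast)
  moreover have "pairing (generic_entry p) (generic_entry p') q q' \<in> T"
    unfolding T_def permanent_generic_2 by (rule subsetD[OF ideal_gen_superset], simp)
  ultimately show "permanental_ideal 3 \<subseteq> T"
    by (intro permanental_ideal_3_le prime_idealD(1)[OF T] tripling_ideal_line_block[where y = generic_entry])
qed

lemma prime_over_two_blocks:
  fixes p p' u u' :: "'m::finite" and q q' v v' :: "'n::finite"
  assumes d: "distinct [p, p', u, u']" "distinct [q, q', v, v']"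
  defines "T \<equiv> ideal_gen ({permanent (generic_sub [p, p'] [q, q']), permanent (generic_sub [u, u'] [v, v'])} \<union>
      indet ` (- ({p, p'} \<times> {q, q'} \<union> {u, u'} \<times> {v, v'}))) :: ('m \<times> 'n, 'k::field) mpoly set"
  shows "prime_ideal T" "permanental_ideal 3 \<subseteq> T"
proof -
  have perm: "permanent (generic_sub [p, p'] [q, q'] :: ('m \<times> 'n, 'k) mpoly mat) =
      indet (p, q) * indet (p', q') + indet (p, q') * indet (p', q)" for p p' and q q'
    unfolding permanent_generic_2 by (simp add: pairing_def generic_entry_def)
  have "prime_ideal (ideal_gen (insert (indet (u, v) * indet (u', v') + indet (u, v') * indet (u', v))
      (insert (indet (p, q) * indet (p', q') + indet (p, q') * indet (p', q))
      (indet ` (- ({p, p'} \<times> {q, q'} \<union> {u, u'} \<times> {v, v'}))))) :: ('m \<times> 'n, 'k) mpoly set)"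
  proof (rule prime_ideal_two_blocks)
    show "distinct [(p, q), (p, q'), (p', q), (p', q'), (u, v), (u, v'), (u', v), (u', v')]"
      using d by simp
  qed blast
  then show T: "prime_ideal T" unfolding T_def perm by (simp add: insert_commute)
  have "generic_entry i j \<in> T" if "(i, j) \<notin> {p, p'} \<times> {q, q'} \<union> {u, u'} \<times> {v, v'}" for i j
    unfolding T_def
    by (rule generic_entry_in_ideal_gen[OF _ Un_upper2]) (use that in blast)
  moreover have "pairing (generic_entry p) (generic_entry p') q q' \<in> T"
    "pairing (generic_entry u) (generic_entry u') v v' \<in> T"
    unfolding T_def permanent_generic_2 by (rule subsetD[OF ideal_gen_superset], simp)+
  ultimately show "permanental_ideal 3 \<subseteq> T"
    using d
    by (intro permanental_ideal_3_le prime_idealD(1)[OF T] tripling_ideal_two_blocks[where y = generic_entry])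
qed

lemma prime_over_three:
  fixes r s t :: "'m::finite" and a b c :: "'n::finite"
  assumes d: "distinct [r, s, t]" "distinct [a, b, c]"
  defines "T \<equiv> ideal_gen ({permanent (generic_sub [r, s, t] [a, b, c])} \<union> indet ` (- ({r, s, t} \<times> {a, b, c})))
    :: ('m \<times> 'n, 'k::field) mpoly set"
  shows "prime_ideal T" "permanental_ideal 3 \<subseteq> T"
proof -
  have perm: "permanent (generic_sub [r, s, t] [a, b, c] :: ('m \<times> 'n, 'k) mpoly mat) =
      indet (r, a) * (indet (s, b) * indet (t, c) + indet (s, c) * indet (t, b)) +
      (indet (r, b) * (indet (s, a) * indet (t, c) + indet (s, c) * indet (t, a)) +
       indet (r, c) * (indet (s, a) * indet (t, b) + indet (s, b) * indet (t, a)))"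
    unfolding permanent_generic_3 by (simp add: tripling_def pairing_def generic_entry_def add.assoc)
  have "prime_ideal (ideal_gen (insert
      (indet (r, a) * (indet (s, b) * indet (t, c) + indet (s, c) * indet (t, b)) +
      (indet (r, b) * (indet (s, a) * indet (t, c) + indet (s, c) * indet (t, a)) +
       indet (r, c) * (indet (s, a) * indet (t, b) + indet (s, b) * indet (t, a))))
      (indet ` (- ({r, s, t} \<times> {a, b, c})))) :: ('m \<times> 'n, 'k) mpoly set)"
  proof (rule prime_ideal_permanent_three)
    show "distinct [(r, a), (r, b), (r, c), (s, a), (s, b), (s, c), (t, a), (t, b), (t, c)]"
      using d by simp
  qed blast
  then show T: "prime_ideal T" unfolding T_def perm by simp
  have "generic_entry i j \<in> T" if "(i, j) \<notin> {r, s, t} \<times> {a, b, c}" for i j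
    unfolding T_def
    by (rule generic_entry_in_ideal_gen[OF _ Un_upper2]) (use that in blast)
  moreover have "tripling (generic_entry r) (generic_entry s) (generic_entry t) a b c \<in> T"
    unfolding T_def permanent_generic_3 by (rule subsetD[OF ideal_gen_superset], simp)
  ultimately show "permanental_ideal 3 \<subseteq> T"
    by (rule permanental_ideal_3_le[OF prime_idealD(1)[OF T] tripling_ideal_three[OF prime_idealD(1)[OF T],
      where y = generic_entry]])
qed

section \<open>From zero patterns to types of minimal primes\<close>

context
  fixes P :: "('m::finite \<times> 'n::finite, 'k::field) mpoly set"
    and \<pi> :: "('m \<times> 'n, 'k) mpoly \<Rightarrow> 'f::field"
  assumes \<pi>: "comm_ring_hom \<pi>" and ker: "\<And>f. \<pi> f = 0 \<longleftrightarrow> f \<in> P"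
    and P: "minimal_prime_over (permanental_ideal 3) P"
begin

interpretation \<pi>: comm_ring_hom \<pi> by (rule \<pi>)

definition residue_entry :: "'m \<Rightarrow> 'n \<Rightarrow> 'f" where
  "residue_entry i j = \<pi> (indet (i, j))"

lemma residue_entry_0: "residue_entry i j = 0 \<longleftrightarrow> indet (i, j) \<in> P"
  by (simp add: residue_entry_def ker)

lemma minimal_is_ideal: "is_ideal P"
  using P prime_idealD(1) unfolding minimal_prime_over_def by blast

lemma residue_pairing:
  "\<pi> (pairing (generic_entry r) (generic_entry s) a b) = pairing (residue_entry r) (residue_entry s) a b"
  by (simp add: pairing_def generic_entry_def residue_entry_def \<pi>.hom_add \<pi>.hom_mult)

lemma residue_tripling:
  "\<pi> (tripling (generic_entry r) (generic_entry s) (generic_entry t) a b c) =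
     tripling (residue_entry r) (residue_entry s) (residue_entry t) a b c"
  by (simp add: tripling_def residue_pairing \<pi>.hom_add \<pi>.hom_mult)
    (simp add: generic_entry_def residue_entry_def)

lemma tripling_in_P:
  assumes "distinct [r, s, t]" "distinct [a, b, c]"
  shows "tripling (generic_entry r) (generic_entry s) (generic_entry t) a b c \<in> P"
proof -
  have "permanental_ideal 3 \<subseteq> P" using P unfolding minimal_prime_over_def by blast
  moreover have "tripling (generic_entry r) (generic_entry s) (generic_entry t) a b c
      \<in> (permanental_ideal 3 :: ('m \<times> 'n, 'k) mpoly set)"
    unfolding permanental_ideal_3 by (rule subsetD[OF ideal_gen_superset]) (use assms in blast)
  ultimately show ?thesis by blast
qed

lemma perm_null_residue: "perm_null residue_entry"
  unfolding perm_null_def tri_null_def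
  using tripling_in_P by (auto simp flip: residue_tripling simp: ker)

text \<open>The zero pattern puts a prime ideal containing the permanents inside \<open>P\<close>,
  and minimality makes the two equal. The lemmas for the other generated ideals argue in the same
  way.\<close>

lemma type_1_if_shape: "shape_1 residue_entry \<Longrightarrow> type_1 P"
proof -
  assume "shape_1 residue_entry"
  then obtain R C where RC: "card R + card C + 2 = CARD('m) + CARD('n)"
    and z: "\<forall>i\<in>R. \<forall>j\<in>C. residue_entry i j = 0" unfolding shape_1_def by blast
  have "ideal_gen (indet ` (R \<times> C)) \<subseteq> P"
    by (rule ideal_gen_minimal[OF minimal_is_ideal]) (use z residue_entry_0 in auto)
  then show ?thesis
    unfolding type_1_def using minimal_prime_overD[OF P prime_over_two_lines[OF RC]] RC by blast
qed

lemma type_2_if_shape: "shape_2 residue_entry \<Longrightarrow> type_2 P"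
proof -
  assume "shape_2 residue_entry"
  then obtain R C p p' q q' where RC: "card R + card C + 1 = CARD('m) + CARD('n)"
    and ne: "p \<noteq> p'" "q \<noteq> q'" and sub: "{p, p'} \<subseteq> R" "{q, q'} \<subseteq> C"
    and pr: "pairing (residue_entry p) (residue_entry p') q q' = 0"
    and z: "\<forall>(i, j) \<in> R \<times> C - {p, p'} \<times> {q, q'}. residue_entry i j = 0"
    unfolding shape_2_def by (elim exE conjE) (rule that)
  have "ideal_gen ({permanent (generic_sub [p, p'] [q, q'])} \<union> indet ` (R \<times> C - {p, p'} \<times> {q, q'})) \<subseteq> P"
    by (rule ideal_gen_minimal[OF minimal_is_ideal])
      (use z pr residue_entry_0 in \<open>auto simp: permanent_generic_2 simp flip: residue_pairing ker\<close>)
  then have "P = ideal_gen ({permanent (generic_sub [p, p'] [q, q'])} \<union> indet ` (R \<times> C - {p, p'} \<times> {q, q'}))"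
    by (rule minimal_prime_overD[OF P prime_over_line_block[OF RC ne]])
  then show ?thesis
    unfolding type_2_def using RC ne sub
    by (intro exI[of _ R] exI[of _ C] exI[of _ "[p, p']"] exI[of _ "[q, q']"]) (simp add: index_list_2)
qed

lemma type_2_2_if_shape: "shape_2_2 residue_entry \<Longrightarrow> type_2_2 P"
proof -
  assume "shape_2_2 residue_entry"
  then obtain p p' q q' u u' v v' where d: "distinct [p, p', u, u']" "distinct [q, q', v, v']"
    and pr: "pairing (residue_entry p) (residue_entry p') q q' = 0"
      "pairing (residue_entry u) (residue_entry u') v v' = 0"
    and z: "\<forall>i j. (i, j) \<notin> {p, p'} \<times> {q, q'} \<union> {u, u'} \<times> {v, v'} \<longrightarrow> residue_entry i j = 0"
    unfolding shape_2_2_def by (elim exE conjE) (rule that)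
  have z': "indet x \<in> P" if "x \<notin> {p, p'} \<times> {q, q'} \<union> {u, u'} \<times> {v, v'}" for x
    using z[rule_format, of "fst x" "snd x"] that residue_entry_0[of "fst x" "snd x"] by simp
  have pr': "permanent (generic_sub [p, p'] [q, q']) \<in> P" "permanent (generic_sub [u, u'] [v, v']) \<in> P"
    unfolding permanent_generic_2 ker[symmetric] residue_pairing by (rule pr)+
  have "ideal_gen ({permanent (generic_sub [p, p'] [q, q']), permanent (generic_sub [u, u'] [v, v'])} \<union>
      indet ` (- ({p, p'} \<times> {q, q'} \<union> {u, u'} \<times> {v, v'}))) \<subseteq> P"
    by (rule ideal_gen_minimal[OF minimal_is_ideal])
      (use z' pr' in blast)
  then have "P = ideal_gen ({permanent (generic_sub [p, p'] [q, q']), permanent (generic_sub [u, u'] [v, v'])} \<union>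
      indet ` (- ({p, p'} \<times> {q, q'} \<union> {u, u'} \<times> {v, v'})))"
    by (rule minimal_prime_overD[OF P prime_over_two_blocks[OF d]])
  then show ?thesis
    unfolding type_2_2_def using d
    by (intro exI[of _ "[p, p']"] exI[of _ "[q, q']"] exI[of _ "[u, u']"] exI[of _ "[v, v']"])
      (simp add: index_list_2)
qed

lemma type_3_if_zero_off:
  assumes d: "distinct [r, s, t]" "distinct [a, b, c]"
    and z: "zero_off {r, s, t} {a, b, c} residue_entry"
  shows "type_3 P"
proof -
  have z': "indet x \<in> P" if "x \<notin> {r, s, t} \<times> {a, b, c}" for x
    using z that residue_entry_0[of "fst x" "snd x"] unfolding zero_off_def by (metis mem_Times_iff prod.collapse)
  have pr': "permanent (generic_sub [r, s, t] [a, b, c]) \<in> P"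
    unfolding permanent_generic_3 by (rule tripling_in_P[OF d])
  have "ideal_gen ({permanent (generic_sub [r, s, t] [a, b, c])} \<union> indet ` (- ({r, s, t} \<times> {a, b, c}))) \<subseteq> P"
    by (rule ideal_gen_minimal[OF minimal_is_ideal])
      (use z' pr' in blast)
  then have "P = ideal_gen ({permanent (generic_sub [r, s, t] [a, b, c])} \<union> indet ` (- ({r, s, t} \<times> {a, b, c})))"
    by (rule minimal_prime_overD[OF P prime_over_three[OF d]])
  then show ?thesis
    unfolding type_3_def using d
    by (intro exI[of _ "[r, s, t]"] exI[of _ "[a, b, c]"]) (simp add: index_list_3)
qed

end

subsection \<open>Rank one matrices in characteristic three\<close>

lemma det_generic_2:
  assumes "r \<noteq> s" "a \<noteq> b"
  shows "det (generic_sub [r, s] [a, b]) =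
    generic_entry r a * generic_entry s b - generic_entry r b * (generic_entry s a :: ('m \<times> 'n, 'k::field) mpoly)"
proof -
  have "{0..<2} = {0, 1::nat}" by auto
  then show ?thesis
    unfolding generic_sub_def sub_indices_def generic_entry_def det_def
    by (simp add: sum_over_permutations_insert Transposition.transpose_def sign_swap_id numeral_2_eq_2)
qed

abbreviation generic_minor :: "'m \<Rightarrow> 'm \<Rightarrow> 'n \<Rightarrow> 'n \<Rightarrow> ('m \<times> 'n, 'k::field) mpoly" where
  "generic_minor r s a b \<equiv>
     generic_entry r a * generic_entry s b - generic_entry r b * generic_entry s a"

lemma determinantal_ideal_2:
  "(determinantal_ideal 2 :: ('m \<times> 'n, 'k::field) mpoly set) =
     ideal_gen {generic_minor r s a b |r s a b. r \<noteq> s \<and> a \<noteq> b}"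
proof -
  have "({det (generic_sub rs cs) |rs cs. index_list 2 rs \<and> index_list 2 cs} :: ('m \<times> 'n, 'k) mpoly set) =
      {generic_minor r s a b |r s a b. r \<noteq> s \<and> a \<noteq> b}" (is "?A = ?B")
  proof
    show "?A \<subseteq> ?B" unfolding index_list_2 using det_generic_2 by fastforce
    show "?B \<subseteq> ?A"
    proof
      fix x assume "x \<in> ?B"
      then obtain r s a b where x: "x = generic_minor r s a b" "r \<noteq> s" "a \<noteq> b" by blast
      then have "x = det (generic_sub [r, s] [a, b])" by (simp add: det_generic_2)
      then show "x \<in> ?A" unfolding index_list_2 using x(2,3) by blast
    qed
  qed
  then show ?thesis unfolding determinantal_ideal_def by simp
qed

section \<open>The ideal of 2 x 2 minors as the kernel of a monomial map\<close>

definition monomial_of :: "'v multiset \<Rightarrow> ('v, 'k::comm_ring_1) mpoly" where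
  "monomial_of M = prod_mset (image_mset indet M)"

definition exponent_of :: "'v multiset \<Rightarrow> 'v \<Rightarrow>\<^sub>0 nat" where
  "exponent_of M = sum_mset (image_mset (\<lambda>v. Poly_Mapping.single v 1) M)"

lemma lookup_exponent_of: "Poly_Mapping.lookup (exponent_of M) v = count M v"
  unfolding exponent_of_def by (induction M) (auto simp: lookup_add lookup_single when_def)

lemma exponent_of_eq_iff: "exponent_of M = exponent_of N \<longleftrightarrow> M = N"
  using lookup_exponent_of by (metis multiset_eqI)

lemma exponent_of_surj: "\<exists>M. exponent_of M = t"
proof (induction t rule: update_induct)
  case const
  show ?case by (rule exI[of _ "{#}"]) (simp add: exponent_of_def)
next
  case (update t v n)
  then obtain M where M: "exponent_of M = t" by blast
  have "exponent_of (replicate_mset n v + M) = Poly_Mapping.update v n t"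
    using update(1) unfolding M[symmetric]
    by (intro poly_mapping_eqI) (auto simp: lookup_exponent_of lookup_update in_keys_iff not_in_iff[symmetric] count_eq_zero_iff)
  then show ?case by blast
qed

lemma monomial_of_eq_single: "monomial_of M = Poly_Mapping.single (exponent_of M) 1"
  unfolding monomial_of_def exponent_of_def by (induction M) (simp_all add: indet_def mult_single)

lemma sum_monomials:
  fixes f :: "('v, 'k::comm_ring_1) mpoly"
  shows "\<exists>S c. finite S \<and> f = (\<Sum>M\<in>S. const (c M) * monomial_of M)"
proof -
  obtain M where M: "\<And>t. exponent_of (M t) = (t :: 'v \<Rightarrow>\<^sub>0 nat)" using exponent_of_surj by metis
  define c where "c N = Poly_Mapping.lookup f (exponent_of N)" for N
  have "f = (\<Sum>t\<in>Poly_Mapping.keys f. Poly_Mapping.single t (Poly_Mapping.lookup f t))"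
    by (rule poly_mapping_eqI) (simp add: lookup_sum lookup_single when_def in_keys_iff)
  also have "\<dots> = (\<Sum>t\<in>Poly_Mapping.keys f. const (c (M t)) * monomial_of (M t))"
    by (simp add: c_def M const_def monomial_of_eq_single mult_single)
  also have "\<dots> = (\<Sum>N\<in>M ` Poly_Mapping.keys f. const (c N) * monomial_of N)"
    by (subst sum.reindex) (auto intro: inj_on_inverseI M)
  finally show ?thesis by (intro exI[of _ "M ` Poly_Mapping.keys f"] exI[of _ c]) simp
qed

text \<open>Exchanging the column indices of two factors changes a monomial by a multiple of a
  \<open>2 \<times> 2\<close> minor, and such exchanges connect any two monomials with the same margins.\<close>

lemma monomial_margins_cong:
  fixes M N :: "('m \<times> 'n) multiset"
  assumes "image_mset fst M = image_mset fst N" "image_mset snd M = image_mset snd N"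
  shows "monomial_of M - monomial_of N \<in> (determinantal_ideal 2 :: ('m \<times> 'n, 'k::field) mpoly set)"
  using assms
proof (induction M arbitrary: N)
  case empty
  then show ?case using ideal_0[OF is_ideal_ideal_gen] by (simp add: determinantal_ideal_def)
next
  case (add x M)
  let ?D = "determinantal_ideal 2 :: ('m \<times> 'n, 'k) mpoly set"
  have D: "is_ideal ?D" unfolding determinantal_ideal_def by (rule is_ideal_ideal_gen)
  obtain i j where x: "x = (i, j)" by (cases x)
  have step: "monomial_of (add_mset x M) - monomial_of (add_mset x N') \<in> ?D"
    if "image_mset fst M = image_mset fst N'" "image_mset snd M = image_mset snd N'" for N'
  proof -
    have "monomial_of (add_mset x M) - monomial_of (add_mset x N') =
        indet x * (monomial_of M - monomial_of N' :: ('m \<times> 'n, 'k) mpoly)"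
      by (simp add: monomial_of_def right_diff_distrib)
    then show ?thesis using ideal_mult_left[OF D add.IH[OF that]] by simp
  qed
  show ?case
  proof (cases "x \<in># N")
    case True
    then obtain N' where N': "N = add_mset x N'" by (blast dest: multi_member_split)
    then show ?thesis using step add.prems by simp
  next
    case False
    \<comment> \<open>Equality of margins provides factors (i, j') and (i', j) in \<open>N\<close>;
      exchanging their column indices produces the missing factor \<open>x\<close> at the cost of
      one minor.\<close>
    have "i \<in># image_mset fst N" "j \<in># image_mset snd N"
      using add.prems x by (metis fst_conv snd_conv image_mset_add_mset union_single_eq_member)+
    then obtain i' j' where ij: "(i, j') \<in># N" "(i', j) \<in># N" by auto
    then have ne: "j' \<noteq> j" "i' \<noteq> i" using False x by auto
    obtain N1 where "N = add_mset (i, j') N1" using ij(1) by (blast dest: multi_member_split)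
    moreover from this obtain N0 where "N1 = add_mset (i', j) N0"
      using ij(2) ne by (auto dest: multi_member_split)
    ultimately have N: "N = add_mset (i, j') (add_mset (i', j) N0)" by simp
    define N' where "N' = add_mset (i', j') N0"
    have "monomial_of (add_mset x M) - monomial_of (add_mset x N') \<in> ?D"
    proof (rule step)
      show "image_mset fst M = image_mset fst N'" "image_mset snd M = image_mset snd N'"
        using add.prems unfolding N x N'_def by (simp_all add: add_mset_commute)
    qed
    moreover have "monomial_of (add_mset x N') - monomial_of N = generic_minor i i' j j' * monomial_of N0"
      unfolding N x N'_def by (simp add: monomial_of_def generic_entry_def algebra_simps)
    moreover have "generic_minor i i' j j' \<in> ?D"
      unfolding determinantal_ideal_2 by (rule subsetD[OF ideal_gen_superset]) (use ne in blast)
    ultimately have "(monomial_of (add_mset x M) - monomial_of (add_mset x N')) +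
        (monomial_of (add_mset x N') - monomial_of N) \<in> ?D"
      using ideal_add[OF D] ideal_mult_right[OF D] by metis
    then show ?thesis by simp
  qed
qed

text \<open>This is the kernel of the Segre substitution x_ij = s_i t_j into a domain, where even
  numbers index the s_i and odd numbers the t_j. Monomials with equal image have equal margins,
  hence are congruent modulo the minors.\<close>

lemma prime_ideal_determinantal_2:
  "prime_ideal (determinantal_ideal 2 :: ('m::finite \<times> 'n::finite, 'k::field) mpoly set)"
proof -
  let ?D = "determinantal_ideal 2 :: ('m \<times> 'n, 'k) mpoly set"
  have D: "is_ideal ?D" unfolding determinantal_ideal_def by (rule is_ideal_ideal_gen)
  obtain e :: "'m \<Rightarrow> nat" where e: "inj e"
    using finite_imp_inj_to_nat_seg[of "UNIV :: 'm set"] by auto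
  obtain f :: "'n \<Rightarrow> nat" where f: "inj f"
    using finite_imp_inj_to_nat_seg[of "UNIV :: 'n set"] by auto
  define \<phi> :: "('m \<times> 'n, 'k) mpoly \<Rightarrow> (nat, 'k) mpoly"
    where "\<phi> = peval const (\<lambda>(i, j). indet (2 * e i) * indet (2 * f j + 1))"
  have \<phi>: "comm_ring_hom \<phi>" unfolding \<phi>_def by (rule comm_ring_hom_peval[OF comm_ring_hom_const])
  interpret \<phi>: comm_ring_hom \<phi> by (rule \<phi>)
  interpret const: comm_ring_hom "const :: 'k \<Rightarrow> (nat, 'k) mpoly" by (rule comm_ring_hom_const)
  interpret const': comm_ring_hom "const :: 'k \<Rightarrow> ('m \<times> 'n, 'k) mpoly" by (rule comm_ring_hom_const)
  have phi_const: "\<phi> (const c) = const c" for c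
    by (simp add: \<phi>_def peval_const[OF comm_ring_hom_const])
  have phi_indet: "\<phi> (indet (i, j)) = indet (2 * e i) * indet (2 * f j + 1)" for i j
    by (simp add: \<phi>_def peval_indet[OF comm_ring_hom_const])
  define \<nu> where "\<nu> M = image_mset (\<lambda>x. 2 * e (fst x)) M + image_mset (\<lambda>x. 2 * f (snd x) + 1) M"
    for M :: "('m \<times> 'n) multiset"
  have phi_mono: "\<phi> (monomial_of M) = monomial_of (\<nu> M)" for M
    by (induction M) (auto simp: monomial_of_def \<nu>_def \<phi>.hom_mult phi_indet ac_simps)
  have margins: "image_mset fst M = image_mset fst N \<and> image_mset snd M = image_mset snd N"
    if "\<nu> M = \<nu> N" for M N
  proof -
    have ev: "filter_mset even (\<nu> M) = image_mset (\<lambda>i. 2 * e i) (image_mset fst M)" for M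
      unfolding \<nu>_def by (induction M) auto
    have od: "filter_mset odd (\<nu> M) = image_mset (\<lambda>j. 2 * f j + 1) (image_mset snd M)" for M
      unfolding \<nu>_def by (induction M) auto
    have "inj (\<lambda>i. 2 * e i)" "inj (\<lambda>j. 2 * f j + 1)" using e f by (auto simp: inj_def)
    then have inj: "inj (image_mset (\<lambda>i. 2 * e i))" "inj (image_mset (\<lambda>j. 2 * f j + 1))"
      by (simp_all only: multiset.inj_map)
    show ?thesis using ev[of M] ev[of N] od[of M] od[of N] that inj by (metis injD)
  qed
  have "{p. \<phi> p = 0} \<subseteq> ?D"
  proof clarify
    fix p assume p: "\<phi> p = 0"
    obtain S c where S: "finite S" "p = (\<Sum>M\<in>S. const (c M) * monomial_of M)"
      using sum_monomials by blast
    have "\<phi> p = (\<Sum>M\<in>S. const (c M) * monomial_of (\<nu> M))"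
      unfolding S(2) by (simp add: \<phi>.hom_sum \<phi>.hom_mult phi_const phi_mono)
    also have "\<dots> = (\<Sum>M\<in>S. Poly_Mapping.single (exponent_of (\<nu> M)) (c M))"
      by (simp add: monomial_of_eq_single const_def mult_single)
    finally have phi: "\<phi> p = (\<Sum>M\<in>S. Poly_Mapping.single (exponent_of (\<nu> M)) (c M))" .
    have coef: "(\<Sum>M\<in>{M\<in>S. \<nu> M = u}. c M) = 0" for u
    proof -
      have "0 = Poly_Mapping.lookup (\<phi> p) (exponent_of u)" using p by simp
      also have "\<dots> = (\<Sum>M\<in>S. if \<nu> M = u then c M else 0)"
        unfolding phi by (simp add: lookup_sum lookup_single when_def exponent_of_eq_iff)
      also have "\<dots> = (\<Sum>M\<in>{M\<in>S. \<nu> M = u}. c M)"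
        using S(1) by (simp add: sum.If_cases Int_def)
      finally show ?thesis by simp
    qed
    \<comment> \<open>One monomial for each fibre of \<open>\<nu>\<close>. Subtracting the
      representatives does not change \<open>p\<close>, since the coefficients in each fibre sum to
      zero.\<close>
    define rep where "rep u = (SOME M. \<nu> M = u)" for u
    have rep: "\<nu> (rep (\<nu> M)) = \<nu> M" for M unfolding rep_def by (rule someI) (rule refl)
    have "(\<Sum>M\<in>S. const (c M) * monomial_of (rep (\<nu> M))) =
        (\<Sum>u\<in>\<nu> ` S. \<Sum>M\<in>{M\<in>S. \<nu> M = u}. const (c M) * monomial_of (rep (\<nu> M)) :: ('m \<times> 'n, 'k) mpoly)"
      by (rule sum.image_gen[OF S(1)])
    also have "\<dots> = (\<Sum>u\<in>\<nu> ` S. const (\<Sum>M\<in>{M\<in>S. \<nu> M = u}. c M) * monomial_of (rep u))"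
      by (intro sum.cong refl) (simp add: const'.hom_sum sum_distrib_right)
    finally have zero: "(\<Sum>M\<in>S. const (c M) * monomial_of (rep (\<nu> M)) :: ('m \<times> 'n, 'k) mpoly) = 0"
      by (simp add: coef)
    have "p = (\<Sum>M\<in>S. const (c M) * (monomial_of M - monomial_of (rep (\<nu> M))))"
      using zero unfolding S(2) by (simp add: right_diff_distrib sum_subtractf)
    moreover have "\<dots> \<in> ?D"
      using margins rep by (intro ideal_sum[OF D] ideal_mult_left[OF D] monomial_margins_cong) metis+
    ultimately show "p \<in> ?D" by simp
  qed
  moreover have "?D \<subseteq> {p. \<phi> p = 0}"
    unfolding determinantal_ideal_2
    by (rule ideal_gen_minimal[OF prime_idealD(1)[OF prime_ideal_kernel[OF \<phi>]]])
      (auto simp: generic_entry_def \<phi>.hom_minus \<phi>.hom_mult phi_indet)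
  ultimately show ?thesis using prime_ideal_kernel[OF \<phi>] by simp
qed

text \<open>The all-ones matrix has rank one; it serves below as the test point for
  nonmembership.\<close>

lemma eval_ones_determinantal:
  assumes "g \<in> (determinantal_ideal 2 :: ('m \<times> 'n, 'k::field) mpoly set)"
  shows "peval (\<lambda>c. c) (\<lambda>_. 1) g = 0"
proof (rule ccontr)
  interpret ev: comm_ring_hom "peval (\<lambda>c. c) (\<lambda>_. 1) :: ('m \<times> 'n, 'k) mpoly \<Rightarrow> 'k"
    by (rule comm_ring_hom_peval[OF comm_ring_hom_id])
  assume "peval (\<lambda>c. c) (\<lambda>_. 1) g \<noteq> 0"
  then have "g \<notin> determinantal_ideal 2"
    unfolding determinantal_ideal_2
    by (rule not_in_ideal_gen_peval[rotated]) (auto simp: ev.hom_minus generic_entry_def eval_simps)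
  then show False using assms by simp
qed

lemma exists_other_two:
  assumes "CARD('a::finite) \<ge> 4"
  shows "\<exists>u v::'a. distinct [r, s, u, v] \<or> r = s"
proof (cases "r = s")
  case False
  have "card (- {r, s}) \<ge> 2" using assms False by (simp add: card_Compl_eq)
  then obtain T where "T \<subseteq> - {r, s}" "card T = 2" using obtain_subset_with_card_n by metis
  then obtain u v where "u \<noteq> v" "{u, v} \<subseteq> - {r, s}" by (auto simp: card_2_iff)
  then have "distinct [r, s, u, v]" using False by auto
  then show ?thesis by blast
qed auto

text \<open>
  Rows \<open>r\<close> and \<open>s\<close> lie in the kernel of the symmetric matrix formed by the \<open>2 \<times> 2\<close> permanents of two
  other rows \<open>u\<close>, \<open>v\<close> in four columns.  At the all-ones matrix it has rank three, so locally at the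
  determinantal ideal rows \<open>r\<close> and \<open>s\<close> are proportional.
\<close>

lemma determinantal_2_minimal:
  assumes m: "CARD('m::finite) \<ge> 4" and n: "CARD('n::finite) \<ge> 4" and char: "CHAR('k::field) = 3"
  shows "minimal_prime_over (permanental_ideal 3) (determinantal_ideal 2 :: ('m \<times> 'n, 'k) mpoly set)"
proof -
  let ?D = "determinantal_ideal 2 :: ('m \<times> 'n, 'k) mpoly set"
  let ?x = "generic_entry :: 'm \<Rightarrow> 'n \<Rightarrow> ('m \<times> 'n, 'k) mpoly"
  note D = prime_ideal_determinantal_2[where 'm = 'm and 'n = 'n and 'k = 'k]
  note D' = prime_idealD(1)[OF D]
  have "of_nat 3 = (0::'k)" using of_nat_CHAR[where 'a = 'k] char by simp
  then have three_k: "(3::'k) = 0" by simp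
  have two_k: "(2::'k) \<noteq> 0"
  proof
    assume "(2::'k) = 0"
    then have "(1::'k) = 0" using three_k by (metis add.right_neutral numeral_plus_one semiring_norm(5) add_0)
    then show False by simp
  qed
  have "(3 :: ('m \<times> 'n, 'k) mpoly) = const 3" by (simp add: const_def)
  then have three: "(3 :: ('m \<times> 'n, 'k) mpoly) = 0" using three_k by (simp add: const_def)
  have I: "permanental_ideal 3 \<subseteq> ?D"
  proof (rule permanental_ideal_3_le[OF D'])
    fix r s t :: 'm and a b c :: 'n
    define m where "m p q z = ?x r p * ?x s q * ?x t z" for p q z
    have mon: "m p q z = monomial_of {#(r, p), (s, q), (t, z)#}" for p q z
      by (simp add: m_def generic_entry_def monomial_of_def mult.assoc)
    have d: "m p q z - m a b c \<in> ?D" if "{#p, q, z#} = {#a, b, c#}" for p q z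
      unfolding mon by (rule monomial_margins_cong) (use that in auto)
    \<comment> \<open>The six terms of the permanent are all congruent to \<open>m a b c\<close>,
      and six copies of it vanish in characteristic three.\<close>
    have "tripling (?x r) (?x s) (?x t) a b c = 3 * (2 * m a b c) + ((m a c b - m a b c) +
       ((m b a c - m a b c) + ((m b c a - m a b c) + ((m c a b - m a b c) + (m c b a - m a b c)))))"
      by (simp add: tripling_def pairing_def m_def algebra_simps)
    also have "\<dots> \<in> ?D"
      unfolding three mult_zero_left add_0_left
      by (intro ideal_add[OF D'] d) (simp_all add: add_mset_commute)
    finally show "tripling (?x r) (?x s) (?x t) a b c \<in> ?D" .
  qed
  have "Q = ?D" if Q: "prime_ideal Q" "permanental_ideal 3 \<subseteq> Q" "Q \<subseteq> ?D" for Q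
  proof -
    note Q' = prime_idealD[OF Q(1)]
    have tri: "tripling (?x r) (?x s) (?x t) a b c \<in> Q" if "distinct [r, s, t]" "distinct [a, b, c]" for r s t a b c
      by (rule subsetD[OF Q(2)], unfold permanental_ideal_3, rule subsetD[OF ideal_gen_superset]) (use that in blast)
    have "generic_minor r s a b \<in> Q" if ne: "r \<noteq> s" "a \<noteq> b" for r s a b
    proof -
      obtain u v where uv: "distinct [r, s, u, v]" using exists_other_two[OF m, of r s] ne by blast
      obtain c d where cd: "distinct [a, b, c, d]" using exists_other_two[OF n, of a b] ne by blast
      define B where "B = pairing (?x u) (?x v)"
      have "tripling (?x z) (?x u) (?x v) a c d \<in> Q" "tripling (?x z) (?x u) (?x v) a b d \<in> Q"
        "tripling (?x z) (?x u) (?x v) a b c \<in> Q" if "z = r \<or> z = s" for z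
        by (rule tri; use uv cd that in auto)+
      then have E: "?x r a * tripling (?x s) (?x u) (?x v) p q z - ?x s a * tripling (?x r) (?x u) (?x v) p q z \<in> Q"
        if "(p, q, z) \<in> {(a, c, d), (a, b, d), (a, b, c)}" for p q z
        using that by (auto intro!: ideal_diff[OF Q'(1)] ideal_mult_left[OF Q'(1)])
      \<comment> \<open>Put X_p = x_ra x_sp - x_sa x_rp, so that X_a = 0. The bracketed expressions
        are X_b B_ad + X_d B_ab, X_b B_ac + X_c B_ab and X_c B_ad + X_d B_ac; the combination
        isolates X_b, which is the minor.\<close>
      have "2 * B a d * B a c * generic_minor r s a b =
        B a c * (?x r a * tripling (?x s) (?x u) (?x v) a b d - ?x s a * tripling (?x r) (?x u) (?x v) a b d) +
        B a d * (?x r a * tripling (?x s) (?x u) (?x v) a b c - ?x s a * tripling (?x r) (?x u) (?x v) a b c) -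
        B a b * (?x r a * tripling (?x s) (?x u) (?x v) a c d - ?x s a * tripling (?x r) (?x u) (?x v) a c d)"
        unfolding tripling_def B_def[symmetric] by (simp add: algebra_simps)
      also have "\<dots> \<in> Q"
        by (intro ideal_diff[OF Q'(1)] ideal_add[OF Q'(1)] ideal_mult_left[OF Q'(1)] E) auto
      finally have "2 * B a d * B a c * generic_minor r s a b \<in> Q" .
      \<comment> \<open>The value at the all-ones matrix is 8, which is nonzero in characteristic
        three, whereas all of \<open>Q\<close> vanishes there.\<close>
      moreover have "2 * B a d * B a c \<notin> Q"
      proof
        interpret ev: comm_ring_hom "peval (\<lambda>c. c) (\<lambda>_. 1) :: ('m \<times> 'n, 'k) mpoly \<Rightarrow> 'k"
          by (rule comm_ring_hom_peval[OF comm_ring_hom_id])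
        assume "2 * B a d * B a c \<in> Q"
        then have "peval (\<lambda>c. c) (\<lambda>_. 1) (2 * B a d * B a c) = (0::'k)"
          using Q(3) eval_ones_determinantal by blast
        moreover have "peval (\<lambda>c. c) (\<lambda>_. 1) (2 :: ('m \<times> 'n, 'k) mpoly) = (2::'k)"
          by (metis ev.hom_add ev.hom_one one_add_one)
        ultimately have "(2::'k) * 2 * 2 = 0"
          by (simp add: ev.hom_mult B_def pairing_def generic_entry_def eval_simps)
        then show False using two_k by (metis mult_eq_0_iff)
      qed
      ultimately show ?thesis using Q'(3) by blast
    qed
    then have "?D \<subseteq> Q"
      unfolding determinantal_ideal_2 by (intro ideal_gen_minimal[OF Q'(1)]) blast
    then show ?thesis using Q(3) by blast
  qed
  then show ?thesis unfolding minimal_prime_over_def using D I by blast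
qed

text \<open>Every ideal of a listed type contains an indeterminate, but \<open>D\<close> vanishes at
  the all-ones matrix and so contains none.\<close>

lemma determinantal_2_not_type:
  fixes D :: "('m::finite \<times> 'n::finite, 'k::field) mpoly set"
  assumes m: "CARD('m) \<ge> 4" and n: "CARD('n) \<ge> 4" and D: "D = determinantal_ideal 2"
  shows "\<not> (type_1 D \<or> type_2 D \<or> type_3 D \<or> type_3A D \<or> type_2_2 D)"
proof -
  have no: False if "indet v \<in> D" for v
    using eval_ones_determinantal[of "indet v :: ('m \<times> 'n, 'k) mpoly"] that D by (simp add: eval_simps)
  have gen: "W = {}" if "D = ideal_gen (A \<union> indet ` W)" for A W
  proof -
    have "indet ` W \<subseteq> D" using ideal_gen_superset[of "A \<union> indet ` W"] that by auto
    then show ?thesis using no by auto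
  qed
  have row: "\<exists>i. i \<notin> set rs" if "length rs < CARD('m)" for rs :: "'m list"
    using that card_length[of rs] by (metis UNIV_eq_I not_less)
  have col: "\<exists>j. j \<notin> set cs" if "length cs < CARD('n)" for cs :: "'n list"
    using that card_length[of cs] by (metis UNIV_eq_I not_less)
  have "\<not> type_1 D"
  proof
    assume "type_1 D"
    then obtain R C where RC: "card R + card C + 2 = CARD('m) + CARD('n)" "D = ideal_gen (indet ` (R \<times> C))"
      unfolding type_1_def by blast
    then have "R = {} \<or> C = {}" using gen[of "{}" "R \<times> C"] by auto
    then show False using RC(1) m n card_Compl_eq(2)[of R] card_Compl_eq(2)[of C] by auto
  qed
  moreover have "\<not> type_2 D"
  proof
    assume "type_2 D"
    then obtain R :: "'m set" and C :: "'n set" and rs cs where RC: "card R + card C + 1 = CARD('m) + CARD('n)"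
      and rs: "index_list 2 rs"
      and D2: "D = ideal_gen ({permanent (generic_sub rs cs)} \<union> indet ` (R \<times> C - set rs \<times> set cs))"
      unfolding type_2_def by (elim exE conjE) (rule that)
    have "card R > 2" "C \<noteq> {}"
      using RC(1) m n card_Compl_eq(2)[of R] card_Compl_eq(2)[of C] by auto
    moreover have "card R \<le> 2" if "R \<subseteq> set rs"
      using card_mono[OF _ that] card_length[of rs] rs unfolding index_list_def by simp
    ultimately show False using gen[OF D2] by fastforce
  qed
  moreover have "\<not> type_3 D"
  proof
    assume "type_3 D"
    then obtain rs cs where rs: "index_list 3 rs"
      and D3: "D = ideal_gen ({permanent (generic_sub rs cs)} \<union> indet ` (- (set rs \<times> set cs)))"
      unfolding type_3_def by blast
    obtain i where "i \<notin> set rs" using row[of rs] rs m unfolding index_list_def by auto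
    then show False using gen[OF D3] by blast
  qed
  moreover have "\<not> type_3A D"
  proof
    assume "type_3A D"
    then obtain rs :: "'m list" and cs :: "'n list" where
      rs: "index_list 3 rs \<or> index_list 3 cs" and sub: "indet ` (- (set rs \<times> set cs)) \<subseteq> D"
      unfolding type_3A_def by blast
    have "\<exists>x. x \<notin> set rs \<times> set cs" using rs row[of rs] col[of cs] m n unfolding index_list_def by auto
    then show False using no sub by blast
  qed
  moreover have "\<not> type_2_2 D"
  proof
    assume "type_2_2 D"
    then obtain rs cs rs' cs' where l: "index_list 2 rs" "index_list 2 cs'" "index_list 2 rs'"
      and dis: "set rs \<inter> set rs' = {}" "set cs \<inter> set cs' = {}"
      and D2: "D = ideal_gen ({permanent (generic_sub rs cs), permanent (generic_sub rs' cs')} \<union>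
                       indet ` (- (set rs \<times> set cs \<union> set rs' \<times> set cs')))"
      unfolding type_2_2_def by (elim exE conjE) (rule that)
    have "set rs \<noteq> {}" "set cs' \<noteq> {}" using l by (auto simp: index_list_2)
    then obtain r c where "r \<in> set rs" "c \<in> set cs'" by (meson all_not_in_conv)
    then have "(r, c) \<notin> set rs \<times> set cs \<union> set rs' \<times> set cs'" using dis by auto
    then show False using gen[OF D2] by blast
  qed
  ultimately show ?thesis by blast
qed

subsection \<open>The ideal \<open>J\<^sub>3\<close>\<close>

lemma pderivative_add: "pderivative v (f + g) = pderivative v f + pderivative v g"
  unfolding pderivative_def
  by (rule setsum_keys_plus_distrib) (simp_all add: distrib_left single_add)

lemma pderivative_single:
  "pderivative v (Poly_Mapping.single t c) =
     Poly_Mapping.single (t - Poly_Mapping.single v 1) (of_nat (Poly_Mapping.lookup t v) * c)"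
  by (simp add: pderivative_def)

lemma pderivative_0: "pderivative v 0 = 0"
  by (simp add: pderivative_def)

lemma pderivative_indet: "pderivative v (indet w) = (if v = w then 1 else 0)"
  by (simp add: indet_def pderivative_single lookup_single)

lemma add_minus_single:
  fixes s t :: "'v \<Rightarrow>\<^sub>0 nat"
  assumes "Poly_Mapping.lookup t v \<noteq> 0"
  shows "s + (t - Poly_Mapping.single v 1) = s + t - Poly_Mapping.single v 1"
  by (rule poly_mapping_eqI) (use assms in \<open>auto simp: lookup_add lookup_minus lookup_single when_def\<close>)

text \<open>Truncated subtraction of exponents is harmful only where \<open>v\<close> does not
  occur, and there the coefficient is zero; elsewhere \<open>add_minus_single\<close>
  applies.\<close>

lemma pderivative_mult_single:
  "pderivative v (Poly_Mapping.single s a * Poly_Mapping.single t b) =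
     Poly_Mapping.single s a * pderivative v (Poly_Mapping.single t b) +
     pderivative v (Poly_Mapping.single s a) * Poly_Mapping.single t b"
proof -
  let ?e = "Poly_Mapping.single v (1::nat)"
  have 1: "Poly_Mapping.single s a * pderivative v (Poly_Mapping.single t b) =
      Poly_Mapping.single (s + t - ?e) (of_nat (Poly_Mapping.lookup t v) * (a * b))"
    using add_minus_single[of t v s]
    by (cases "Poly_Mapping.lookup t v = 0") (simp_all add: pderivative_single mult_single ac_simps)
  have 2: "pderivative v (Poly_Mapping.single s a) * Poly_Mapping.single t b =
      Poly_Mapping.single (s + t - ?e) (of_nat (Poly_Mapping.lookup s v) * (a * b))"
    using add_minus_single[of s v t]
    by (cases "Poly_Mapping.lookup s v = 0") (simp_all add: pderivative_single mult_single ac_simps)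
  show ?thesis
    unfolding 1 2 by (simp add: mult_single pderivative_single lookup_add distrib_right single_add add.commute)
qed

lemma pderivative_mult: "pderivative v (f * g) = f * pderivative v g + pderivative v f * g"
proof (induction f rule: update_induct)
  case const
  then show ?case by (simp add: pderivative_0)
next
  case (update f s a)
  have "pderivative v (Poly_Mapping.single s a * g) =
      Poly_Mapping.single s a * pderivative v g + pderivative v (Poly_Mapping.single s a) * g"
  proof (induction g rule: update_induct)
    case const
    then show ?case by (simp add: pderivative_0)
  next
    case (update g t b)
    then show ?case
      by (simp add: update_eq_add distrib_left pderivative_add pderivative_mult_single algebra_simps)
  qed
  then show ?case using update
    by (simp add: update_eq_add distrib_right pderivative_add algebra_simps)
qed

section \<open>Expansions of the permanents of a 3 x 4 matrix\<close>

definition skip :: "nat \<Rightarrow> nat \<Rightarrow> nat" where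
  "skip q j = (if j < q then j else Suc j)"

lemma pick_skip: "pick (- {q}) j = skip q j"
proof (induction j)
  case 0
  then show ?case by (auto simp: skip_def intro!: Least_equality)
next
  case (Suc j)
  then show ?case by (auto simp: skip_def intro!: Least_equality)
qed

lemma card_skip: "q < Suc n \<Longrightarrow> card {j. j < Suc n \<and> j \<noteq> q} = n"
proof -
  assume "q < Suc n"
  moreover have "{j. j < Suc n \<and> j \<noteq> q} = {..<Suc n} - {q}" by auto
  ultimately show ?thesis by simp
qed

lemma submatrix_skip:
  assumes "A \<in> carrier_mat n (Suc k)" "q < Suc k"
  shows "submatrix A UNIV (- {q}) = mat n k (\<lambda>(i, j). A $$ (i, skip q j))"
  using assms card_skip[OF assms(2)] by (simp add: submatrix_def pick_skip pick_UNIV)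

text \<open>A permanent is linear in each row, so differentiating it by the entry in row
  \<open>r\<close> and column \<open>p\<close> amounts to replacing row \<open>r\<close> by this
  unit vector.\<close>

definition unit_at :: "nat \<Rightarrow> nat \<Rightarrow> 'a::comm_ring_1" where
  "unit_at p j = (if j = p then 1 else 0)"

abbreviation row_choices :: "(nat \<times> nat \<times> nat) set" where
  "row_choices \<equiv> {(0, 1, 2), (1, 0, 2), (2, 0, 1)}"

lemma less_4_cases: "q < 4 \<Longrightarrow> (q = 0 \<Longrightarrow> P) \<Longrightarrow> (q = 1 \<Longrightarrow> P) \<Longrightarrow> (q = 2 \<Longrightarrow> P) \<Longrightarrow> (q = (3::nat) \<Longrightarrow> P) \<Longrightarrow> P"
  by linarith

text \<open>Both sides are the 2 x 2 permanent of \<open>v\<close> and \<open>w\<close> in the two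
  columns other than \<open>p\<close> and \<open>q\<close>, or zero if \<open>p = q\<close>.\<close>

lemma tripling_unit_symmetric:
  assumes "p < 4" "q < 4"
  shows "tripling (unit_at p) v w (skip q 0) (skip q 1) (skip q 2) =
    tripling (unit_at q) v w (skip p 0) (skip p 1) (skip p 2)"
  using assms by (elim less_4_cases; simp add: skip_def unit_at_def tripling_def pairing_def flip: numeral_2_eq_2)

text \<open>Expansion along the first row; the summand with \<open>p = q\<close> is zero because
  \<open>skip q\<close> avoids \<open>q\<close>.\<close>

lemma tripling_unit_row:
  assumes "q < 4"
  shows "(\<Sum>p<4. u p * tripling (unit_at p) v w (skip q 0) (skip q 1) (skip q 2)) =
    tripling u v w (skip q 0) (skip q 1) (skip q 2)"
proof -
  have "{..<4} = {0, 1, 2, 3::nat}" by auto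
  then show ?thesis
    using assms by (elim less_4_cases; simp add: skip_def unit_at_def tripling_def pairing_def flip: numeral_2_eq_2)
qed

text \<open>Expansion along column \<open>p\<close>, which is among the remaining columns because
  \<open>p\<close> differs from \<open>q\<close>.\<close>

lemma tripling_unit_col:
  assumes "p < 4" "q < 4" "p \<noteq> q"
  shows "u p * tripling (unit_at p) v w (skip q 0) (skip q 1) (skip q 2) +
    v p * tripling (unit_at p) u w (skip q 0) (skip q 1) (skip q 2) +
    w p * tripling (unit_at p) u v (skip q 0) (skip q 1) (skip q 2) =
    tripling u v w (skip q 0) (skip q 1) (skip q 2)"
  using assms
  by (elim less_4_cases; simp add: skip_def unit_at_def tripling_def pairing_def algebra_simps flip: numeral_2_eq_2)

lemma det_zero_if_kernel:
  fixes A :: "'a::field mat"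
  assumes A: "A \<in> carrier_mat n n" and u: "\<exists>j<n. u j \<noteq> 0"
    and ker: "\<And>i. i < n \<Longrightarrow> (\<Sum>j<n. A $$ (i, j) * u j) = 0"
  shows "det A = 0"
proof -
  have "vec n u \<noteq> 0\<^sub>v n" using u by (metis index_vec index_zero_vec(1))
  moreover have "A *\<^sub>v vec n u = 0\<^sub>v n"
    using A ker by (intro eq_vecI) (auto simp: scalar_prod_def atLeast0LessThan)
  moreover have "vec n u \<in> carrier_vec n" by simp
  ultimately show ?thesis using det_0_iff_vec_prod_zero_field[OF A] by blast
qed

context
  fixes Y :: "'v mat"
  assumes Y: "Y \<in> carrier_mat 3 4"
    and inj: "\<And>r p r' p'. r < 3 \<Longrightarrow> p < 4 \<Longrightarrow> r' < 3 \<Longrightarrow> p' < 4 \<Longrightarrow>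
      Y $$ (r, p) = Y $$ (r', p') \<longleftrightarrow> r = r' \<and> p = p'"
begin

abbreviation (input) Y_row :: "nat \<Rightarrow> nat \<Rightarrow> ('v, 'k::field) mpoly" where
  "Y_row r p \<equiv> indet (Y $$ (r, p))"

lemma J3_P_tripling:
  assumes "q < 4"
  shows "J3_P Y q = tripling (Y_row 0) (Y_row 1) (Y_row 2) (skip q 0) (skip q 1) (skip q 2)"
proof -
  have sk: "skip q 0 < 4" "skip q 1 < 4" "skip q 2 < 4" using assms by (auto simp: skip_def)
  have "map_mat indet Y \<in> carrier_mat 3 (Suc 3)" using Y by simp
  then have "J3_P Y q = permanent (mat 3 3 (\<lambda>(i, j). map_mat indet Y $$ (i, skip q j)))"
    unfolding J3_P_def using assms by (subst submatrix_skip[of _ 3 3]) auto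
  also have "\<dots> = tripling (Y_row 0) (Y_row 1) (Y_row 2) (skip q 0) (skip q 1) (skip q 2)"
    using Y sk by (subst permanent_3) (simp_all add: tripling_def pairing_def)
  finally show ?thesis .
qed

lemma pderivative_tripling_unit:
  assumes "r < 3" "p < 4" "distinct [r, s, t]" "s < 3" "t < 3" "a < 4" "b < 4" "c < 4"
  shows "pderivative (Y $$ (r, p)) (tripling (Y_row r) (Y_row s) (Y_row t) a b c :: ('v, 'k::field) mpoly) =
    tripling (unit_at p) (Y_row s) (Y_row t) a b c"
proof -
  have other: "pderivative (Y $$ (r, p)) (Y_row s j) = (0 :: ('v, 'k) mpoly)"
    if "s < 3" "j < 4" "s \<noteq> r" for s j
    using that assms by (simp add: pderivative_indet inj)
  have same: "pderivative (Y $$ (r, p)) (Y_row r j) = (unit_at p j :: ('v, 'k) mpoly)" if "j < 4" for j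
    using that assms by (auto simp: pderivative_indet inj unit_at_def)
  show ?thesis
    using assms by (simp add: tripling_def pairing_def pderivative_add pderivative_mult other same)
qed

lemma J3_B_tripling:
  assumes "r < 3" "p < 4" "q < 4" and st: "(r, s, t) \<in> row_choices"
  shows "(J3_B Y r p q :: ('v, 'k::field) mpoly) = tripling (unit_at p) (Y_row s) (Y_row t) (skip q 0) (skip q 1) (skip q 2)"
proof -
  have sk: "skip q 0 < 4" "skip q 1 < 4" "skip q 2 < 4" using assms by (auto simp: skip_def)
  have "(J3_P Y q :: ('v, 'k) mpoly) = tripling (Y_row r) (Y_row s) (Y_row t) (skip q 0) (skip q 1) (skip q 2)"
    unfolding J3_P_tripling[OF assms(3)] using st
    by (auto simp: tripling_def pairing_def algebra_simps)
  moreover have "pderivative (Y $$ (r, p))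
        (tripling (Y_row r) (Y_row s) (Y_row t) (skip q 0) (skip q 1) (skip q 2) :: ('v, 'k) mpoly) =
      tripling (unit_at p) (Y_row s) (Y_row t) (skip q 0) (skip q 1) (skip q 2)"
    by (rule pderivative_tripling_unit) (use assms sk in auto)
  ultimately show ?thesis unfolding J3_B_def by simp
qed

lemma J3_row_choice: "r < 3 \<Longrightarrow> \<exists>s t. (r, s, t) \<in> row_choices"
  by (auto simp: less_Suc_eq numeral_3_eq_3)

lemma J3_B_symmetric:
  assumes "r < 3" "p < 4" "q < 4"
  shows "(J3_B Y r p q :: ('v, 'k::field) mpoly) = J3_B Y r q p"
proof -
  obtain s t where st: "(r, s, t) \<in> row_choices"
    using J3_row_choice assms(1) by blast
  show ?thesis
    unfolding J3_B_tripling[OF assms st] J3_B_tripling[OF assms(1,3,2) st]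
    by (rule tripling_unit_symmetric[OF assms(2,3)])
qed

lemma J3_B_row:
  assumes "r < 3" "q < 4"
  shows "(\<Sum>p<4. Y_row r p * J3_B Y r p q) = (J3_P Y q :: ('v, 'k::field) mpoly)"
proof -
  obtain s t where st: "(r, s, t) \<in> row_choices"
    using J3_row_choice assms(1) by blast
  have "(\<Sum>p<4. Y_row r p * J3_B Y r p q) =
      (\<Sum>p<4. Y_row r p * tripling (unit_at p) (Y_row s) (Y_row t) (skip q 0) (skip q 1) (skip q 2))"
    by (rule sum.cong) (simp_all add: J3_B_tripling[OF assms(1) _ assms(2) st])
  also have "\<dots> = tripling (Y_row r) (Y_row s) (Y_row t) (skip q 0) (skip q 1) (skip q 2)"
    by (rule tripling_unit_row[OF assms(2)])
  also have "\<dots> = (J3_P Y q :: ('v, 'k) mpoly)"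
    unfolding J3_P_tripling[OF assms(2)] using st
    by (auto simp: tripling_def pairing_def algebra_simps)
  finally show ?thesis .
qed

lemma J3_B_col:
  assumes "p < 4" "q < 4" "p \<noteq> q"
  shows "(\<Sum>r<3. Y_row r p * J3_B Y r p q) = (J3_P Y q :: ('v, 'k::field) mpoly)"
proof -
  have "{..<3} = {0, 1, 2::nat}" by auto
  then show ?thesis
    using tripling_unit_col[OF assms, of "Y_row 0" "Y_row 1" "Y_row 2"] assms(1,2)
    by (simp add: J3_B_tripling[of 0 p q 1 2] J3_B_tripling[of 1 p q 0 2] J3_B_tripling[of 2 p q 0 1]
      J3_P_tripling add.assoc del: One_nat_def)
qed

text \<open>Once all P_q vanish, \<open>J3_B_row\<close> makes row \<open>r\<close> a kernel vector
  of the matrix of g_r, and \<open>J3_B_col\<close> makes column \<open>p\<close> a left kernel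
  vector of the matrix of f_p. The last two hypotheses say that these vectors are nonzero.\<close>

lemma J3_le_kernel:
  fixes \<pi> :: "('v, 'k::field) mpoly \<Rightarrow> 'f::field"
  assumes \<pi>: "comm_ring_hom \<pi>" and P: "\<And>q. q < 4 \<Longrightarrow> \<pi> (J3_P Y q) = 0"
    and row: "\<And>r. r < 3 \<Longrightarrow> \<exists>p<4. \<pi> (Y_row r p) \<noteq> 0" and col: "\<And>p. p < 4 \<Longrightarrow> \<exists>r<3. \<pi> (Y_row r p) \<noteq> 0"
  shows "J3 Y \<subseteq> {f. \<pi> f = 0}"
proof -
  interpret \<pi>: comm_ring_hom \<pi> by (rule \<pi>)
  have f: "\<pi> (J3_f Y p) = 0" if p: "p < 4" for p
  proof -
    define A where "A = mat 3 3 (\<lambda>(r, j). \<pi> (J3_B Y r (skip p j) p))"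
    have "J3_f Y p = det (mat 3 3 (\<lambda>(r, j). J3_B Y r (skip p j) p :: ('v, 'k) mpoly))"
    proof -
      have "submatrix (mat 3 4 (\<lambda>(r, q). J3_B Y r q p)) UNIV (- {p}) =
        mat 3 3 (\<lambda>(r, j). mat 3 4 (\<lambda>(r, q). J3_B Y r q p :: ('v, 'k) mpoly) $$ (r, skip p j))"
        using p by (subst submatrix_skip[of _ 3 3]) auto
      also have "\<dots> = mat 3 3 (\<lambda>(r, j). J3_B Y r (skip p j) p)"
        by (rule eq_matI) (auto simp: skip_def)
      finally show ?thesis unfolding J3_f_def by simp
    qed
    then have "\<pi> (J3_f Y p) = det (map_mat \<pi> (mat 3 3 (\<lambda>(r, j). J3_B Y r (skip p j) p)))"
      by (simp add: \<pi>.hom_det)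
    also have "map_mat \<pi> (mat 3 3 (\<lambda>(r, j). J3_B Y r (skip p j) p)) = A"
      unfolding A_def by (rule eq_matI) auto
    \<comment> \<open>Column \<open>p\<close> is a kernel vector on the left, hence the transpose.
      The symmetry of B enters too: f_p fixes the last index of B, the expansion along column
      \<open>p\<close> the middle one.\<close>
    also have "det A = det (transpose_mat A)"
      by (rule det_transpose[symmetric, of _ 3]) (simp add: A_def)
    also have "\<dots> = 0"
    proof (rule det_zero_if_kernel)
      show "transpose_mat A \<in> carrier_mat 3 3" by (simp add: A_def)
      show "\<exists>r<3. \<pi> (Y_row r p) \<noteq> 0" by (rule col[OF p])
      fix j :: nat assume j: "j < 3"
      then have q: "skip p j < 4" "p \<noteq> skip p j" by (auto simp: skip_def)
      have "(\<Sum>r<3. transpose_mat A $$ (j, r) * \<pi> (Y_row r p)) = \<pi> (\<Sum>r<3. Y_row r p * J3_B Y r p (skip p j))"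
        unfolding \<pi>.hom_sum using j
        by (intro sum.cong) (simp_all add: A_def \<pi>.hom_mult J3_B_symmetric[OF _ p q(1)] mult.commute)
      then show "(\<Sum>r<3. transpose_mat A $$ (j, r) * \<pi> (Y_row r p)) = 0"
        unfolding J3_B_col[OF p q] using P[OF q(1)] by simp
    qed
    finally show ?thesis .
  qed
  have g: "\<pi> (J3_g Y r) = 0" if r: "r < 3" for r
  proof -
    define A where "A = mat 4 4 (\<lambda>(p, q). \<pi> (J3_B Y r p q))"
    have "\<pi> (J3_g Y r) = det (map_mat \<pi> (mat 4 4 (\<lambda>(p, q). J3_B Y r p q)))"
      by (simp add: J3_g_def \<pi>.hom_det)
    also have "map_mat \<pi> (mat 4 4 (\<lambda>(p, q). J3_B Y r p q)) = A"
      unfolding A_def by (rule eq_matI) auto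
    also have "det A = 0"
    proof (rule det_zero_if_kernel)
      show "A \<in> carrier_mat 4 4" by (simp add: A_def)
      show "\<exists>p<4. \<pi> (Y_row r p) \<noteq> 0" by (rule row[OF r])
      fix q :: nat assume q: "q < 4"
      have "(\<Sum>p<4. A $$ (q, p) * \<pi> (Y_row r p)) = \<pi> (\<Sum>p<4. Y_row r p * J3_B Y r p q)"
        unfolding \<pi>.hom_sum using q
        by (intro sum.cong) (simp_all add: A_def \<pi>.hom_mult J3_B_symmetric[OF r _ q] mult.commute)
      then show "(\<Sum>p<4. A $$ (q, p) * \<pi> (Y_row r p)) = 0"
        unfolding J3_B_row[OF r q] using P[OF q] by simp
    qed
    finally show ?thesis .
  qed
  show ?thesis
    unfolding J3_def
    by (rule ideal_gen_minimal[OF prime_idealD(1)[OF prime_ideal_kernel[OF \<pi>]]]) (use P f g in auto)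
qed

end

subsection \<open>Residue fields of minimal primes\<close>

text \<open>Smaller supports are padded to blocks of the exact size \<open>k\<close> by
  \<open>l\<close>, as the definitions of the types demand.\<close>

lemma zero_off_superset:
  fixes y :: "'m::finite \<Rightarrow> 'n::finite \<Rightarrow> 'a::zero"
  assumes "zero_off R C y" "card R \<le> k" "k \<le> CARD('m)" "card C \<le> l" "l \<le> CARD('n)"
  obtains rs cs where "distinct rs" "length rs = k" "distinct cs" "length cs = l" "zero_off (set rs) (set cs) y"
proof -
  have ex: "\<exists>xs. distinct xs \<and> length xs = k \<and> A \<subseteq> set xs" if k: "card A \<le> k" "k \<le> CARD('x)"
    for A :: "'x::finite set" and k
  proof -
    obtain B where "A \<subseteq> B" "card B = k"
      using exists_subset_between[OF k subset_UNIV finite] by blast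
    moreover obtain xs where "set xs = B" "distinct xs" using finite_distinct_list[of B] by auto
    ultimately show ?thesis using distinct_card by metis
  qed
  obtain rs cs where "distinct rs" "length rs = k" "distinct cs" "length cs = l" "R \<subseteq> set rs" "C \<subseteq> set cs"
    using ex[OF assms(2,3)] ex[OF assms(4,5)] by blast
  then show thesis using that assms(1) unfolding zero_off_def by blast
qed

lemma ex_index_of_member:
  assumes "length xs = k" "x \<in> set xs"
  shows "\<exists>i<k. xs ! i = x"
  using assms by (metis in_set_conv_nth)

context
  fixes P :: "('m::finite \<times> 'n::finite, 'k::field) mpoly set"
    and \<pi> :: "('m \<times> 'n, 'k) mpoly \<Rightarrow> 'f::field"
  assumes two: "(2::'f) \<noteq> 0" and m: "CARD('m) \<ge> 4" and n: "CARD('n) \<ge> 4"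
    and \<pi>: "comm_ring_hom \<pi>" and ker: "\<And>f. \<pi> f = 0 \<longleftrightarrow> f \<in> P"
    and P: "minimal_prime_over (permanental_ideal 3) P"
begin

lemma type_1_if_rows:
  assumes "\<And>i j. i \<noteq> r \<Longrightarrow> i \<noteq> s \<Longrightarrow> residue_entry \<pi> i j = 0"
  shows "type_1 P"
proof -
  have "shape_1 (residue_entry \<pi>)" by (rule shape_1_rows[OF two m n]) (rule assms)
  then show ?thesis by (rule type_1_if_shape[OF \<pi> ker P])
qed

lemma type_1_if_cols:
  assumes "\<And>i j. j \<noteq> a \<Longrightarrow> j \<noteq> b \<Longrightarrow> residue_entry \<pi> i j = 0"
  shows "type_1 P"
proof -
  have "shape_1 (\<lambda>j i. residue_entry \<pi> i j)" by (rule shape_1_rows[OF two n m]) (rule assms)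
  then show ?thesis using type_1_if_shape[OF \<pi> ker P] shape_1_transpose by blast
qed

lemma type_3_if_lists:
  assumes "distinct rs" "length rs = 3" "distinct cs" "length cs = 3"
    "zero_off (set rs) (set cs) (residue_entry \<pi>)"
  shows "type_3 P"
proof -
  have "index_list 3 rs" "index_list 3 cs" using assms by (auto simp: index_list_def)
  then obtain r s t a b c where "rs = [r, s, t]" "distinct [r, s, t]" "cs = [a, b, c]" "distinct [a, b, c]"
    unfolding index_list_3 by blast
  then show ?thesis using type_3_if_zero_off[OF \<pi> ker P, of r s t a b c] assms(5) by simp
qed

lemma set_of_three_subset:
  assumes "length xs = 3" "x \<in> set xs"
  shows "\<exists>u v. set xs \<subseteq> {x, u, v}"
proof -
  obtain a b c where "xs = [a, b, c]" using assms(1) by (auto simp: numeral_3_eq_3 length_Suc_conv)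
  then show ?thesis using assms(2) by auto
qed

lemma J3_le_or_zero_line:
  fixes Y :: "('m \<times> 'n) mat"
  assumes Y: "Y \<in> carrier_mat 3 4"
    and inj: "\<And>r p r' p'. r < 3 \<Longrightarrow> p < 4 \<Longrightarrow> r' < 3 \<Longrightarrow> p' < 4 \<Longrightarrow>
      Y $$ (r, p) = Y $$ (r', p') \<longleftrightarrow> r = r' \<and> p = p'"
    and J: "\<And>q. q < 4 \<Longrightarrow> J3_P Y q \<in> P"
  obtains (le) "J3 Y \<subseteq> P"
    | (row) r where "r < 3" "\<And>p. p < 4 \<Longrightarrow> case_prod (residue_entry \<pi>) (Y $$ (r, p)) = 0"
    | (col) p where "p < 4" "\<And>r. r < 3 \<Longrightarrow> case_prod (residue_entry \<pi>) (Y $$ (r, p)) = 0"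
proof -
  have "\<pi> (indet (Y $$ (r, p))) = case_prod (residue_entry \<pi>) (Y $$ (r, p))" for r p
    by (simp add: residue_entry_def[OF \<pi> ker P] split: prod.split)
  moreover have "J3 Y \<subseteq> P" if "\<And>r. r < 3 \<Longrightarrow> \<exists>p<4. \<pi> (indet (Y $$ (r, p))) \<noteq> 0"
    "\<And>p. p < 4 \<Longrightarrow> \<exists>r<3. \<pi> (indet (Y $$ (r, p))) \<noteq> 0"
    using J3_le_kernel[OF Y inj \<pi> _ that] J ker by auto
  ultimately show thesis using le row col by metis
qed

text \<open>A zero row leaves two rows and thus type (1), a zero column leaves a 3 x 3 block and
  thus type (3); without zero lines \<open>J3_le_or_zero_line\<close> gives type (3A).\<close>

lemma type_if_three_rows:
  assumes rs: "distinct rs" "length rs = 3" and cs: "distinct cs" "length cs = 4"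
    and off: "zero_off (set rs) (set cs) (residue_entry \<pi>)"
  shows "type_1 P \<or> type_3 P \<or> type_3A P"
proof -
  define Y where "Y = sub_indices rs cs"
  have Y: "Y \<in> carrier_mat 3 4" using rs cs by (simp add: Y_def sub_indices_def)
  have Yx: "Y $$ (r, p) = (rs ! r, cs ! p)" if "r < 3" "p < 4" for r p
    using that rs cs by (simp add: Y_def sub_indices_def)
  have inj: "Y $$ (r, p) = Y $$ (r', p') \<longleftrightarrow> r = r' \<and> p = p'" if "r < 3" "p < 4" "r' < 3" "p' < 4" for r p r' p'
    using that rs cs by (simp add: Yx nth_eq_iff_index_eq)
  have J: "J3_P Y q \<in> P" if q: "q < 4" for q
  proof -
    have sk: "skip q 0 < 4" "skip q 1 < 4" "skip q 2 < 4" using q by (auto simp: skip_def)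
    have "(J3_P Y q :: ('m \<times> 'n, 'k) mpoly) = tripling (generic_entry (rs ! 0)) (generic_entry (rs ! 1)) (generic_entry (rs ! 2))
        (cs ! skip q 0) (cs ! skip q 1) (cs ! skip q 2)"
      using sk by (simp add: J3_P_tripling[OF Y inj q] tripling_def pairing_def generic_entry_def Yx)
    moreover have "\<dots> \<in> P"
      by (rule tripling_in_P[OF \<pi> ker P]) (use rs cs sk in \<open>auto simp: nth_eq_iff_index_eq skip_def\<close>)
    ultimately show ?thesis by simp
  qed
  show ?thesis
  proof (rule J3_le_or_zero_line[OF Y])
    show "Y $$ (r, p) = Y $$ (r', p') \<longleftrightarrow> r = r' \<and> p = p'" if "r < 3" "p < 4" "r' < 3" "p' < 4" for r p r' p'
      using that by (rule inj)
    show "J3_P Y q \<in> P" if "q < 4" for q using that by (rule J)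
  next
    assume "J3 Y \<subseteq> P"
    moreover have "indet ` (- (set rs \<times> set cs)) \<subseteq> P"
      using off residue_entry_0[OF \<pi> ker P] unfolding zero_off_def by auto
    moreover have "prime_ideal P" using P unfolding minimal_prime_over_def by blast
    ultimately have "type_3A P"
      unfolding type_3A_def index_list_def Y_def using rs cs
      by (intro conjI exI[of _ rs] exI[of _ cs]) simp_all
    then show ?thesis by simp
  next
    fix r assume row: "r < 3" "\<And>p. p < 4 \<Longrightarrow> case_prod (residue_entry \<pi>) (Y $$ (r, p)) = 0"
    then have row0: "residue_entry \<pi> (rs ! r) (cs ! p) = 0" if "p < 4" for p using Yx that by fastforce
    have z: "residue_entry \<pi> (rs ! r) j = 0" for j
      using row0 ex_index_of_member[OF cs(2)] off unfolding zero_off_def by metis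
    obtain u v where "set rs \<subseteq> {rs ! r, u, v}" using set_of_three_subset[OF rs(2), of "rs ! r"] row(1) rs by auto
    then have "type_1 P"
      by (intro type_1_if_rows[of u v]) (use off z in \<open>auto simp: zero_off_def\<close>)
    then show ?thesis by simp
  next
    fix p assume col: "p < 4" "\<And>r. r < 3 \<Longrightarrow> case_prod (residue_entry \<pi>) (Y $$ (r, p)) = 0"
    then have col0: "residue_entry \<pi> (rs ! r) (cs ! p) = 0" if "r < 3" for r using Yx that by fastforce
    have z: "residue_entry \<pi> i (cs ! p) = 0" for i
      using col0 ex_index_of_member[OF rs(2)] off unfolding zero_off_def by metis
    have "type_3 P"
      by (rule type_3_if_lists[OF rs, of "remove1 (cs ! p) cs"])
        (use cs col(1) off z in \<open>auto simp: length_remove1 zero_off_def\<close>)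
    then show ?thesis by simp
  qed
qed

lemma type_if_three_cols:
  assumes rs: "distinct rs" "length rs = 4" and cs: "distinct cs" "length cs = 3"
    and off: "zero_off (set rs) (set cs) (residue_entry \<pi>)"
  shows "type_1 P \<or> type_3 P \<or> type_3A P"
proof -
  define Y where "Y = transpose_mat (sub_indices rs cs)"
  have Y: "Y \<in> carrier_mat 3 4" using rs cs by (simp add: Y_def sub_indices_def)
  have Yx: "Y $$ (r, p) = (rs ! p, cs ! r)" if "r < 3" "p < 4" for r p
    using that rs cs by (simp add: Y_def sub_indices_def)
  have inj: "Y $$ (r, p) = Y $$ (r', p') \<longleftrightarrow> r = r' \<and> p = p'" if "r < 3" "p < 4" "r' < 3" "p' < 4" for r p r' p'
    using that rs cs by (auto simp: Yx nth_eq_iff_index_eq)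
  have J: "J3_P Y q \<in> P" if q: "q < 4" for q
  proof -
    have sk: "skip q 0 < 4" "skip q 1 < 4" "skip q 2 < 4" using q by (auto simp: skip_def)
    have "(J3_P Y q :: ('m \<times> 'n, 'k) mpoly) = tripling (generic_entry (rs ! skip q 0)) (generic_entry (rs ! skip q 1))
        (generic_entry (rs ! skip q 2)) (cs ! 0) (cs ! 1) (cs ! 2)"
      using sk by (simp add: J3_P_tripling[OF Y inj q] tripling_def pairing_def generic_entry_def Yx algebra_simps)
    moreover have "\<dots> \<in> P"
      by (rule tripling_in_P[OF \<pi> ker P]) (use rs cs sk in \<open>auto simp: nth_eq_iff_index_eq skip_def\<close>)
    ultimately show ?thesis by simp
  qed
  show ?thesis
  proof (rule J3_le_or_zero_line[OF Y])
    show "Y $$ (r, p) = Y $$ (r', p') \<longleftrightarrow> r = r' \<and> p = p'" if "r < 3" "p < 4" "r' < 3" "p' < 4" for r p r' p'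
      using that by (rule inj)
    show "J3_P Y q \<in> P" if "q < 4" for q using that by (rule J)
  next
    assume "J3 Y \<subseteq> P"
    moreover have "indet ` (- (set rs \<times> set cs)) \<subseteq> P"
      using off residue_entry_0[OF \<pi> ker P] unfolding zero_off_def by auto
    moreover have "prime_ideal P" using P unfolding minimal_prime_over_def by blast
    ultimately have "type_3A P"
      unfolding type_3A_def index_list_def Y_def using rs cs
      by (intro conjI exI[of _ rs] exI[of _ cs]) simp_all
    then show ?thesis by simp
  next
    fix r assume row: "r < 3" "\<And>p. p < 4 \<Longrightarrow> case_prod (residue_entry \<pi>) (Y $$ (r, p)) = 0"
    then have row0: "residue_entry \<pi> (rs ! p) (cs ! r) = 0" if "p < 4" for p using Yx that by fastforce
    have z: "residue_entry \<pi> i (cs ! r) = 0" for i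
      using row0 ex_index_of_member[OF rs(2)] off unfolding zero_off_def by metis
    obtain u v where "set cs \<subseteq> {cs ! r, u, v}" using set_of_three_subset[OF cs(2), of "cs ! r"] row(1) cs by auto
    then have "type_1 P"
      by (intro type_1_if_cols[of u v]) (use off z in \<open>auto simp: zero_off_def\<close>)
    then show ?thesis by simp
  next
    fix p assume col: "p < 4" "\<And>r. r < 3 \<Longrightarrow> case_prod (residue_entry \<pi>) (Y $$ (r, p)) = 0"
    then have col0: "residue_entry \<pi> (rs ! p) (cs ! r) = 0" if "r < 3" for r using Yx that by fastforce
    have z: "residue_entry \<pi> (rs ! p) j = 0" for j
      using col0 ex_index_of_member[OF cs(2)] off unfolding zero_off_def by metis
    have "type_3 P"
      by (rule type_3_if_lists[OF _ _ cs, of "remove1 (rs ! p) rs"])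
        (use rs col(1) off z in \<open>auto simp: length_remove1 zero_off_def\<close>)
    then show ?thesis by simp
  qed
qed

lemma minimal_prime_type:
  assumes three: "(3::'f) \<noteq> 0"
  shows "type_1 P \<or> type_2 P \<or> type_3 P \<or> type_3A P \<or> type_2_2 P"
proof -
  have "type_1 P \<or> type_3 P \<or> type_3A P" if "shape_3 (residue_entry \<pi>)"
  proof -
    from that obtain R C where "card R \<le> 3 \<and> card C \<le> 4 \<or> card R \<le> 4 \<and> card C \<le> 3"
      and off: "zero_off R C (residue_entry \<pi>)" unfolding shape_3_def by blast
    then show ?thesis
    proof (elim disjE conjE)
      assume c: "card R \<le> 3" "card C \<le> 4"
      show ?thesis
        by (rule zero_off_superset[OF off c(1) _ c(2) n]) (use m type_if_three_rows in auto)
    next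
      assume c: "card R \<le> 4" "card C \<le> 3"
      show ?thesis
        by (rule zero_off_superset[OF off c(1) m c(2)]) (use n type_if_three_cols in auto)
    qed
  qed
  then show ?thesis
    using perm_null_shape[OF two three m n perm_null_residue[OF \<pi> ker P]]
      type_1_if_shape[OF \<pi> ker P] type_2_if_shape[OF \<pi> ker P] type_2_2_if_shape[OF \<pi> ker P] by blast
qed

end

section \<open>The residue field of a selected counterexample\<close>

definition untyped_minimal_prime :: "('m::finite \<times> 'n::finite, 'k::field) mpoly set \<Rightarrow> bool" where
  "untyped_minimal_prime P \<longleftrightarrow> minimal_prime_over (permanental_ideal 3) P \<and>
     \<not> (type_1 P \<or> type_2 P \<or> type_3 P \<or> type_3A P \<or> type_2_2 P)"

text \<open>
  A type cannot depend on a prime ideal chosen inside a proof.  It can depend on a constant, and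
  it is enough to treat a single counterexample, selected by the choice operator if there is one.
\<close>

definition selected_prime :: "('m::finite \<times> 'n::finite, 'k::field) mpoly set" where
  "selected_prime = (SOME P. prime_ideal P \<and> (Ex (untyped_minimal_prime :: ('m \<times> 'n, 'k) mpoly set \<Rightarrow> bool)
     \<longrightarrow> untyped_minimal_prime P))"

text \<open>Primality has to hold unconditionally, because the quotient type is formed before any
  counterexample is assumed. If there is none, an ideal generated by indeterminates shows that the
  choice is still possible.\<close>

lemma selected_prime:
  "prime_ideal (selected_prime :: ('m::finite \<times> 'n::finite, 'k::field) mpoly set)"
  "untyped_minimal_prime (P :: ('m \<times> 'n, 'k) mpoly set) \<Longrightarrow>
     untyped_minimal_prime (selected_prime :: ('m \<times> 'n, 'k) mpoly set)"
proof -
  let ?Q = "\<lambda>P :: ('m \<times> 'n, 'k) mpoly set. prime_ideal P \<and>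
    (Ex (untyped_minimal_prime :: ('m \<times> 'n, 'k) mpoly set \<Rightarrow> bool) \<longrightarrow> untyped_minimal_prime P)"
  have "\<exists>P. ?Q P"
  proof (cases "Ex (untyped_minimal_prime :: ('m \<times> 'n, 'k) mpoly set \<Rightarrow> bool)")
    case True
    then show ?thesis unfolding untyped_minimal_prime_def minimal_prime_over_def by blast
  next
    case False
    then show ?thesis using prime_ideal_indets by blast
  qed
  then have "?Q selected_prime" unfolding selected_prime_def by (rule someI_ex)
  then show "prime_ideal (selected_prime :: ('m \<times> 'n, 'k) mpoly set)"
    "untyped_minimal_prime P \<Longrightarrow> untyped_minimal_prime (selected_prime :: ('m \<times> 'n, 'k) mpoly set)" by blast+
qed

lemmas selected_prime_ideal = prime_idealD(1)[OF selected_prime(1)]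

quotient_type (overloaded) ('m, 'n, 'k) residue = "('m::finite \<times> 'n::finite, 'k::field) mpoly" /
  "\<lambda>f g. f - g \<in> selected_prime"
proof (rule equivpI)
  show "reflp (\<lambda>f g :: ('m \<times> 'n, 'k) mpoly. f - g \<in> selected_prime)"
    by (rule reflpI) (simp add: ideal_0[OF selected_prime_ideal])
  show "symp (\<lambda>f g :: ('m \<times> 'n, 'k) mpoly. f - g \<in> selected_prime)"
    by (rule sympI) (use ideal_uminus[OF selected_prime_ideal] in fastforce)
  show "transp (\<lambda>f g :: ('m \<times> 'n, 'k) mpoly. f - g \<in> selected_prime)"
    by (rule transpI) (use ideal_add[OF selected_prime_ideal] in fastforce)
qed

instantiation residue :: (finite, finite, field) comm_ring_1
begin

lift_definition zero_residue :: "('a, 'b, 'c) residue" is 0 .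
lift_definition one_residue :: "('a, 'b, 'c) residue" is 1 .

lift_definition plus_residue :: "('a, 'b, 'c) residue \<Rightarrow> ('a, 'b, 'c) residue \<Rightarrow> ('a, 'b, 'c) residue" is "(+)"
  using ideal_add[OF selected_prime_ideal] by (simp add: add_diff_add)

lift_definition uminus_residue :: "('a, 'b, 'c) residue \<Rightarrow> ('a, 'b, 'c) residue" is uminus
  using ideal_uminus[OF selected_prime_ideal] by fastforce

lift_definition minus_residue :: "('a, 'b, 'c) residue \<Rightarrow> ('a, 'b, 'c) residue \<Rightarrow> ('a, 'b, 'c) residue" is "(-)"
proof -
  fix f f' g g' :: "('a \<times> 'b, 'c) mpoly"
  assume "f - f' \<in> selected_prime" "g - g' \<in> selected_prime"
  then have "(f - f') - (g - g') \<in> selected_prime" by (rule ideal_diff[OF selected_prime_ideal])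
  then show "f - g - (f' - g') \<in> selected_prime" by (simp add: algebra_simps)
qed

lift_definition times_residue :: "('a, 'b, 'c) residue \<Rightarrow> ('a, 'b, 'c) residue \<Rightarrow> ('a, 'b, 'c) residue" is "(*)"
proof -
  fix f f' g g' :: "('a \<times> 'b, 'c) mpoly"
  assume "f - f' \<in> selected_prime" "g - g' \<in> selected_prime"
  then have "f * (g - g') + g' * (f - f') \<in> selected_prime"
    using ideal_add[OF selected_prime_ideal] ideal_mult_left[OF selected_prime_ideal] by blast
  then show "f * g - f' * g' \<in> selected_prime" by (simp add: algebra_simps)
qed

instance
proof
  show "(0 :: ('a, 'b, 'c) residue) \<noteq> 1"
  proof transfer
    have "(0 - 1 :: ('a \<times> 'b, 'c) mpoly) \<notin> selected_prime"
      using ideal_uminus[OF selected_prime_ideal, of "- 1 :: ('a \<times> 'b, 'c) mpoly"]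
        prime_idealD(2)[OF selected_prime(1)] by auto
    then show "\<not> (0 - 1 :: ('a \<times> 'b, 'c) mpoly) \<in> selected_prime" .
  qed
qed (transfer; simp add: algebra_simps ideal_0[OF selected_prime_ideal])+

end

instance residue :: (finite, finite, field) idom
proof
  fix a b :: "('a, 'b, 'c) residue"
  assume "a \<noteq> 0" "b \<noteq> 0"
  then show "a * b \<noteq> 0"
    by transfer (use prime_idealD(3)[OF selected_prime(1)] in auto)
qed

lemma comm_ring_hom_abs_residue: "comm_ring_hom abs_residue"
  by unfold_locales (simp_all add: zero_residue_def one_residue_def plus_residue.abs_eq times_residue.abs_eq)

lemma comm_ring_hom_Fract: "comm_ring_hom (\<lambda>a. Fract a 1)"
  by unfold_locales (simp_all add: Zero_fract_def One_fract_def)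

text \<open>A nonzero element of the coefficient field is a unit, and ring homomorphisms preserve
  units.\<close>

lemma of_nat_hom_nonzero:
  fixes \<pi> :: "('v, 'k::field) mpoly \<Rightarrow> 'f::field"
  assumes \<pi>: "comm_ring_hom \<pi>" and "of_nat c \<noteq> (0::'k)"
  shows "of_nat c \<noteq> (0::'f)"
proof -
  interpret h: comm_ring_hom "\<lambda>a. \<pi> (const a)" by (rule comm_ring_hom_comp[OF \<pi> comm_ring_hom_const])
  have "\<pi> (const (of_nat c)) * \<pi> (const (inverse (of_nat c))) = \<pi> (const 1)"
    using assms(2) by (simp flip: h.hom_mult)
  moreover have "\<pi> (const (of_nat c)) = of_nat c" by (induction c) (simp_all add: h.hom_add)
  ultimately show ?thesis using h.hom_one by auto
qed

theorem corollary15: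
  assumes "CARD('m::finite) \<ge> 4" and "CARD('n::finite) \<ge> 4"
  shows "(CHAR('k::field) \<noteq> 2 \<and> CHAR('k) \<noteq> 3 \<longrightarrow>
            (\<forall>P :: ('m \<times> 'n, 'k) mpoly set.
               minimal_prime_over (permanental_ideal 3) P \<longrightarrow>
                 type_1 P \<or> type_2 P \<or> type_3 P \<or> type_3A P \<or> type_2_2 P)) \<and>
         (CHAR('k) = 3 \<longrightarrow>
            (let D = determinantal_ideal 2 :: ('m \<times> 'n, 'k) mpoly set
             in minimal_prime_over (permanental_ideal 3) D \<and>
                \<not> (type_1 D \<or> type_2 D \<or> type_3 D \<or> type_3A D \<or> type_2_2 D)))"
proof (intro conjI impI allI)
  fix P :: "('m \<times> 'n, 'k) mpoly set"
  assume char: "CHAR('k) \<noteq> 2 \<and> CHAR('k) \<noteq> 3" and P: "minimal_prime_over (permanental_ideal 3) P"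
  show "type_1 P \<or> type_2 P \<or> type_3 P \<or> type_3A P \<or> type_2_2 P"
  proof (rule ccontr)
    assume "\<not> ?thesis"
    then have "untyped_minimal_prime P" using P unfolding untyped_minimal_prime_def by blast
    \<comment> \<open>Only \<open>selected_prime\<close> has a residue field available as a type;
      any counterexample makes it a counterexample too.\<close>
    then have U: "untyped_minimal_prime (selected_prime :: ('m \<times> 'n, 'k) mpoly set)"
      by (rule selected_prime(2))
    define \<pi> :: "('m \<times> 'n, 'k) mpoly \<Rightarrow> ('m, 'n, 'k) residue fract" where "\<pi> f = Fract (abs_residue f) 1" for f
    have \<pi>: "comm_ring_hom \<pi>"
      unfolding \<pi>_def by (rule comm_ring_hom_comp[OF comm_ring_hom_Fract comm_ring_hom_abs_residue])
    have ker: "\<pi> f = 0 \<longleftrightarrow> f \<in> selected_prime" for f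
    proof -
      have "\<pi> f = 0 \<longleftrightarrow> abs_residue f = 0" by (simp add: \<pi>_def Zero_fract_def eq_fract)
      then show ?thesis by (simp add: zero_residue_def residue.abs_eq_iff)
    qed
    have "CHAR('k) \<noteq> 1" by simp
    have "\<not> CHAR('k) dvd 2" "\<not> CHAR('k) dvd 3"
    proof -
      have "c = 1 \<or> c = 2" if "c dvd 2" for c :: nat
        using that dvd_imp_le[OF that] by (cases "c = 0") auto
      moreover have "c = 1 \<or> c = 3" if "c dvd 3" for c :: nat
      proof -
        have "c = 0 \<or> c = 1 \<or> c = 2 \<or> c = 3" using dvd_imp_le[OF that] by auto
        then show ?thesis using that by auto
      qed
      ultimately show "\<not> CHAR('k) dvd 2" "\<not> CHAR('k) dvd 3"
        using char \<open>CHAR('k) \<noteq> 1\<close> by metis+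
    qed
    then have "of_nat 2 \<noteq> (0::'k)" "of_nat 3 \<noteq> (0::'k)" by (simp_all only: of_nat_eq_0_iff_char_dvd not_False_eq_True)
    then have "(2 :: ('m, 'n, 'k) residue fract) \<noteq> 0" "(3 :: ('m, 'n, 'k) residue fract) \<noteq> 0"
      using of_nat_hom_nonzero[OF \<pi>, of 2] of_nat_hom_nonzero[OF \<pi>, of 3] by simp_all
    then show False
      using minimal_prime_type[OF _ assms \<pi> ker] U unfolding untyped_minimal_prime_def by blast
  qed
next
  assume char: "CHAR('k) = 3"
  show "let D = determinantal_ideal 2 :: ('m \<times> 'n, 'k) mpoly set
     in minimal_prime_over (permanental_ideal 3) D \<and>
        \<not> (type_1 D \<or> type_2 D \<or> type_3 D \<or> type_3A D \<or> type_2_2 D)"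
    unfolding Let_def
    using determinantal_2_minimal[OF assms char] determinantal_2_not_type[OF assms refl] by blast
qed

end
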